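(* Let $N \geq 2$ and $\frac{N}{2} < p \leq N$. If $\frac{N}{2} < p < N$, assume $f \in L^p(\mathbb{R}^N)$; if $p = N$, assume $f \in L^N(\mathbb{R}^N) \cap L^q(\mathbb{R}^N)$ for some $1 < q < N$. Then there exists $u \in L^1_{loc}(\mathbb{R}^N)$ such that $$-\int_{\mathbb{R}^N} u\, \Delta \varphi \,dx= \int_{\mathbb{R}^N} f \varphi\,dx \quad \text{for all } \varphi \in C_c^\infty(\mathbb{R}^N), \qquad (\ast)$$ and for which the following regularity estimates hold. (i) If $\frac{N}{2} < p < N$, then for all $x,z\in\mathbb{R}^N$ $$|u(x) - u(z)| \leq C|x-z|^{2-\frac{N}{p}} \|f\|_{L^p(\mathbb{R}^N)},$$ with a constant $C$ depending only on $N$ and $p$. (ii) If $p = N$, then for all $x,z\in\mathbb{R}^N$ $$|u(x) - u(z)| \leq C|x-z| \left(\left|\ln|x-z|\right| + 1\right)^{\frac{1}{N'}} \left(\|f\|_{L^N(\mathbb{R}^N)} + \|f\|_{L^q(\mathbb{R}^N)}\right),$$ with a constant $C$ depending only on $N$ and $q$. In particular, this solution satisfies $\frac{u(x)}{|x|} \to 0$ as $|x| \to \infty$, and hence it is unique up to a constant: any $v \in L^1_{loc}(\mathbb{R}^N)$ that satisfies $(\ast)$ (with $v$ in place of $u$) and $\frac{v(x)}{|x|} \to 0$ as $|x|\to\infty$ differs from $u$ by an additive constant.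
   Context: $N' = \frac{N}{N-1}$ is the Hölder conjugate exponent of $N$. Functions in $L^1_{loc}(\mathbb{R}^N)$ are identified when they agree almost everywhere; the pointwise estimates are for a suitable (continuous) representative of $u$, and the growth condition on a function $v\in L^1_{loc}(\mathbb{R}^N)$ and equality up to a constant are understood up to null sets. When $x=z$ the right-hand side of (ii) is interpreted as $0$. *)

theory Defs
  imports "HOL-Analysis.Analysis"
begin

definition partial_deriv :: "'a::euclidean_space \<Rightarrow> ('a \<Rightarrow> real) \<Rightarrow> 'a \<Rightarrow> real" where
  "partial_deriv e f x = frechet_derivative f (at x) e"

primrec C_k :: "nat \<Rightarrow> ('a::euclidean_space \<Rightarrow> real) \<Rightarrow> bool" where
  "C_k 0 f \<longleftrightarrow> continuous_on UNIV f"
| "C_k (Suc k) f \<longleftrightarrow>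
     (\<forall>x. f differentiable (at x)) \<and> (\<forall>e\<in>Basis. C_k k (partial_deriv e f))"

definition test_functions :: "('a::euclidean_space \<Rightarrow> real) set" where
  "test_functions = {\<phi>. (\<forall>k. C_k k \<phi>) \<and> compact (closure {x. \<phi> x \<noteq> 0})}"

definition laplacian :: "('a::euclidean_space \<Rightarrow> real) \<Rightarrow> 'a \<Rightarrow> real" where
  "laplacian f x = (\<Sum>e\<in>Basis. partial_deriv e (partial_deriv e f) x)"

(* Elements are functions, not equivalence classes; used for 0 < p only. *)
definition Lp :: "real \<Rightarrow> ('a::euclidean_space \<Rightarrow> real) set" where
  "Lp p = {f. f \<in> borel_measurable lebesgue \<and> integrable lebesgue (\<lambda>x. \<bar>f x\<bar> powr p)}"

definition Lp_norm :: "real \<Rightarrow> ('a::euclidean_space \<Rightarrow> real) \<Rightarrow> real" where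
  "Lp_norm p f = (LINT x|lebesgue. \<bar>f x\<bar> powr p) powr (1 / p)"

definition L1_loc :: "('a::euclidean_space \<Rightarrow> real) set" where
  "L1_loc = {u. \<forall>K. compact K \<longrightarrow> u absolutely_integrable_on K}"

definition weak_poisson_solution ::
    "('a::euclidean_space \<Rightarrow> real) \<Rightarrow> ('a \<Rightarrow> real) \<Rightarrow> bool" where
  "weak_poisson_solution u f \<longleftrightarrow>
     (\<forall>\<phi>\<in>test_functions.
        - (LINT x|lebesgue. u x * laplacian \<phi> x) = (LINT x|lebesgue. f x * \<phi> x))"

(* v(x) / |x| tends to 0 as |x| tends to infinity, up to null sets. *)
definition ess_sublinear :: "('a::euclidean_space \<Rightarrow> real) \<Rightarrow> bool" where
  "ess_sublinear v \<longleftrightarrow>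
     (\<forall>\<epsilon>>0. \<exists>R. AE x in lebesgue. R \<le> norm x \<longrightarrow> \<bar>v x / norm x\<bar> < \<epsilon>)"

definition holder_conj :: "real \<Rightarrow> real" where
  "holder_conj r = r / (r - 1)"

end

theory Submission
  imports Defs
begin

text \<open>
Let \<open>N\<close> be the dimension and let \<open>E\<close> be the Newton kernel, that is \<open>norm x powr (2 - N) / (N - 2)\<close>, or
\<open>- ln (norm x)\<close> if \<open>N = 2\<close>, whose radial derivative is \<open>- (r powr (1 - N))\<close> in every dimension. The
solution is the Newton potential
\<open>u x = (1 / \<kappa>) * \<integral> (E (x - y) - E (- y)) * f y dy\<close>. Subtracting \<open>E (- y)\<close> makes the integral
converge at infinity, and it disappears from \<open>u x - u z\<close>. So existence and regularity come from one estimate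
for \<open>\<integral> \<bar>E (x - y) - E (z - y)\<bar> * \<bar>f y\<bar> dy\<close>.

\<^bold>\<open>Regularity.\<close> For \<open>0 < \<theta> \<le> 1\<close> the kernel satisfies
\<open>\<bar>E a - E b\<bar> \<le> h powr \<theta> * m powr (2 - N - \<theta>) / \<theta>\<close>, where \<open>h\<close> bounds the difference of the norms of
\<open>a\<close> and \<open>b\<close> and \<open>m\<close> is the smaller of the two norms (\<open>newton_abs_diff_le\<close>).
A small \<open>\<theta>\<close> is used where \<open>m < h\<close>, and \<open>\<theta> = 1\<close> elsewhere. With \<open>p'\<close> the conjugate exponent
of \<open>p\<close>, the first power is \<open>p'\<close>-integrable near the origin because \<open>p > N / 2\<close>, the second one at
infinity because \<open>p < N\<close>. Hoelder's inequality and scaling give the factor \<open>h powr (2 - N / p)\<close>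
(\<open>newton_kernel_Holder_bound\<close>). For \<open>p = N\<close> the second power is critical: each dyadic shell between the radii
\<open>h\<close> and \<open>1\<close> contributes the same amount, there are about \<open>\<bar>ln h\<bar>\<close> such shells, and the part beyond the radius \<open>1\<close> is
controlled by the \<open>q\<close>-norm (\<open>newton_kernel_log_bound\<close>). In that case \<open>f\<close> also lies in \<open>Lp r\<close> for
some \<open>r < N\<close> with \<open>r > N / 2\<close>, so all qualitative properties of \<open>u\<close>, including its sublinear growth, are those of
the subcritical case.

\<^bold>\<open>Equation.\<close> By Fubini it suffices that \<open>\<integral> E (x - y) * laplacian \<phi> x dx = - \<kappa> * \<phi> y\<close>
(\<open>newton_kernel_fundamental\<close>). Replace \<open>norm x\<close> by \<open>sqrt ((norm x)\<^sup>2 + \<epsilon>\<^sup>2)\<close> in \<open>E\<close>. The resulting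
smooth function has as negative Laplacian the rescaling, with mass \<open>\<kappa>\<close>, of one integrable profile,
hence an approximate identity; the second Green identity and \<open>\<epsilon> \<rightarrow> 0\<close> give the claim.

\<^bold>\<open>Uniqueness.\<close> The difference \<open>w\<close> of two solutions is weakly harmonic and sublinear. For a radial bump \<open>\<Phi>\<close> the derivative
of \<open>t powr (- N) * \<Phi> ((y - a) / t)\<close> in \<open>t\<close> is the Laplacian of a test function (\<open>DERIV_mean_bump\<close>), so the average
of \<open>w\<close> against this dilated bump does not depend on \<open>t\<close>. For large \<open>t\<close> the averages around two centres
differ by \<open>o(1)\<close>, since \<open>w\<close> is sublinear; hence they agree. So all averages of \<open>w\<close> equal those of one
constant, and \<open>w\<close> is that constant almost everywhere (\<open>Liouville_weakly_harmonic\<close>).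
\<close>

section \<open>Integration on Euclidean space\<close>

lemma nn_integral_lborel_affine:
  fixes f :: "'a::euclidean_space \<Rightarrow> ennreal" and t :: 'a
  assumes [measurable]: "f \<in> borel_measurable borel" and c: "c \<noteq> 0"
  shows "(\<integral>\<^sup>+x. f x \<partial>lborel) = ennreal (\<bar>c\<bar> ^ DIM('a)) * (\<integral>\<^sup>+x. f (t + c *\<^sub>R x) \<partial>lborel)"
  by (subst lborel_affine[OF c, of t]) (simp add: nn_integral_density nn_integral_distr nn_integral_cmult)

lemma integrable_lborel_affine:
  fixes f :: "'a::euclidean_space \<Rightarrow> real" and t :: 'a
  assumes f: "integrable lborel f" and c: "c \<noteq> 0"
  shows "integrable lborel (\<lambda>x. f (t + c *\<^sub>R x))"
proof -
  have [measurable]: "f \<in> borel_measurable borel" using f by auto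
  have "ennreal (\<bar>c\<bar> ^ DIM('a)) * (\<integral>\<^sup>+x. ennreal (norm (f (t + c *\<^sub>R x))) \<partial>lborel) < \<infinity>"
    using f nn_integral_lborel_affine[of "\<lambda>x. ennreal (norm (f x))" c t] c
    by (auto simp: integrable_iff_bounded)
  hence "(\<integral>\<^sup>+x. ennreal (norm (f (t + c *\<^sub>R x))) \<partial>lborel) < \<infinity>"
    using c by (auto simp: ennreal_mult_less_top)
  thus ?thesis by (auto simp: integrable_iff_bounded)
qed

lemma integral_lborel_affine:
  fixes f :: "'a::euclidean_space \<Rightarrow> real" and t :: 'a
  assumes f: "integrable lborel f" and c: "c \<noteq> 0"
  shows "(LBINT x. f x) = \<bar>c\<bar> ^ DIM('a) * (LBINT x. f (t + c *\<^sub>R x))"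
proof -
  have [measurable]: "f \<in> borel_measurable borel" using f by auto
  show ?thesis
    using integrable_lborel_affine[OF f c, of t]
    by (subst lborel_affine[OF c, of t]) (simp add: integral_density integral_distr)
qed

text \<open>
Young's inequality for the functions divided by their norms. If one of the norms is zero, the product
vanishes almost everywhere.
\<close>

lemma Holder_inequality:
  fixes f g :: "'a \<Rightarrow> real"
  assumes pq: "p > 1" "q > 1" "1/p + 1/q = 1"
    and [measurable]: "f \<in> borel_measurable M" "g \<in> borel_measurable M"
    and f: "integrable M (\<lambda>x. \<bar>f x\<bar> powr p)" and g: "integrable M (\<lambda>x. \<bar>g x\<bar> powr q)"
  shows "integrable M (\<lambda>x. f x * g x)"
    and "(\<integral>x. \<bar>f x * g x\<bar> \<partial>M) \<le> (\<integral>x. \<bar>f x\<bar> powr p \<partial>M) powr (1/p) * (\<integral>x. \<bar>g x\<bar> powr q \<partial>M) powr (1/q)"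
proof -
  have Y: "\<bar>f x * g x\<bar> \<le> \<bar>f x\<bar> powr p / p + \<bar>g x\<bar> powr q / q" for x
    using Youngs_inequality[OF pq, of "\<bar>f x\<bar>" "\<bar>g x\<bar>"] by (simp add: abs_mult)
  show int: "integrable M (\<lambda>x. f x * g x)"
  proof (rule Bochner_Integration.integrable_bound[where f = "\<lambda>x. \<bar>f x\<bar> powr p / p + \<bar>g x\<bar> powr q / q"])
    show "AE x in M. norm (f x * g x) \<le> norm (\<bar>f x\<bar> powr p / p + \<bar>g x\<bar> powr q / q)"
    proof (rule AE_I2)
      fix x show "norm (f x * g x) \<le> norm (\<bar>f x\<bar> powr p / p + \<bar>g x\<bar> powr q / q)"
        using Y[of x] abs_ge_self[of "\<bar>f x\<bar> powr p / p + \<bar>g x\<bar> powr q / q"] unfolding real_norm_def by linarith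
    qed
  qed (use f g in auto)
  define A where "A = (\<integral>x. \<bar>f x\<bar> powr p \<partial>M)"
  define B where "B = (\<integral>x. \<bar>g x\<bar> powr q \<partial>M)"
  have nn: "A \<ge> 0" "B \<ge> 0" by (auto simp: A_def B_def)
  show "(\<integral>x. \<bar>f x * g x\<bar> \<partial>M) \<le> A powr (1/p) * B powr (1/q)"
  proof (cases "A = 0 \<or> B = 0")
    case True
    have "AE x in M. f x * g x = 0"
    proof (cases "A = 0")
      case True
      hence "AE x in M. \<bar>f x\<bar> powr p = 0"
        unfolding A_def by (subst (asm) integral_nonneg_eq_0_iff_AE) (use f in auto)
      thus ?thesis by eventually_elim auto
    next
      case False
      hence "B = 0" using True by simp
      hence "AE x in M. \<bar>g x\<bar> powr q = 0"
        unfolding B_def by (subst (asm) integral_nonneg_eq_0_iff_AE) (use g in auto)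
      thus ?thesis by eventually_elim auto
    qed
    hence "(\<integral>x. \<bar>f x * g x\<bar> \<partial>M) = (\<integral>x. 0 \<partial>M)"
      by (intro integral_cong_AE) auto
    thus ?thesis by simp
  next
    case False
    hence pos: "A > 0" "B > 0" using nn by auto
    define a where "a = A powr (1/p)"
    define b where "b = B powr (1/q)"
    have ab: "a > 0" "b > 0" "a powr p = A" "b powr q = B"
      using pos pq by (auto simp: a_def b_def powr_powr)
    have Y2: "\<bar>f x * g x\<bar> \<le> a * b * (\<bar>f x\<bar> powr p / (p * A) + \<bar>g x\<bar> powr q / (q * B))" for x
    proof -
      have "(\<bar>f x\<bar> / a) * (\<bar>g x\<bar> / b) \<le> (\<bar>f x\<bar> / a) powr p / p + (\<bar>g x\<bar> / b) powr q / q"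
        using Youngs_inequality[OF pq, of "\<bar>f x\<bar> / a" "\<bar>g x\<bar> / b"] ab by simp
      also have "\<dots> = \<bar>f x\<bar> powr p / (p * A) + \<bar>g x\<bar> powr q / (q * B)"
        using ab by (simp add: powr_divide mult.commute)
      finally show ?thesis using ab by (simp add: abs_mult field_simps)
    qed
    have "(\<integral>x. \<bar>f x * g x\<bar> \<partial>M) \<le> (\<integral>x. a * b * (\<bar>f x\<bar> powr p / (p * A) + \<bar>g x\<bar> powr q / (q * B)) \<partial>M)"
      using f g int Y2 by (intro integral_mono) auto
    also have "\<dots> = a * b * (A / (p * A) + B / (q * B))"
      using f g by (simp add: A_def B_def)
    also have "\<dots> = a * b * (1/p + 1/q)" using pos by simp
    finally show ?thesis using pq by (simp add: a_def b_def)
  qed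
qed

lemma Fubini_integral_dominated:
  fixes F :: "'a::euclidean_space \<Rightarrow> 'b::euclidean_space \<Rightarrow> real"
  assumes F: "case_prod F \<in> borel_measurable (lborel \<Otimes>\<^sub>M lborel)"
    and int: "\<And>x. integrable lborel (F x)" and g: "integrable lborel g"
    and le: "\<And>x. (LBINT y. \<bar>F x y\<bar>) \<le> g x"
  shows "(LBINT y. LBINT x. F x y) = (LBINT x. LBINT y. F x y)"
proof (rule lborel_pair.Fubini_integral, rule lborel_pair.Fubini_integrable[OF F])
  show "integrable lborel (\<lambda>x. LBINT y. norm (case (x, y) of (x, y) \<Rightarrow> F x y))"
  proof (rule Bochner_Integration.integrable_bound[OF g])
    show "(\<lambda>x. LBINT y. norm (case (x, y) of (x, y) \<Rightarrow> F x y)) \<in> borel_measurable lborel"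
      using F by measurable
    show "AE x in lborel. norm (LBINT y. norm (case (x, y) of (x, y) \<Rightarrow> F x y)) \<le> norm (g x)"
      using le by (intro AE_I2) (auto intro: order.trans[OF _ abs_ge_self])
  qed
qed (use int in auto)

text \<open>
The mean value theorem bounds the difference quotients by \<open>g\<close>, so dominated convergence applies.
The lemma serves twice: for the translates of a function of compact support, and for the dilates of a bump.
\<close>

lemma has_real_derivative_integral:
  fixes \<Lambda> :: "real \<Rightarrow> 'a \<Rightarrow> real"
  assumes \<delta>: "0 < \<delta>"
    and int: "\<And>t. \<bar>t - t0\<bar> < \<delta> \<Longrightarrow> integrable M (\<Lambda> t)"
    and deriv: "\<And>t x. \<bar>t - t0\<bar> < \<delta> \<Longrightarrow> ((\<lambda>s. \<Lambda> s x) has_real_derivative \<Lambda>' t x) (at t)"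
    and bound: "\<And>t x. \<bar>t - t0\<bar> < \<delta> \<Longrightarrow> \<bar>\<Lambda>' t x\<bar> \<le> g x"
    and g: "integrable M g"
  shows "((\<lambda>t. \<integral>x. \<Lambda> t x \<partial>M) has_real_derivative (\<integral>x. \<Lambda>' t0 x \<partial>M)) (at t0)"
  unfolding DERIV_def tendsto_at_iff_sequentially
proof (intro allI impI, unfold comp_def)
  fix X :: "nat \<Rightarrow> real" assume X: "\<forall>i. X i \<in> UNIV - {0}" "X \<longlonglongrightarrow> 0"
  have "eventually (\<lambda>i. \<bar>X i\<bar> < \<delta>) sequentially"
    using X(2) \<delta> by (simp add: tendsto_iff dist_real_def)
  then obtain n0 where n0: "\<And>i. i \<ge> n0 \<Longrightarrow> \<bar>X i\<bar> < \<delta>"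
    by (auto simp: eventually_sequentially)
  define Y where "Y i = X (i + n0)" for i
  have Y: "Y i \<noteq> 0" "\<bar>Y i\<bar> < \<delta>" for i using X(1) n0 by (auto simp: Y_def)
  have Y0: "Y \<longlonglongrightarrow> 0" unfolding Y_def using X(2) by (rule LIMSEQ_ignore_initial_segment)
  \<comment> \<open>The shift by \<open>n0\<close> keeps all increments inside the interval where the bound holds.\<close>
  define s where "s i x = (\<Lambda> (t0 + Y i) x - \<Lambda> t0 x) / Y i" for i x
  have int_i: "integrable M (\<Lambda> (t0 + Y i))" for i using int[of "t0 + Y i"] Y by simp
  have int_0: "integrable M (\<Lambda> t0)" using int[of t0] \<delta> by simp
  have s_int: "integrable M (s i)" for i
    unfolding s_def using int_i int_0 by auto
  have lim: "(\<lambda>i. s i x) \<longlonglongrightarrow> \<Lambda>' t0 x" for x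
  proof -
    have "((\<lambda>h. (\<Lambda> (t0 + h) x - \<Lambda> t0 x) / h) \<longlongrightarrow> \<Lambda>' t0 x) (at 0)"
      using deriv[of t0 x] \<delta> by (simp add: DERIV_def)
    thus ?thesis unfolding tendsto_at_iff_sequentially comp_def s_def using Y Y0 by auto
  qed
  have bd: "\<bar>s i x\<bar> \<le> g x" for i x
  proof -
    have "norm (\<Lambda> (t0 + Y i) x - \<Lambda> t0 x) \<le> g x * norm (t0 + Y i - t0)"
    proof (rule field_differentiable_bound[of "{t0 - \<delta><..<t0 + \<delta>}"])
      fix t assume "t \<in> {t0 - \<delta><..<t0 + \<delta>}"
      hence t: "\<bar>t - t0\<bar> < \<delta>" by auto
      show "((\<lambda>s. \<Lambda> s x) has_real_derivative \<Lambda>' t x) (at t within {t0 - \<delta><..<t0 + \<delta>})"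
        by (rule has_field_derivative_at_within[OF deriv[OF t]])
      show "norm (\<Lambda>' t x) \<le> g x" using bound[OF t] by simp
    qed (use Y(2)[of i] \<delta> in auto)
    thus ?thesis using Y(1)[of i] by (simp add: s_def field_simps)
  qed
  have "(\<lambda>i. \<integral>x. s i x \<partial>M) \<longlonglongrightarrow> (\<integral>x. \<Lambda>' t0 x \<partial>M)"
  proof (rule integral_dominated_convergence[where w = g])
    show "\<Lambda>' t0 \<in> borel_measurable M"
      by (rule borel_measurable_LIMSEQ_real[OF lim]) (use s_int in auto)
  qed (use s_int g lim bd in auto)
  moreover have "(\<integral>x. s i x \<partial>M) = ((\<integral>x. \<Lambda> (t0 + Y i) x \<partial>M) - (\<integral>x. \<Lambda> t0 x \<partial>M)) / Y i" for i
    unfolding s_def using int_i int_0 by simp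
  ultimately have "(\<lambda>i. ((\<integral>x. \<Lambda> (t0 + X (i + n0)) x \<partial>M) - (\<integral>x. \<Lambda> t0 x \<partial>M)) / X (i + n0)) \<longlonglongrightarrow> (\<integral>x. \<Lambda>' t0 x \<partial>M)"
    by (simp add: Y_def)
  thus "(\<lambda>i. ((\<integral>x. \<Lambda> (t0 + X i) x \<partial>M) - (\<integral>x. \<Lambda> t0 x \<partial>M)) / X i) \<longlonglongrightarrow> (\<integral>x. \<Lambda>' t0 x \<partial>M)"
    by (rule LIMSEQ_offset)
qed

lemma DERIV_along_line:
  assumes "f differentiable (at (x + t *\<^sub>R e))"
  shows "((\<lambda>s. f (x + s *\<^sub>R e)) has_real_derivative partial_deriv e f (x + t *\<^sub>R e)) (at t)"
proof -
  have 1: "(f has_derivative frechet_derivative f (at (x + t *\<^sub>R e))) (at (x + t *\<^sub>R e))"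
    using assms frechet_derivative_works by blast
  have "((\<lambda>s. x + s *\<^sub>R e) has_derivative (\<lambda>s. s *\<^sub>R e)) (at t)"
    by (auto intro!: derivative_eq_intros)
  from has_derivative_compose[OF this 1]
  have "((\<lambda>s. f (x + s *\<^sub>R e)) has_derivative (\<lambda>s. frechet_derivative f (at (x + t *\<^sub>R e)) (s *\<^sub>R e))) (at t)" .
  moreover have "frechet_derivative f (at (x + t *\<^sub>R e)) (s *\<^sub>R e) = s * partial_deriv e f (x + t *\<^sub>R e)" for s
    using linear_frechet_derivative[OF assms] by (simp add: linear_cmul partial_deriv_def)
  ultimately show ?thesis
    by (simp add: has_field_derivative_def mult_commute_abs)
qed

lemma differentiable_imp_continuous_on_UNIV: "(\<And>x. f differentiable (at x)) \<Longrightarrow> continuous_on UNIV f"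
  by (auto intro!: continuous_at_imp_continuous_on differentiable_imp_continuous_within)

lemma partial_deriv_eq_0:
  assumes "open S" "x \<in> S" "\<And>y. y \<in> S \<Longrightarrow> f y = 0"
  shows "partial_deriv e f x = 0"
proof -
  have "(f has_derivative (\<lambda>h. 0)) (at x)"
    by (rule has_derivative_transform_within_open[of "\<lambda>_. 0", OF _ assms(1,2)]) (use assms(3) in auto)
  thus ?thesis by (simp add: partial_deriv_def frechet_derivative_at[symmetric])
qed

lemma partial_deriv_eq_0_outside:
  assumes "\<And>y. R < norm y \<Longrightarrow> f y = 0" "R < norm x"
  shows "partial_deriv e f x = 0"
  by (rule partial_deriv_eq_0[of "{y. R < norm y}"]) (use assms in \<open>auto intro: open_Collect_less continuous_intros\<close>)

lemma integrable_continuous_compact_support: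
  fixes f :: "'a::euclidean_space \<Rightarrow> real"
  assumes "continuous_on UNIV f" "\<And>x. R < norm x \<Longrightarrow> f x = 0"
  shows "integrable lborel f"
proof -
  have "integrable lborel (\<lambda>x. indicator (cball 0 R) x *\<^sub>R f x)"
    by (rule borel_integrable_compact) (auto intro: continuous_on_subset[OF assms(1)])
  also have "(\<lambda>x. indicator (cball 0 R) x *\<^sub>R f x) = f" using assms(2) by (auto simp: fun_eq_iff indicator_def)
  finally show ?thesis .
qed

lemma integrable_indicator_cball: "integrable lborel (\<lambda>x. indicator (cball a r) x :: real)" for a :: "'a::euclidean_space"
  using emeasure_lborel_cball_finite[of a r] by (intro integrable_real_indicator) auto

lemma bounded_continuous_compact_support:
  fixes f :: "'a::euclidean_space \<Rightarrow> real"
  assumes "continuous_on UNIV f" "\<And>x. R < norm x \<Longrightarrow> f x = 0"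
  obtains B where "B \<ge> 0" "\<And>x. \<bar>f x\<bar> \<le> B"
proof -
  have "compact (f ` cball 0 R)" by (rule compact_continuous_image) (auto intro: continuous_on_subset[OF assms(1)])
  then obtain B where B: "\<And>y. y \<in> f ` cball 0 R \<Longrightarrow> norm y \<le> B" 
    using compact_imp_bounded bounded_iff by metis
  have "\<bar>f x\<bar> \<le> max B 0" for x
  proof (cases "norm x \<le> R")
    case True
    hence "f x \<in> f ` cball 0 R" by auto
    from B[OF this] show ?thesis by (auto simp: max_def)
  qed (use assms(2) in auto)
  thus ?thesis using that[of "max B 0"] by simp
qed

text \<open>
The integral of \<open>F (x + t *\<^sub>R e)\<close> does not depend on \<open>t\<close> by translation invariance, and its
derivative at \<open>t = 0\<close> is the integral of the partial derivative.
\<close>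

lemma integral_partial_deriv_eq_0:
  fixes F :: "'a::euclidean_space \<Rightarrow> real"
  assumes diff: "\<And>x. F differentiable (at x)"
    and cont: "continuous_on UNIV (partial_deriv e F)"
    and supp: "\<And>x. R < norm x \<Longrightarrow> F x = 0"
  shows "(LBINT x. partial_deriv e F x) = 0"
proof -
  have supp': "partial_deriv e F x = 0" if "R < norm x" for x
    by (rule partial_deriv_eq_0_outside[OF supp that])
  obtain B where B: "B \<ge> 0" "\<And>x. \<bar>partial_deriv e F x\<bar> \<le> B"
    by (rule bounded_continuous_compact_support[OF cont supp']) auto
  have Fc: "continuous_on UNIV F"
    by (rule differentiable_imp_continuous_on_UNIV[OF diff])
  have Fi: "integrable lborel F" by (rule integrable_continuous_compact_support[OF Fc supp])
  have trans: "integrable lborel (\<lambda>x. F (x + t *\<^sub>R e))" "(LBINT x. F (x + t *\<^sub>R e)) = (LBINT x. F x)" for t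
    using integrable_lborel_affine[OF Fi, of 1 "t *\<^sub>R e"] integral_lborel_affine[OF Fi, of 1 "t *\<^sub>R e"]
    by (auto simp: add.commute)
  have "((\<lambda>t. LBINT x. F (x + t *\<^sub>R e)) has_real_derivative (LBINT x. partial_deriv e F (x + 0 *\<^sub>R e))) (at 0)"
  proof (rule has_real_derivative_integral[where \<delta> = 1 and g = "\<lambda>x. B * indicator (cball 0 (R + norm e)) x"])
    fix t :: real and x :: 'a assume t: "\<bar>t - 0\<bar> < 1"
    show "\<bar>partial_deriv e F (x + t *\<^sub>R e)\<bar> \<le> B * indicator (cball 0 (R + norm e)) x"
    proof (cases "norm x \<le> R + norm e")
      case False
      have "norm x \<le> norm (x + t *\<^sub>R e) + norm (t *\<^sub>R e)"
        by (metis add_diff_cancel norm_triangle_ineq4)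
      moreover have "norm (t *\<^sub>R e) \<le> norm e" using t by (simp add: mult_left_le_one_le)
      ultimately have "R < norm (x + t *\<^sub>R e)" using False by linarith
      thus ?thesis using supp' B(1) by simp
    qed (use B in auto)
  qed (use trans diff in \<open>auto intro!: DERIV_along_line integrable_mult_right integrable_real_indicator simp: emeasure_lborel_cball_finite[simplified]\<close>)
  hence "((\<lambda>t. LBINT x. F x) has_real_derivative (LBINT x. partial_deriv e F x)) (at 0)"
    by (simp add: trans)
  thus ?thesis using DERIV_unique DERIV_const by blast
qed

section \<open>Integrals of radial powers\<close>

text \<open>
Scaling reduces every dyadic shell to this one.
\<close>

definition annulus_mass :: "'a::euclidean_space itself \<Rightarrow> real \<Rightarrow> ennreal" where
  "annulus_mass _ a = (\<integral>\<^sup>+x. ennreal (indicator {x::'a. 1 \<le> norm x \<and> norm x < 2} x * norm x powr (-a)) \<partial>lborel)"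

lemma annulus_mass_finite: "annulus_mass TYPE('a::euclidean_space) a < \<infinity>"
proof -
  have "annulus_mass TYPE('a) a \<le> (\<integral>\<^sup>+x. ennreal (2 powr \<bar>a\<bar>) * indicator (cball (0::'a) 2) x \<partial>lborel)"
    unfolding annulus_mass_def
  proof (intro nn_integral_mono)
    fix x :: 'a
    have "norm x powr (-a) \<le> 2 powr \<bar>a\<bar>" if "1 \<le> norm x" "norm x < 2"
    proof -
      have "norm x powr (-a) \<le> norm x powr \<bar>a\<bar>" using that by (intro powr_mono) auto
      also have "\<dots> \<le> 2 powr \<bar>a\<bar>" using that by (intro powr_mono2) auto
      finally show ?thesis .
    qed
    thus "ennreal (indicator {x::'a. 1 \<le> norm x \<and> norm x < 2} x * norm x powr (-a)) \<le> ennreal (2 powr \<bar>a\<bar>) * indicator (cball 0 2) x"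
      by (auto simp: indicator_def)
  qed
  also have "\<dots> = ennreal (2 powr \<bar>a\<bar>) * emeasure lborel (cball (0::'a) 2)"
    by (subst nn_integral_cmult_indicator) auto
  also have "\<dots> < \<infinity>" using emeasure_lborel_cball_finite[of "0::'a" 2] by (simp add: ennreal_mult_less_top)
  finally show ?thesis .
qed

lemma nn_integral_annulus:
  assumes r: "r > 0"
  shows "(\<integral>\<^sup>+x. ennreal (indicator {x::'a::euclidean_space. r \<le> norm x \<and> norm x < 2 * r} x * norm x powr (-a)) \<partial>lborel)
           = ennreal (r powr (real DIM('a) - a)) * annulus_mass TYPE('a) a"
proof -
  have "(\<integral>\<^sup>+x. ennreal (indicator {x::'a. r \<le> norm x \<and> norm x < 2 * r} x * norm x powr (-a)) \<partial>lborel)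
      = ennreal (\<bar>r\<bar> ^ DIM('a)) * (\<integral>\<^sup>+x. ennreal (indicator {x::'a. r \<le> norm x \<and> norm x < 2 * r} (0 + r *\<^sub>R x) * norm (0 + r *\<^sub>R x) powr (-a)) \<partial>lborel)"
    using r by (intro nn_integral_lborel_affine) auto
  also have "(\<integral>\<^sup>+x. ennreal (indicator {x::'a. r \<le> norm x \<and> norm x < 2 * r} (0 + r *\<^sub>R x) * norm (0 + r *\<^sub>R x) powr (-a)) \<partial>lborel)
     = (\<integral>\<^sup>+x. ennreal (r powr (-a)) * ennreal (indicator {x::'a. 1 \<le> norm x \<and> norm x < 2} x * norm x powr (-a)) \<partial>lborel)"
    using r by (intro nn_integral_cong) (auto simp: indicator_def powr_mult ennreal_mult')
  also have "\<dots> = ennreal (r powr (-a)) * annulus_mass TYPE('a) a"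
    unfolding annulus_mass_def by (subst nn_integral_cmult) auto
  finally show ?thesis using r
    by (simp add: mult.assoc[symmetric] ennreal_mult'[symmetric] powr_realpow[symmetric] powr_add[symmetric])
qed

lemma dyadic_shell:
  assumes "r > 0"
  obtains k :: int where "2 powr k \<le> r" "r < 2 * 2 powr k"
proof -
  define k where "k = \<lfloor>log 2 r\<rfloor>"
  have "2 powr k \<le> r" using assms by (simp add: powr_le_iff k_def)
  moreover have "log 2 r < k + 1" by (simp add: k_def)
  hence "r < 2 powr (k + 1)" using assms by (simp add: log_less_iff)
  ultimately show ?thesis using that by (simp add: powr_add mult.commute)
qed

lemma ennreal_le_suminf: "f n \<le> (\<Sum>k. f k)" for f :: "nat \<Rightarrow> ennreal"
  using sum_le_suminf[of f "{n}"] by (simp add: summableI)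

lemma suminf_geometric_annuli_finite:
  assumes "d > 0"
  shows "(\<Sum>k. ennreal ((2 powr (- (real k + c))) powr d) * annulus_mass TYPE('a::euclidean_space) a) < \<infinity>"
proof -
  have eq: "(2 powr (- (real k + c))) powr d = 2 powr (-c*d) * (2 powr (-d)) ^ k" for k :: nat
  proof -
    have "(2 powr (-d)) ^ k = (2::real) powr (-d * k)" by (simp add: powr_power mult.commute)
    thus ?thesis by (simp add: powr_powr powr_add[symmetric] algebra_simps)
  qed
  have "(2::real) powr (-d) < 1" using assms by (simp add: powr_less_one)
  hence "summable (\<lambda>k. 2 powr (-c*d) * (2 powr (-d)) ^ k :: real)" by (intro summable_mult summable_geometric) auto
  hence "(\<Sum>k. ennreal (2 powr (-c*d) * (2 powr (-d)) ^ k)) = ennreal (\<Sum>k. 2 powr (-c*d) * (2 powr (-d)) ^ k)"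
    by (intro suminf_ennreal_eq) (auto simp: summable_sums)
  hence "(\<Sum>k. ennreal ((2 powr (- (real k + c))) powr d)) < \<infinity>" unfolding eq by simp
  thus ?thesis using annulus_mass_finite[where 'a='a and a=a] unfolding ennreal_suminf_multc infinity_ennreal_def
    by (intro ennreal_mult_less_top[THEN iffD2]) auto
qed

text \<open>
A power singularity of order \<open>a\<close> at the origin joined to a decay of order \<open>b\<close> at infinity. Since \<open>0 powr s = 0\<close>,
the value at \<open>r = 0\<close> is \<open>0\<close>, so pointwise bounds by a profile hold away from a single point.
\<close>

definition shell_profile :: "real \<Rightarrow> real \<Rightarrow> real \<Rightarrow> real" where
  "shell_profile a b r = (if r < 1 then r powr (-a) else r powr (-b))"

lemma shell_profile_nonneg [simp]: "shell_profile a b r \<ge> 0"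
  by (simp add: shell_profile_def)

lemma measurable_shell_profile [measurable]: "shell_profile a b \<in> borel_measurable borel"
  unfolding shell_profile_def[abs_def] by measurable

text \<open>
The masses of the dyadic shells form a geometric series inside the unit ball, because \<open>a < DIM('a)\<close>, and
another one outside of it, because \<open>DIM('a) < b\<close>.
\<close>

lemma integrable_shell_profile:
  assumes a: "a < real DIM('a::euclidean_space)" and b: "real DIM('a) < b"
  shows "integrable lborel (\<lambda>x::'a. shell_profile a b (norm x))"
proof -
  let ?A = "\<lambda>r. {x::'a. r \<le> norm x \<and> norm x < 2 * r}"
  let ?N = "real DIM('a)"
  let ?i = "\<lambda>k::nat. 2 powr (- (real k + 1)) :: real" and ?o = "\<lambda>k::nat. 2 powr (real k) :: real"
  let ?I = "\<lambda>k x. ennreal (indicator (?A (?i k)) x * norm x powr (-a))"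
  let ?O = "\<lambda>k x. ennreal (indicator (?A (?o k)) x * norm x powr (-b))"
  have "(\<integral>\<^sup>+x. ennreal (shell_profile a b (norm (x::'a))) \<partial>lborel)
     \<le> (\<integral>\<^sup>+x. (\<Sum>k. ?I k x)
              + (\<Sum>k. ?O k x) \<partial>lborel)"
  proof (intro nn_integral_mono)
    fix x :: 'a
    show "ennreal (shell_profile a b (norm x)) \<le> (\<Sum>k. ?I k x)
              + (\<Sum>k. ?O k x)" (is "_ \<le> ?S + ?T")
    proof (cases "x = 0")
      case False
      then obtain k where k: "2 powr real_of_int k \<le> norm x" "norm x < 2 * 2 powr real_of_int k"
        using dyadic_shell[of "norm x"] by auto
      show ?thesis
      proof (cases "norm x < 1")
        case True
        hence "(2::real) powr k < 2 powr 0" using k by simp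
        hence "real_of_int k < 0" by (subst (asm) powr_less_cancel_iff) auto
        define j where "j = nat (- k - 1)"
        have kj: "real_of_int k = - (real j + 1)" using \<open>real_of_int k < 0\<close> by (simp add: j_def)
        have "ennreal (shell_profile a b (norm x)) = ennreal (indicator (?A (?i j)) x * norm x powr (-a))"
          using k True unfolding kj by (simp add: shell_profile_def)
        also have "\<dots> \<le> ?S" by (rule ennreal_le_suminf[of "\<lambda>k. ?I k x" j])
        also have "\<dots> \<le> ?S + ?T" by simp
        finally show ?thesis .
      next
        case False
        hence "(2::real) powr 0 < 2 powr (k + 1)" using k by (simp add: powr_add)
        hence "0 < real_of_int k + 1" by (subst (asm) powr_less_cancel_iff) auto
        define j where "j = nat k"
        have kj: "real_of_int k = real j" using \<open>0 < real_of_int k + 1\<close> by (simp add: j_def)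
        have "ennreal (shell_profile a b (norm x)) = ennreal (indicator (?A (?o j)) x * norm x powr (-b))"
          using k False unfolding kj by (simp add: shell_profile_def)
        also have "\<dots> \<le> ?T" by (rule ennreal_le_suminf[of "\<lambda>k. ?O k x" j])
        also have "\<dots> \<le> ?S + ?T" by simp
        finally show ?thesis .
      qed
    qed (simp add: shell_profile_def)
  qed
  also have "\<dots> = (\<Sum>k. ennreal (?i k powr (?N - a)) * annulus_mass TYPE('a) a)
                + (\<Sum>k. ennreal (?o k powr (?N - b)) * annulus_mass TYPE('a) b)"
    by (subst nn_integral_add) (auto simp: nn_integral_suminf nn_integral_annulus)
  also have "\<dots> = (\<Sum>k. ennreal ((2 powr (- (real k + 1))) powr (?N - a)) * annulus_mass TYPE('a) a)
                + (\<Sum>k. ennreal ((2 powr (- (real k + 0))) powr (b - ?N)) * annulus_mass TYPE('a) b)"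
    by (simp add: powr_powr algebra_simps)
  also have "\<dots> < \<infinity>"
    using suminf_geometric_annuli_finite[of "?N - a" 1, where 'a='a and a=a]
      suminf_geometric_annuli_finite[of "b - ?N" 0, where 'a='a and a=b] a b
    by (simp only: infinity_ennreal_def ennreal_add_less_top diff_gt_0_iff_gt)
  finally show ?thesis by (simp add: integrable_iff_bounded)
qed

text \<open>
At the critical exponent all dyadic shells have the same mass, and \<open>O(\<bar>ln h\<bar> + 1)\<close> of them cover the
region between the radii \<open>h\<close> and 1. This is where the logarithm of the limiting case comes from.
\<close>

lemma critical_shell_bound:
  shows "\<exists>C. \<forall>h>0. integrable lborel (\<lambda>x::'a::euclidean_space. indicator {x. h \<le> norm x \<and> norm x < 1} x * norm x powr (- real DIM('a)))
     \<and> (LBINT x. indicator {x::'a. h \<le> norm x \<and> norm x < 1} x * norm x powr (- real DIM('a))) \<le> C * (\<bar>ln h\<bar> + 1)"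
proof -
  let ?A = "\<lambda>r. {x::'a. r \<le> norm x \<and> norm x < 2 * r}"
  let ?i = "\<lambda>k::nat. 2 powr (- (real k + 1)) :: real"
  let ?N = "real DIM('a)"
  define m where "m = enn2real (annulus_mass TYPE('a) ?N)"
  have m: "annulus_mass TYPE('a) ?N = ennreal m" "m \<ge> 0" using annulus_mass_finite[where 'a='a and a="?N"] by (auto simp: m_def)
  show ?thesis
  proof (intro exI[of _ "2 * m"] allI impI)
    fix h :: real assume h: "h > 0"
    let ?f = "\<lambda>x::'a. indicator {x. h \<le> norm x \<and> norm x < 1} x * norm x powr (- ?N)"
    \<comment> \<open>The number of dyadic shells between the radii \<open>h\<close> and 1; it is 0 if \<open>h \<ge> 1\<close>.\<close>
    define n where "n = nat \<lceil>log 2 (1 / h)\<rceil>"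
    have n1: "real n \<le> 2 * (\<bar>ln h\<bar> + 1)"
    proof -
      have "real n \<le> \<bar>log 2 (1/h)\<bar> + 1" unfolding n_def by linarith
      also have "\<bar>log 2 (1/h)\<bar> = \<bar>ln h\<bar> / ln 2" using h by (simp add: log_def ln_div)
      also have "\<dots> \<le> \<bar>ln h\<bar> / (1/2)" by (intro divide_left_mono) (use ln2_ge_two_thirds in auto)
      finally show ?thesis by simp
    qed
    have n2: "log 2 (1/h) \<le> real n" unfolding n_def by linarith
    have "(\<integral>\<^sup>+x. ennreal (?f x) \<partial>lborel) \<le> (\<integral>\<^sup>+x. (\<Sum>k<n. ennreal (indicator (?A (?i k)) x * norm x powr (- ?N))) \<partial>lborel)"
    proof (intro nn_integral_mono)
      fix x :: 'a
      show "ennreal (?f x) \<le> (\<Sum>k<n. ennreal (indicator (?A (?i k)) x * norm x powr (- ?N)))"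
      proof (cases "h \<le> norm x \<and> norm x < 1")
        case True
        then obtain k where k: "2 powr real_of_int k \<le> norm x" "norm x < 2 * 2 powr real_of_int k"
          using dyadic_shell[of "norm x"] h by (metis order_less_le_trans)
        have "(2::real) powr k < 2 powr 0" using k True by simp
        hence "real_of_int k < 0" by (subst (asm) powr_less_cancel_iff) auto
        define j where "j = nat (- k - 1)"
        have kj: "real_of_int k = - (real j + 1)" using \<open>real_of_int k < 0\<close> by (simp add: j_def)
        have "h < 2 powr (k + 1)" using k True by (simp add: powr_add)
        hence "log 2 h < k + 1" using h by (simp add: log_less_iff)
        hence "- (k + 1) < real n" using n2 h by (simp add: log_divide)
        hence less: "j < n" using kj by linarith
        have "ennreal (?f x) = ennreal (indicator (?A (?i j)) x * norm x powr (-?N))"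
          using k True unfolding kj by simp
        also have "\<dots> \<le> (\<Sum>k<n. ennreal (indicator (?A (?i k)) x * norm x powr (- ?N)))"
          by (rule member_le_sum[of "j" "{..<n}"]) (use less in auto)
        finally show ?thesis .
      qed auto
    qed
    also have "\<dots> = (\<Sum>k<n. ennreal (?i k powr (?N - ?N)) * annulus_mass TYPE('a) ?N)"
      by (subst nn_integral_sum) (auto simp: nn_integral_annulus)
    also have "\<dots> = (\<Sum>k<n. ennreal m)" by (intro sum.cong) (auto simp: m)
    also have "\<dots> = ennreal (n * m)" by (subst sum_ennreal) (use m in auto)
    also have "\<dots> \<le> ennreal (2 * m * (\<bar>ln h\<bar> + 1))" 
      using mult_right_mono[OF n1 m(2)] by (intro ennreal_leI) (simp add: algebra_simps)
    finally have le: "(\<integral>\<^sup>+x. ennreal (?f x) \<partial>lborel) \<le> ennreal (2 * m * (\<bar>ln h\<bar> + 1))" .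
    show "integrable lborel ?f \<and> integral\<^sup>L lborel ?f \<le> 2 * m * (\<bar>ln h\<bar> + 1)"
    proof
      have "(\<integral>\<^sup>+x. ennreal (?f x) \<partial>lborel) < \<infinity>" by (rule order.strict_trans1[OF le]) simp
      thus "integrable lborel ?f" by (simp add: integrable_iff_bounded abs_mult)
      thus "integral\<^sup>L lborel ?f \<le> 2 * m * (\<bar>ln h\<bar> + 1)"
        using le m by (subst (asm) nn_integral_eq_integral) (auto simp: ennreal_le_iff)
    qed
  qed
qed

section \<open>The Newton kernel\<close>

text \<open>
The radial profile of the fundamental solution, normalised so that its derivative is \<open>- (r powr (1 - N))\<close> in
every dimension, the plane included.
\<close>

definition newton :: "nat \<Rightarrow> real \<Rightarrow> real" where
  "newton N r = (if N = 2 then - ln r else r powr (2 - real N) / (real N - 2))"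

lemma measurable_newton [measurable]: "newton N \<in> borel_measurable borel"
  unfolding newton_def[abs_def] by measurable

lemma DERIV_newton:
  assumes "r > 0"
  shows "(newton N has_real_derivative - (r powr (1 - real N))) (at r)"
proof (cases "N = 2")
  case True
  show ?thesis unfolding newton_def[abs_def] using assms True
    by (auto intro!: derivative_eq_intros simp: powr_minus field_simps)
next
  case False
  have "((\<lambda>r. r powr (2 - real N) / (real N - 2)) has_real_derivative ((2 - real N) * r powr (2 - real N - 1)) / (real N - 2)) (at r)"
    using assms by (intro DERIV_cdivide has_real_derivative_powr)
  moreover have "((2 - real N) * r powr (2 - real N - 1)) / (real N - 2) = - (r powr (1 - real N))"
    using False by (simp add: field_simps)
  ultimately show ?thesis unfolding newton_def[abs_def] using False by simp
qed

text \<open>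
Both \<open>(s - r) / s\<close> and \<open>r / s\<close> lie in the unit interval, where \<open>x \<le> x powr \<theta>\<close>; they add up to 1.
\<close>

lemma powr_diff_le_powr_of_diff:
  fixes r s \<theta> :: real
  assumes "0 < r" "r \<le> s" "0 < \<theta>" "\<theta> \<le> 1"
  shows "s powr \<theta> - r powr \<theta> \<le> (s - r) powr \<theta>"
proof -
  have le: "x \<le> x powr \<theta>" if "0 \<le> x" "x \<le> 1" for x :: real
    using powr_mono'[of \<theta> 1 x] that assms by simp
  have s: "s > 0" using assms by simp
  have "1 = (s - r) / s + r / s" using s by (simp add: field_simps)
  also have "\<dots> \<le> ((s - r) / s) powr \<theta> + (r / s) powr \<theta>"
    using assms by (intro add_mono le) auto
  also have "\<dots> = ((s - r) powr \<theta> + r powr \<theta>) / s powr \<theta>"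
    using assms by (simp add: powr_divide add_divide_distrib)
  finally show ?thesis using s by (simp add: field_simps)
qed

lemma newton_antimono:
  assumes "0 < r" "r \<le> s"
  shows "newton N s \<le> newton N r"
proof (rule DERIV_nonpos_imp_nonincreasing[OF assms(2)])
  fix t assume "r \<le> t" "t \<le> s"
  thus "\<exists>y. (newton N has_real_derivative y) (at t) \<and> y \<le> 0"
    using DERIV_newton[of t N] assms by (intro exI[of _ "- (t powr (1 - real N))"]) auto
qed

text \<open>
In \<open>t powr (1 - N) = t powr (\<theta> - 1) * t powr (2 - N - \<theta>)\<close> the last factor is decreasing, so it is at most its value
at \<open>r\<close>; what remains integrates to \<open>(s powr \<theta> - r powr \<theta>) / \<theta>\<close>. The free exponent \<open>\<theta>\<close> trades
regularity against the strength of the singularity.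
\<close>

lemma newton_diff_le:
  assumes r: "0 < r" "r \<le> s" and \<theta>: "0 < \<theta>" "\<theta> \<le> 1" and N: "N \<ge> 2"
  shows "newton N r - newton N s \<le> (s - r) powr \<theta> * r powr (2 - real N - \<theta>) / \<theta>"
proof -
  define c where "c = r powr (2 - real N - \<theta>) / \<theta>"
  \<comment> \<open>Its monotonicity bounds the left side by \<open>c * (s powr \<theta> - r powr \<theta>)\<close>.\<close>
  define \<phi> where "\<phi> t = c * (t powr \<theta>) + newton N t" for t
  have "\<phi> r \<le> \<phi> s"
  proof (rule DERIV_nonneg_imp_nondecreasing[OF r(2)])
    fix t assume t: "r \<le> t" "t \<le> s"
    have t0: "t > 0" using t r by simp
    have 1: "(\<phi> has_real_derivative (c * (\<theta> * t powr (\<theta> - 1)) + - (t powr (1 - real N)))) (at t)"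
      unfolding \<phi>_def[abs_def] using t0
      by (intro DERIV_add DERIV_cmult has_real_derivative_powr DERIV_newton)
    have "t powr (1 - real N) = t powr (\<theta> - 1) * t powr (2 - real N - \<theta>)"
      using t0 by (simp add: powr_add[symmetric])
    also have "\<dots> \<le> t powr (\<theta> - 1) * r powr (2 - real N - \<theta>)"
      using r t N \<theta> by (intro mult_left_mono powr_mono2') auto
    also have "\<dots> = c * (\<theta> * t powr (\<theta> - 1))" using \<theta> by (simp add: c_def)
    finally show "\<exists>y. (\<phi> has_real_derivative y) (at t) \<and> 0 \<le> y" 
      using 1 by (intro exI[of _ "c * (\<theta> * t powr (\<theta> - 1)) + - (t powr (1 - real N))"]) auto
  qed
  hence "newton N r - newton N s \<le> c * (s powr \<theta> - r powr \<theta>)" by (simp add: \<phi>_def algebra_simps)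
  also have "\<dots> \<le> c * (s - r) powr \<theta>"
    using powr_diff_le_powr_of_diff[OF r \<theta>] \<theta> by (intro mult_left_mono) (auto simp: c_def)
  finally show ?thesis by (simp add: c_def mult.commute)
qed

lemma newton_abs_diff_le:
  assumes r: "0 < r" "0 < s" and h: "\<bar>r - s\<bar> \<le> h" and \<theta>: "0 < \<theta>" "\<theta> \<le> 1" and N: "N \<ge> 2"
  shows "\<bar>newton N r - newton N s\<bar> \<le> h powr \<theta> * min r s powr (2 - real N - \<theta>) / \<theta>"
  using r h
proof (induction r s rule: linorder_wlog)
  case (le r s)
  have "\<bar>newton N r - newton N s\<bar> = newton N r - newton N s" using newton_antimono[of r s N] le by simp
  also have "\<dots> \<le> (s - r) powr \<theta> * r powr (2 - real N - \<theta>) / \<theta>"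
    using le by (intro newton_diff_le \<theta> N) auto
  also have "\<dots> \<le> h powr \<theta> * r powr (2 - real N - \<theta>) / \<theta>"
    using le \<theta> by (intro divide_right_mono mult_right_mono powr_mono2) auto
  finally show ?case using le by simp
next
  case (sym r s)
  thus ?case by (simp add: abs_minus_commute min.commute)
qed

lemma newton_abs_diff_le_scaled:
  assumes r: "0 < r" "0 < s" and h: "\<bar>r - s\<bar> \<le> h" "0 < h" and \<theta>: "0 < \<theta>" "\<theta> \<le> 1" and N: "N \<ge> 2"
  shows "\<bar>newton N r - newton N s\<bar> \<le> h powr (2 - real N) / \<theta> * (min r s / h) powr (- (real N - 2 + \<theta>))"
proof -
  define e where "e = 2 - real N - \<theta>"
  have "h powr \<theta> * min r s powr e = h powr \<theta> * h powr e * (min r s / h) powr e"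
    using h r by (simp add: powr_divide)
  also have "h powr \<theta> * h powr e = h powr (2 - real N)" by (simp add: e_def powr_add[symmetric])
  finally show ?thesis
    using newton_abs_diff_le[OF r h(1) \<theta> N] by (simp add: e_def)
qed

text \<open>
Below the scale \<open>h\<close> the given \<open>\<theta>\<close> is used, above it \<open>\<theta> = 1\<close>. The value at the smaller radius is
bounded by the sum of both values, which turns the estimate into a sum of two functions of one variable.
\<close>

lemma newton_diff_le_profile:
  assumes r: "0 < r" "0 < s" and h: "\<bar>r - s\<bar> \<le> h" "0 < h" and \<theta>: "0 < \<theta>" "\<theta> \<le> 1" and N: "N \<ge> 2"
  shows "\<bar>newton N r - newton N s\<bar>
     \<le> h powr (2 - real N) / \<theta> * (shell_profile (real N - 2 + \<theta>) (real N - 1) (r / h) + shell_profile (real N - 2 + \<theta>) (real N - 1) (s / h))"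
proof -
  let ?F = "shell_profile (real N - 2 + \<theta>) (real N - 1)"
  define m where "m = min r s"
  have m: "m > 0" using r by (simp add: m_def)
  have "\<bar>newton N r - newton N s\<bar> \<le> h powr (2 - real N) / \<theta> * ?F (m / h)"
  proof (cases "m < h")
    case True
    thus ?thesis using newton_abs_diff_le_scaled[OF r h \<theta> N] h by (simp add: shell_profile_def m_def)
  next
    case False
    have "\<bar>newton N r - newton N s\<bar> \<le> h powr (2 - real N) / 1 * (m / h) powr (- (real N - 2 + 1))"
      unfolding m_def by (rule newton_abs_diff_le_scaled[OF r h _ _ N]) auto
    also have "\<dots> \<le> h powr (2 - real N) / \<theta> * (m / h) powr (- (real N - 2 + 1))"
      using \<theta> by (intro mult_right_mono divide_left_mono) auto
    also have "real N - 2 + 1 = real N - 1" by simp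
    finally show ?thesis using False h by (simp add: shell_profile_def)
  qed
  also have "\<dots> \<le> h powr (2 - real N) / \<theta> * (?F (r / h) + ?F (s / h))"
    using \<theta> by (intro mult_left_mono) (auto simp: m_def min_def)
  finally show ?thesis .
qed

text \<open>
The analogue of the previous lemma for the limiting exponent. The decay of order \<open>N - 1\<close> is cut at radius 1:
between \<open>h\<close> and 1 it is kept separate, beyond 1 it will be paired with a function in \<open>Lp q\<close>.
\<close>

lemma newton_diff_le_log_profile:
  assumes r: "0 < r" "0 < s" and h: "\<bar>r - s\<bar> \<le> h" "0 < h" and N: "N \<ge> 2"
  defines "G \<equiv> \<lambda>t. 2 * h powr (2 - real N) * shell_profile (real N - 3/2) (real N + 1) (t / h)
     + h * (indicator {t. h \<le> t \<and> t < 1} t * t powr (1 - real N)) + h * shell_profile 0 (real N - 1) t"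
  shows "\<bar>newton N r - newton N s\<bar> \<le> G r + G s"
proof -
  define m where "m = min r s"
  have m: "m > 0" using r by (simp add: m_def)
  have G0: "G t \<ge> 0" for t using h by (simp add: G_def)
  have "\<bar>newton N r - newton N s\<bar> \<le> G m"
  proof (cases "m < h")
    case True
    have "\<bar>newton N r - newton N s\<bar> \<le> h powr (2 - real N) / (1/2) * (m / h) powr (- (real N - 2 + 1/2))"
      unfolding m_def by (rule newton_abs_diff_le_scaled[OF r h _ _ N]) auto
    also have "real N - 2 + 1/2 = real N - 3/2" by simp
    also have "h powr (2 - real N) / (1/2) * (m / h) powr (- (real N - 3/2))
        = 2 * h powr (2 - real N) * shell_profile (real N - 3/2) (real N + 1) (m / h)"
      using True h by (simp add: shell_profile_def)
    also have "\<dots> \<le> G m" using h by (simp add: G_def)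
    finally show ?thesis .
  next
    case False
    have "\<bar>newton N r - newton N s\<bar> \<le> h powr 1 * m powr (2 - real N - 1) / 1"
      unfolding m_def by (rule newton_abs_diff_le[OF r h(1) _ _ N]) auto
    also have "\<dots> = h * m powr (1 - real N)" using h by simp
    also have "\<dots> \<le> h * (indicator {t. h \<le> t \<and> t < 1} m * m powr (1 - real N)) + h * shell_profile 0 (real N - 1) m"
      using False h by (auto simp: shell_profile_def indicator_def)
    also have "\<dots> \<le> G m" using h by (simp add: G_def)
    finally show ?thesis .
  qed
  also have "\<dots> \<le> G r + G s" using G0[of r] G0[of s] by (auto simp: m_def min_def)
  finally show ?thesis .
qed

lemma shell_profile_powr: "shell_profile a b r powr c = shell_profile (a * c) (b * c) r"
  by (simp add: shell_profile_def powr_powr)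

abbreviation lborel_norm :: "real \<Rightarrow> ('a::euclidean_space \<Rightarrow> real) \<Rightarrow> real" where
  "lborel_norm p f \<equiv> (LBINT y. \<bar>f y\<bar> powr p) powr (1/p)"

text \<open>
Reflection and translation of \<open>G\<close> do not change its norm.
\<close>

lemma Holder_convolution:
  fixes G f :: "'a::euclidean_space \<Rightarrow> real"
  assumes pq: "p > 1" "q > 1" "1/p + 1/q = 1" and [measurable]: "f \<in> borel_measurable borel" "G \<in> borel_measurable borel"
    and f: "integrable lborel (\<lambda>x. \<bar>f x\<bar> powr p)" and G: "integrable lborel (\<lambda>x. G x powr q)" "\<And>x. G x \<ge> 0"
  shows "integrable lborel (\<lambda>y. G (x - y) * \<bar>f y\<bar>)"
    and "(LBINT y. G (x - y) * \<bar>f y\<bar>) \<le> (LBINT y. G y powr q) powr (1/q) * lborel_norm p f"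
proof -
  have i: "integrable lborel (\<lambda>y. \<bar>G (x - y)\<bar> powr q)" "(LBINT y. \<bar>G (x - y)\<bar> powr q) = (LBINT y. G y powr q)"
    using integrable_lborel_affine[OF G(1), of "-1" x] integral_lborel_affine[OF G(1), of "-1" x] G(2) by auto
  have pq': "1/q + 1/p = 1" using pq by simp
  note H = Holder_inequality[OF pq(2,1) pq', of "\<lambda>y. G (x - y)" lborel "\<lambda>y. \<bar>f y\<bar>"]
  show "integrable lborel (\<lambda>y. G (x - y) * \<bar>f y\<bar>)" using i f by (intro H) auto
  have "(LBINT y. \<bar>G (x - y) * \<bar>f y\<bar>\<bar>) \<le> (LBINT y. \<bar>G (x - y)\<bar> powr q) powr (1/q) * (LBINT y. \<bar>\<bar>f y\<bar>\<bar> powr p) powr (1/p)"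
    using i f by (intro H) auto
  thus "(LBINT y. G (x - y) * \<bar>f y\<bar>) \<le> (LBINT y. G y powr q) powr (1/q) * lborel_norm p f"
    using i G(2) by (simp add: abs_mult)
qed

definition profile_norm :: "'a::euclidean_space itself \<Rightarrow> real \<Rightarrow> real \<Rightarrow> real \<Rightarrow> real" where
  "profile_norm _ q a b = (LBINT y. shell_profile (a*q) (b*q) (norm (y::'a))) powr (1/q)"

text \<open>
Dilation of the profile by \<open>h\<close> multiplies the integral of its \<open>q\<close>-th power by \<open>h ^ DIM('a)\<close>.
\<close>

lemma profile_convolution_bound:
  fixes f :: "'a::euclidean_space \<Rightarrow> real"
  assumes pq: "p > 1" "q > 1" "1/p + 1/q = 1" and ab: "a * q < real DIM('a)" "real DIM('a) < b * q"
    and h: "h > 0" and f[measurable]: "f \<in> borel_measurable borel" and fi: "integrable lborel (\<lambda>x. \<bar>f x\<bar> powr p)"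
  shows "integrable lborel (\<lambda>y. shell_profile a b (norm (x - y) / h) * \<bar>f y\<bar>)"
    and "(LBINT y. shell_profile a b (norm (x - y) / h) * \<bar>f y\<bar>)
       \<le> profile_norm TYPE('a) q a b * h powr (real DIM('a) / q) * lborel_norm p f"
proof -
  define J where "J = (LBINT y. shell_profile (a*q) (b*q) (norm (y::'a)))"
  have J0: "J \<ge> 0" by (simp add: J_def)
  have iJ: "integrable lborel (\<lambda>y::'a. shell_profile (a*q) (b*q) (norm y))" by (rule integrable_shell_profile[OF ab])
  define G where "G w = shell_profile a b (norm w / h)" for w :: 'a
  have [measurable]: "G \<in> borel_measurable borel" unfolding G_def[abs_def] by measurable
  have Gq: "G w powr q = shell_profile (a*q) (b*q) (norm (0 + (1/h) *\<^sub>R w))" for w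
    using h by (simp add: G_def shell_profile_powr)
  have Gi: "integrable lborel (\<lambda>w. G w powr q)" unfolding Gq
    using integrable_lborel_affine[OF iJ, of "1/h" 0] h by simp
  have "J = (1/h) ^ DIM('a) * (LBINT w. G w powr q)"
    unfolding J_def Gq using integral_lborel_affine[OF iJ, of "1/h" 0] h by simp
  hence "(LBINT w. G w powr q) = h powr (real DIM('a)) * J" using h by (simp add: powr_realpow field_simps)
  hence *: "(LBINT w. G w powr q) powr (1/q) = profile_norm TYPE('a) q a b * h powr (real DIM('a) / q)"
    using h J0 by (simp add: powr_mult powr_powr profile_norm_def J_def)
  have G0: "G w \<ge> 0" for w by (simp add: G_def)
  show "integrable lborel (\<lambda>y. shell_profile a b (norm (x - y) / h) * \<bar>f y\<bar>)"
    using Holder_convolution(1)[OF pq f _ fi Gi G0] by (simp add: G_def)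
  show "(LBINT y. shell_profile a b (norm (x - y) / h) * \<bar>f y\<bar>)
       \<le> profile_norm TYPE('a) q a b * h powr (real DIM('a) / q) * lborel_norm p f"
    using Holder_convolution(2)[OF pq f _ fi Gi G0, of x] by (simp add: G_def[symmetric] *)
qed

definition newton_kernel :: "'a::euclidean_space \<Rightarrow> real" where
  "newton_kernel x = newton DIM('a) (norm x)"

lemma measurable_newton_kernel [measurable]: "newton_kernel \<in> borel_measurable borel"
  unfolding newton_kernel_def[abs_def] by measurable

abbreviation newton_increment :: "'a::euclidean_space \<Rightarrow> 'a \<Rightarrow> 'a \<Rightarrow> real" where
  "newton_increment x z y \<equiv> newton_kernel (x - y) - newton_kernel (z - y)"

text \<open>
The exceptional points are \<open>y = x\<close> and \<open>y = z\<close>, where the kernel has only its default value.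
\<close>

lemma newton_kernel_diff_AE_bound:
  fixes x z :: "'a::euclidean_space"
  assumes G: "\<And>r s. 0 < r \<Longrightarrow> 0 < s \<Longrightarrow> \<bar>r - s\<bar> \<le> norm (x - z) \<Longrightarrow> \<bar>newton DIM('a) r - newton DIM('a) s\<bar> \<le> G r + G s"
  shows "AE y in lborel. \<bar>newton_increment x z y\<bar> \<le> G (norm (x - y)) + G (norm (z - y))"
  using AE_lborel_singleton[of x] AE_lborel_singleton[of z]
proof eventually_elim
  case (elim y)
  have "\<bar>norm (x - y) - norm (z - y)\<bar> \<le> norm (x - z)"
    using norm_triangle_ineq3[of "x - y" "z - y"] by simp
  thus ?case using elim by (auto simp: newton_kernel_def intro!: G)
qed

lemma integrable_dominated:
  fixes f g :: "'a \<Rightarrow> real"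
  assumes "integrable M g" "f \<in> borel_measurable M" "AE x in M. \<bar>f x\<bar> \<le> g x"
  shows "integrable M f"
proof (rule Bochner_Integration.integrable_bound[OF assms(1,2)])
  show "AE x in M. norm (f x) \<le> norm (g x)" using assms(3) by eventually_elim auto
qed

text \<open>
With \<open>q\<close> the conjugate exponent of \<open>p\<close>, the condition \<open>DIM('a) / 2 < p\<close> leaves room for some \<open>\<theta> > 0\<close> with
\<open>(DIM('a) - 2 + \<theta>) * q < DIM('a)\<close>, and \<open>p < DIM('a)\<close> means \<open>DIM('a) < (DIM('a) - 1) * q\<close>. So both powers in the profile are
admissible, and the powers of \<open>h\<close> combine to \<open>2 - DIM('a) + DIM('a) / q = 2 - DIM('a) / p\<close>.
\<close>

lemma newton_kernel_Holder_bound: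
  fixes p :: real
  assumes N: "DIM('a::euclidean_space) \<ge> 2" and p: "real DIM('a) / 2 < p" "p < real DIM('a)"
  shows "\<exists>C\<ge>0. \<forall>f::'a \<Rightarrow> real. \<forall>x z. f \<in> borel_measurable borel \<longrightarrow> integrable lborel (\<lambda>x. \<bar>f x\<bar> powr p) \<longrightarrow>
      integrable lborel (\<lambda>y. newton_increment x z y * f y) \<and>
      (LBINT y. \<bar>newton_increment x z y * f y\<bar>)
         \<le> C * norm (x - z) powr (2 - real DIM('a) / p) * lborel_norm p f"
proof -
  let ?N = "real DIM('a)"
  have N2: "?N \<ge> 2" using N by simp
  have p1: "p > 1" using p N2 by simp
  define q where "q = p / (p - 1)"
  have q: "q > 1" "1/p + 1/q = 1" using p1 by (auto simp: q_def field_simps)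
  have iq: "1/q = 1 - 1/p" using q by simp
  \<comment> \<open>Any \<open>\<theta>\<close> below \<open>2 - ?N / p = ?N / q - (?N - 2)\<close> keeps the inner power integrable.\<close>
  define \<theta> where "\<theta> = min 1 ((2 - ?N/p) / 2)"
  have Np: "?N / p < 2" using p p1 by (simp add: field_simps)
  have \<theta>: "0 < \<theta>" "\<theta> \<le> 1" "\<theta> < 2 - ?N / p" using Np by (auto simp: \<theta>_def min_def)
  have Nq: "?N / q = ?N - ?N / p" 
  proof -
    have "?N / q = ?N * (1 / q)" by simp
    thus ?thesis by (simp add: iq algebra_simps)
  qed
  have "?N - 2 + \<theta> < ?N / q" using \<theta> Nq by linarith
  hence a: "(?N - 2 + \<theta>) * q < ?N" using q by (simp add: field_simps)
  have "1 < ?N / p" using p p1 by (simp add: field_simps)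
  hence "?N / q < ?N - 1" using Nq by linarith
  hence b: "?N < (?N - 1) * q" using q by (simp add: field_simps)
  let ?F = "shell_profile (?N - 2 + \<theta>) (?N - 1)"
  define C where "C = profile_norm TYPE('a) q (?N - 2 + \<theta>) (?N - 1)"
  have C0: "C \<ge> 0" by (simp add: C_def profile_norm_def)
  note C = profile_convolution_bound[OF p1 q a b, folded C_def]
  show ?thesis
  proof (intro exI[of _ "2 * C / \<theta>"] conjI allI impI)
    show "2 * C / \<theta> \<ge> 0" using C0 \<theta> by simp
    fix f :: "'a \<Rightarrow> real" and x z :: 'a
    assume f[measurable]: "f \<in> borel_measurable borel" and fi: "integrable lborel (\<lambda>x. \<bar>f x\<bar> powr p)"
    let ?D = "\<lambda>y. newton_increment x z y * f y"
    define A where "A = lborel_norm p f"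
    have "integrable lborel ?D \<and> (LBINT y. \<bar>?D y\<bar>) \<le> 2 * C / \<theta> * norm (x - z) powr (2 - ?N / p) * A"
    proof (cases "x = z")
      case False
      define h where "h = norm (x - z)"
      have h: "h > 0" using False by (simp add: h_def)
      let ?c = "h powr (2 - ?N) / \<theta>"
      have le: "AE y in lborel. \<bar>?D y\<bar> \<le> ?c * (?F (norm (x - y) / h) * \<bar>f y\<bar> + ?F (norm (z - y) / h) * \<bar>f y\<bar>)"
      proof -
        have "AE y in lborel. \<bar>newton_increment x z y\<bar> \<le> ?c * ?F (norm (x - y) / h) + ?c * ?F (norm (z - y) / h)"
          by (rule newton_kernel_diff_AE_bound[where G = "\<lambda>r. ?c * ?F (r / h)"])
             (unfold ring_distribs(1)[symmetric], rule newton_diff_le_profile, use N \<theta> h in \<open>auto simp: h_def\<close>)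
        thus ?thesis
        proof eventually_elim
          case (elim y)
          have "\<bar>?D y\<bar> \<le> (?c * ?F (norm (x - y) / h) + ?c * ?F (norm (z - y) / h)) * \<bar>f y\<bar>"
            unfolding abs_mult by (intro mult_right_mono elim) auto
          thus ?case by (simp add: algebra_simps)
        qed
      qed
      have int: "integrable lborel (\<lambda>y. ?c * (?F (norm (x - y) / h) * \<bar>f y\<bar> + ?F (norm (z - y) / h) * \<bar>f y\<bar>))"
        using C(1)[OF h f fi, of x] C(1)[OF h f fi, of z] by auto
      have D: "integrable lborel ?D"
        by (rule integrable_dominated[OF int _ le]) measurable
      have "(LBINT y. \<bar>?D y\<bar>) \<le> (LBINT y. ?c * (?F (norm (x - y) / h) * \<bar>f y\<bar> + ?F (norm (z - y) / h) * \<bar>f y\<bar>))"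
        by (rule integral_mono_AE) (use D int le in auto)
      also have "\<dots> = ?c * ((LBINT y. ?F (norm (x - y) / h) * \<bar>f y\<bar>) + (LBINT y. ?F (norm (z - y) / h) * \<bar>f y\<bar>))"
        using C(1)[OF h f fi, of x] C(1)[OF h f fi, of z] by simp
      also have "\<dots> \<le> ?c * (C * h powr (?N / q) * A + C * h powr (?N / q) * A)"
        using C(2)[OF h f fi, of x] C(2)[OF h f fi, of z] \<theta> unfolding A_def
        by (intro mult_left_mono add_mono) auto
      also have "\<dots> = 2 * C / \<theta> * (h powr (2 - ?N) * h powr (?N / q)) * A" by simp
      also have "h powr (2 - ?N) * h powr (?N / q) = h powr (2 - ?N / p)" using h by (simp add: powr_add[symmetric] Nq)
      finally show ?thesis using D by (simp add: h_def)
    qed simp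
    thus "integrable lborel ?D" "(LBINT y. \<bar>?D y\<bar>) \<le> 2 * C / \<theta> * norm (x - z) powr (2 - ?N / p) * A" by auto
  qed
qed

lemma integral_linear_combination3:
  fixes F1 F2 F3 :: "'a \<Rightarrow> real"
  assumes "integrable M F1" "integrable M F2" "integrable M F3"
  shows "(\<integral>y. a * F1 y + b * F2 y + c * F3 y \<partial>M)
           = a * integral\<^sup>L M F1 + b * integral\<^sup>L M F2 + c * integral\<^sup>L M F3"
  using assms by simp

text \<open>
The three parts of the logarithmic profile are paired with \<open>f\<close> by Hoelder's inequality: the inner and the
middle one with the norm of exponent \<open>DIM('a)\<close>, the outer one with the norm of exponent \<open>q\<close>. Only the middle part
produces the logarithm.
\<close>

lemma newton_kernel_log_bound:
  fixes q :: real
  assumes N: "DIM('a::euclidean_space) \<ge> 2" and q: "1 < q" "q < real DIM('a)"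
  shows "\<exists>C. \<forall>f::'a \<Rightarrow> real. \<forall>x z. f \<in> borel_measurable borel \<longrightarrow> integrable lborel (\<lambda>x. \<bar>f x\<bar> powr DIM('a)) \<longrightarrow>
      integrable lborel (\<lambda>x. \<bar>f x\<bar> powr q) \<longrightarrow>
      (LBINT y. \<bar>newton_increment x z y * f y\<bar>)
         \<le> C * norm (x - z) * (\<bar>ln (norm (x - z))\<bar> + 1) powr (1 / holder_conj DIM('a)) *
            (lborel_norm DIM('a) f + lborel_norm q f)"
proof -
  let ?N = "real DIM('a)"
  let ?P = "shell_profile (?N - 3/2) (?N + 1)" and ?P' = "shell_profile 0 (?N - 1)"
  have N2: "?N \<ge> 2" using N by simp
  define r where "r = holder_conj ?N"
  have r: "r > 1" "1/?N + 1/r = 1" "?N / r = ?N - 1" "(?N - 1) * r = ?N"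
    using N2 by (auto simp: r_def holder_conj_def field_simps)
  define s where "s = q / (q - 1)"
  have s: "s > 1" "1/q + 1/s = 1" using q by (auto simp: s_def field_simps)
  have N1: "?N > 1" using N2 by simp
  have a1: "(?N - 3/2) * r < ?N" and b1: "?N < (?N + 1) * r" using r by (auto simp: algebra_simps)
  have a3: "0 * s < ?N" and b3: "?N < (?N - 1) * s"
    using q N2 by (auto simp: s_def field_simps)
  define C1 where "C1 = profile_norm TYPE('a) r (?N - 3/2) (?N + 1)"
  define C3 where "C3 = profile_norm TYPE('a) s 0 (?N - 1)"
  have C1_0: "C1 \<ge> 0" and C3_0: "C3 \<ge> 0" by (simp_all add: C1_def C3_def profile_norm_def)
  note C1 = profile_convolution_bound[OF N1 r(1,2) a1 b1, folded C1_def]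
  note C3 = profile_convolution_bound[OF q(1) s a3 b3, folded C3_def]
  obtain C2 where C2: "\<And>h. h > 0 \<Longrightarrow> integrable lborel (\<lambda>x::'a. indicator {x. h \<le> norm x \<and> norm x < 1} x * norm x powr (- ?N))"
     "\<And>h. h > 0 \<Longrightarrow> (LBINT x. indicator {x::'a. h \<le> norm x \<and> norm x < 1} x * norm x powr (- ?N)) \<le> C2 * (\<bar>ln h\<bar> + 1)"
    using critical_shell_bound by blast
  define C where "C = 2 * C1 + \<bar>C2\<bar> powr (1/r) + C3"
  show ?thesis
  proof (intro exI[of _ "2 * C"] allI impI)
    fix f :: "'a \<Rightarrow> real" and x z :: 'a
    assume f[measurable]: "f \<in> borel_measurable borel" and fN: "integrable lborel (\<lambda>x. \<bar>f x\<bar> powr ?N)"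
      and fq: "integrable lborel (\<lambda>x. \<bar>f x\<bar> powr q)"
    let ?D = "\<lambda>y. newton_increment x z y * f y"
    define A where "A = lborel_norm ?N f"
    define B where "B = lborel_norm q f"
    have AB: "A \<ge> 0" "B \<ge> 0" by (auto simp: A_def B_def)
    have "(LBINT y. \<bar>?D y\<bar>) \<le> 2 * C * norm (x - z) * (\<bar>ln (norm (x - z))\<bar> + 1) powr (1 / r) * (A + B)"
    proof (cases "x = z")
      case False
      define h where "h = norm (x - z)"
      have h: "h > 0" using False by (simp add: h_def)
      define L where "L = (\<bar>ln h\<bar> + 1) powr (1 / r)"
      have L: "L \<ge> 1" unfolding L_def using r by (intro ge_one_powr_ge_zero) auto
      define G where "G t = 2 * h powr (2 - ?N) * ?P (t / h)
         + h * (indicator {t. h \<le> t \<and> t < 1} t * t powr (1 - ?N)) + h * ?P' t" for t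
      have [measurable]: "G \<in> borel_measurable borel" unfolding G_def[abs_def] by measurable
      define G2 where "G2 w = indicator {x::'a. h \<le> norm x \<and> norm x < 1} w * norm w powr (1 - ?N)" for w :: 'a
      have [measurable]: "G2 \<in> borel_measurable borel" unfolding G2_def[abs_def] by measurable
      have G2r: "G2 w powr r = indicator {x. h \<le> norm x \<and> norm x < 1} w * norm w powr (- ?N)" for w
        using r by (auto simp: G2_def indicator_def powr_powr algebra_simps)
      have G2_0: "G2 w \<ge> 0" for w by (simp add: G2_def)
      have G2i: "integrable lborel (\<lambda>w. G2 w powr r)" unfolding G2r by (rule C2[OF h])
      have G2b: "(LBINT w. G2 w powr r) powr (1/r) \<le> \<bar>C2\<bar> powr (1/r) * L"
      proof -
        have "(LBINT w. G2 w powr r) \<le> C2 * (\<bar>ln h\<bar> + 1)" unfolding G2r by (rule C2[OF h])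
        also have "\<dots> \<le> \<bar>C2\<bar> * (\<bar>ln h\<bar> + 1)" by (intro mult_right_mono) auto
        finally have "(LBINT w. G2 w powr r) powr (1/r) \<le> (\<bar>C2\<bar> * (\<bar>ln h\<bar> + 1)) powr (1/r)"
          using r by (intro powr_mono2) auto
        thus ?thesis by (simp add: L_def powr_mult)
      qed
      have one: "integrable lborel (\<lambda>y. G (norm (x - y)) * \<bar>f y\<bar>)" (is ?I)
        "(LBINT y. G (norm (x - y)) * \<bar>f y\<bar>) \<le> C * h * L * (A + B)" (is ?B) for x
      proof -
        have eq: "G (norm (x - y)) * \<bar>f y\<bar> = 2 * h powr (2 - ?N) * (?P (norm (x - y) / h) * \<bar>f y\<bar>)
            + h * (G2 (x - y) * \<bar>f y\<bar>) + h * (?P' (norm (x - y) / 1) * \<bar>f y\<bar>)" for y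
          by (simp add: G_def G2_def indicator_def algebra_simps)
        note I1 = C1(1)[OF h f fN, of x]
        note I2 = Holder_convolution(1)[OF N1 r(1,2) f _ fN G2i G2_0, of x, simplified]
        note I3 = C3(1)[OF zero_less_one f fq, of x]
        show ?I unfolding eq using I1 I2 I3 by (intro Bochner_Integration.integrable_add integrable_mult_right) auto
        have "(LBINT y. G (norm (x - y)) * \<bar>f y\<bar>) = 2 * h powr (2 - ?N) * (LBINT y. ?P (norm (x - y) / h) * \<bar>f y\<bar>)
            + h * (LBINT y. G2 (x - y) * \<bar>f y\<bar>) + h * (LBINT y. ?P' (norm (x - y) / 1) * \<bar>f y\<bar>)"
          unfolding eq by (rule integral_linear_combination3[OF I1 I2 I3])
        also have "\<dots> \<le> 2 * h powr (2 - ?N) * (C1 * h powr (?N / r) * A) + h * (\<bar>C2\<bar> powr (1/r) * L * A) + h * (C3 * 1 powr (?N / s) * B)"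
        proof (intro add_mono mult_left_mono)
          show "(LBINT y. ?P (norm (x - y) / h) * \<bar>f y\<bar>) \<le> C1 * h powr (?N / r) * A"
            unfolding A_def by (rule C1(2)[OF h f fN])
          show "(LBINT y. ?P' (norm (x - y) / 1) * \<bar>f y\<bar>) \<le> C3 * 1 powr (?N / s) * B"
            unfolding B_def by (rule C3(2)[OF zero_less_one f fq])
          have "(LBINT y. G2 (x - y) * \<bar>f y\<bar>) \<le> (LBINT w. G2 w powr r) powr (1/r) * A"
            unfolding A_def by (rule Holder_convolution(2)[OF N1 r(1,2) f _ fN G2i G2_0]) measurable
          also have "\<dots> \<le> \<bar>C2\<bar> powr (1/r) * L * A" using G2b AB by (intro mult_right_mono) auto
          finally show "(LBINT y. G2 (x - y) * \<bar>f y\<bar>) \<le> \<bar>C2\<bar> powr (1/r) * L * A" .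
        qed (use h in auto)
        also have "h powr (?N / r) = h powr (?N - 1)" using r by simp
        also have "2 * h powr (2 - ?N) * (C1 * h powr (?N - 1) * A) = h * (2 * C1 * A)"
        proof -
          have "h powr (2 - ?N) * h powr (?N - 1) = h" using h by (simp add: powr_add[symmetric])
          thus ?thesis by (simp add: algebra_simps)
        qed
        also have "h * (2 * C1 * A) + h * (\<bar>C2\<bar> powr (1/r) * L * A) + h * (C3 * 1 powr (?N / s) * B)
           = h * (2 * C1 * 1 * A + \<bar>C2\<bar> powr (1/r) * L * A + C3 * 1 * B)" by (simp add: algebra_simps)
        also have "\<dots> \<le> h * (2 * C1 * L * (A + B) + \<bar>C2\<bar> powr (1/r) * L * (A + B) + C3 * L * (A + B))"
          using h AB L C1_0 C3_0 by (intro mult_left_mono add_mono mult_mono) auto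
        also have "\<dots> = C * h * L * (A + B)" by (simp add: C_def algebra_simps)
        finally show ?B .
      qed
      have le: "AE y in lborel. \<bar>?D y\<bar> \<le> G (norm (x - y)) * \<bar>f y\<bar> + G (norm (z - y)) * \<bar>f y\<bar>"
      proof -
        have "AE y in lborel. \<bar>newton_increment x z y\<bar> \<le> G (norm (x - y)) + G (norm (z - y))"
          by (rule newton_kernel_diff_AE_bound)
             (unfold G_def, rule newton_diff_le_log_profile, use N h in \<open>auto simp: h_def\<close>)
        thus ?thesis
        proof eventually_elim
          case (elim y)
          have "\<bar>?D y\<bar> \<le> (G (norm (x - y)) + G (norm (z - y))) * \<bar>f y\<bar>"
            unfolding abs_mult by (intro mult_right_mono elim) auto
          thus ?case by (simp add: algebra_simps)
        qed
      qed
      have int: "integrable lborel (\<lambda>y. G (norm (x - y)) * \<bar>f y\<bar> + G (norm (z - y)) * \<bar>f y\<bar>)"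
        using one by auto
      have D: "integrable lborel ?D"
        by (rule integrable_dominated[OF int _ le]) measurable
      have "(LBINT y. \<bar>?D y\<bar>) \<le> (LBINT y. G (norm (x - y)) * \<bar>f y\<bar> + G (norm (z - y)) * \<bar>f y\<bar>)"
        by (rule integral_mono_AE) (use D int le in auto)
      also have "\<dots> \<le> 2 * C * h * L * (A + B)"
        using one[of x] one[of z] by simp
      finally show ?thesis by (simp add: h_def L_def)
    qed simp
    thus "(LBINT y. \<bar>?D y\<bar>) \<le> 2 * C * norm (x - z) * (\<bar>ln (norm (x - z))\<bar> + 1) powr (1 / holder_conj ?N) *
       (lborel_norm ?N f + lborel_norm q f)"
      by (simp add: A_def B_def r_def)
  qed
qed

section \<open>Test functions and the second Green identity\<close>

lemma partial_deriv_eqI: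
  assumes "(f has_derivative D) (at x)"
  shows "partial_deriv e f x = D e"
  using frechet_derivative_at[OF assms] by (simp add: partial_deriv_def)

lemma partial_deriv_mult:
  assumes "f differentiable (at x)" "g differentiable (at x)"
  shows "partial_deriv e (\<lambda>x. f x * g x) x = f x * partial_deriv e g x + partial_deriv e f x * g x"
  using partial_deriv_eqI[OF has_derivative_mult[OF assms[unfolded frechet_derivative_works]], of e]
  by (simp add: partial_deriv_def)

lemma partial_deriv_diff:
  assumes "f differentiable (at x)" "g differentiable (at x)"
  shows "partial_deriv e (\<lambda>x. f x - g x) x = partial_deriv e f x - partial_deriv e g x"
  using partial_deriv_eqI[OF has_derivative_diff[OF assms[unfolded frechet_derivative_works]], of e]
  by (simp add: partial_deriv_def)

lemma has_derivative_radial: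
  fixes x y :: "'a::euclidean_space"
  assumes "(g has_real_derivative d) (at ((norm (x - y))\<^sup>2))"
  shows "((\<lambda>x. g ((norm (x - y))\<^sup>2)) has_derivative (\<lambda>v. 2 * ((x - y) \<bullet> v) * d)) (at x)"
proof -
  have 1: "((\<lambda>x. (norm (x - y))\<^sup>2) has_derivative (\<lambda>v. 2 * ((x - y) \<bullet> v))) (at x)"
    unfolding power2_norm_eq_inner
    by (auto intro!: derivative_eq_intros simp: inner_commute)
  from has_derivative_compose[OF this assms[unfolded has_field_derivative_def]]
  show ?thesis by (simp add: mult.commute)
qed

lemma partial_deriv_radial:
  fixes y :: "'a::euclidean_space"
  assumes "\<And>s. s \<ge> 0 \<Longrightarrow> (g has_real_derivative g' s) (at s)"
  shows "(\<lambda>x. g ((norm (x - y))\<^sup>2)) differentiable (at x)"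
    and "partial_deriv e (\<lambda>x. g ((norm (x - y))\<^sup>2)) = (\<lambda>x. 2 * ((x - y) \<bullet> e) * g' ((norm (x - y))\<^sup>2))"
  using has_derivative_radial[OF assms, of _ y] partial_deriv_eqI[OF has_derivative_radial[OF assms, of _ y]]
  by (auto simp: differentiable_def fun_eq_iff)

lemma partial_deriv2_radial:
  fixes y :: "'a::euclidean_space"
  assumes g: "\<And>s. s \<ge> 0 \<Longrightarrow> (g has_real_derivative g' s) (at s)"
    and g': "\<And>s. s \<ge> 0 \<Longrightarrow> (g' has_real_derivative g'' s) (at s)"
    and e: "e \<in> Basis"
  shows "partial_deriv e (\<lambda>x. g ((norm (x - y))\<^sup>2)) differentiable (at x)" (is ?D)
    and "partial_deriv e (partial_deriv e (\<lambda>x. g ((norm (x - y))\<^sup>2))) =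
         (\<lambda>x. 2 * g' ((norm (x - y))\<^sup>2) + 4 * ((x - y) \<bullet> e)\<^sup>2 * g'' ((norm (x - y))\<^sup>2))" (is ?P)
proof -
  have 1: "((\<lambda>x. 2 * ((x - y) \<bullet> e) * g' ((norm (x - y))\<^sup>2)) has_derivative
      (\<lambda>v. 2 * ((x - y) \<bullet> e) * (2 * ((x - y) \<bullet> v) * g'' ((norm (x - y))\<^sup>2)) + 2 * (v \<bullet> e) * g' ((norm (x - y))\<^sup>2))) (at x)" for x
  proof (rule has_derivative_mult)
    show "((\<lambda>x. 2 * ((x - y) \<bullet> e)) has_derivative (\<lambda>v. 2 * (v \<bullet> e))) (at x)"
      by (auto intro!: derivative_eq_intros)
    show "((\<lambda>x. g' ((norm (x - y))\<^sup>2)) has_derivative (\<lambda>v. 2 * ((x - y) \<bullet> v) * g'' ((norm (x - y))\<^sup>2))) (at x)"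
      by (rule has_derivative_radial[OF g']) auto
  qed
  have eq: "partial_deriv e (\<lambda>x. g ((norm (x - y))\<^sup>2)) = (\<lambda>x. 2 * ((x - y) \<bullet> e) * g' ((norm (x - y))\<^sup>2))"
    by (rule partial_deriv_radial(2)[OF g])
  show ?D unfolding eq differentiable_def using 1 by blast
  show ?P unfolding eq
    using partial_deriv_eqI[OF 1, of e] e by (auto simp: fun_eq_iff power2_eq_square algebra_simps)
qed

lemma laplacian_radial:
  fixes y :: "'a::euclidean_space"
  assumes g: "\<And>s. s \<ge> 0 \<Longrightarrow> (g has_real_derivative g' s) (at s)"
    and g': "\<And>s. s \<ge> 0 \<Longrightarrow> (g' has_real_derivative g'' s) (at s)"
  shows "laplacian (\<lambda>x. g ((norm (x - y))\<^sup>2)) x =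
     2 * real DIM('a) * g' ((norm (x - y))\<^sup>2) + 4 * (norm (x - y))\<^sup>2 * g'' ((norm (x - y))\<^sup>2)"
proof -
  have "laplacian (\<lambda>x. g ((norm (x - y))\<^sup>2)) x =
     (\<Sum>e\<in>Basis. 2 * g' ((norm (x - y))\<^sup>2) + 4 * ((x - y) \<bullet> e)\<^sup>2 * g'' ((norm (x - y))\<^sup>2))"
    unfolding laplacian_def by (intro sum.cong refl) (simp add: partial_deriv2_radial(2)[OF g g'])
  also have "\<dots> = 2 * real DIM('a) * g' ((norm (x - y))\<^sup>2) + 4 * (\<Sum>e\<in>Basis. ((x - y) \<bullet> e)\<^sup>2) * g'' ((norm (x - y))\<^sup>2)"
    by (simp add: sum.distrib sum_distrib_left sum_distrib_right mult.assoc)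
  also have "(\<Sum>e\<in>Basis. ((x - y) \<bullet> e)\<^sup>2) = (x - y) \<bullet> (x - y)"
    unfolding power2_eq_square by (rule euclidean_inner[symmetric])
  also have "\<dots> = (norm (x - y))\<^sup>2" by (rule power2_norm_eq_inner[symmetric])
  finally show ?thesis .
qed

lemma test_function_continuous: "\<phi> \<in> test_functions \<Longrightarrow> continuous_on UNIV \<phi>"
  unfolding test_functions_def using C_k.simps(1) by blast

lemma test_function_differentiable: "\<phi> \<in> test_functions \<Longrightarrow> \<phi> differentiable (at x)"
proof -
  assume "\<phi> \<in> test_functions"
  hence "C_k (Suc 0) \<phi>" unfolding test_functions_def by blast
  thus ?thesis by simp
qed

lemma test_function_support:
  fixes \<phi> :: "'a::euclidean_space \<Rightarrow> real"
  assumes "\<phi> \<in> test_functions"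
  obtains R where "R > 0" "\<And>x. R < norm x \<Longrightarrow> \<phi> x = 0"
proof -
  have "bounded (closure {x. \<phi> x \<noteq> 0})"
    using assms by (auto simp: test_functions_def compact_imp_bounded)
  then obtain R where R: "\<And>x. x \<in> closure {x. \<phi> x \<noteq> 0} \<Longrightarrow> norm x \<le> R" by (auto simp: bounded_iff)
  show ?thesis
  proof (rule that[of "max R 1"])
    fix x :: 'a assume "max R 1 < norm x"
    hence "x \<notin> closure {x. \<phi> x \<noteq> 0}" using R[of x] by auto
    thus "\<phi> x = 0" using closure_subset[of "{x. \<phi> x \<noteq> 0}"] by auto
  qed auto
qed

lemma test_function_partial_deriv:
  assumes "\<phi> \<in> test_functions" "e \<in> Basis"
  shows "partial_deriv e \<phi> \<in> test_functions"
proof -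
  have "C_k k (partial_deriv e \<phi>)" for k
  proof -
    have "C_k (Suc k) \<phi>" using assms unfolding test_functions_def by blast
    thus ?thesis using assms by simp
  qed
  moreover have "{x. partial_deriv e \<phi> x \<noteq> 0} \<subseteq> closure {x. \<phi> x \<noteq> 0}"
  proof
    fix x assume x: "x \<in> {x. partial_deriv e \<phi> x \<noteq> 0}"
    show "x \<in> closure {x. \<phi> x \<noteq> 0}"
    proof (rule ccontr)
      assume "x \<notin> closure {x. \<phi> x \<noteq> 0}"
      hence "partial_deriv e \<phi> x = 0"
        by (intro partial_deriv_eq_0[of "- closure {x. \<phi> x \<noteq> 0}"])
           (use closure_subset[of "{x. \<phi> x \<noteq> 0}"] in auto)
      thus False using x by simp
    qed
  qed
  hence "closure {x. partial_deriv e \<phi> x \<noteq> 0} \<subseteq> closure {x. \<phi> x \<noteq> 0}" by (simp add: closure_minimal)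
  hence "compact (closure {x. partial_deriv e \<phi> x \<noteq> 0})"
    using assms(1) unfolding test_functions_def by (auto simp: compact_eq_bounded_closed intro: bounded_subset)
  ultimately show ?thesis by (simp add: test_functions_def)
qed

lemma test_function_laplacian:
  fixes \<phi> :: "'a::euclidean_space \<Rightarrow> real"
  assumes "\<phi> \<in> test_functions"
  obtains R B where "continuous_on UNIV (laplacian \<phi>)" "R > 0" "\<And>x. R < norm x \<Longrightarrow> laplacian \<phi> x = 0"
    "B \<ge> 0" "\<And>x. \<bar>laplacian \<phi> x\<bar> \<le> B" "integrable lborel (laplacian \<phi>)"
proof -
  have c: "continuous_on UNIV (laplacian \<phi>)" unfolding laplacian_def[abs_def]
    by (intro continuous_on_sum test_function_continuous test_function_partial_deriv assms)
  obtain R where R: "R > 0" "\<And>x. R < norm x \<Longrightarrow> \<phi> x = 0" using test_function_support[OF assms] by blast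
  have s: "laplacian \<phi> x = 0" if "R < norm x" for x
    unfolding laplacian_def
    by (intro sum.neutral ballI partial_deriv_eq_0_outside[OF partial_deriv_eq_0_outside[OF R(2)] that])
  obtain B where "B \<ge> 0" "\<And>x. \<bar>laplacian \<phi> x\<bar> \<le> B"
    by (rule bounded_continuous_compact_support[OF c s]) auto
  with c R(1) s integrable_continuous_compact_support[OF c s] show ?thesis by (intro that) auto
qed

text \<open>
For each basis vector \<open>e\<close>, the partial derivative of \<open>g * \<partial>\<^sub>e \<phi> - \<partial>\<^sub>e g * \<phi>\<close> in the direction \<open>e\<close> is
\<open>g * \<partial>\<^sub>e \<partial>\<^sub>e \<phi> - \<partial>\<^sub>e \<partial>\<^sub>e g * \<phi>\<close>, because the mixed products cancel; its integral vanishes.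
\<close>

lemma Green_second_identity:
  fixes g \<phi> :: "'a::euclidean_space \<Rightarrow> real"
  assumes g: "\<And>x. g differentiable (at x)"
    and g1: "\<And>e x. e \<in> Basis \<Longrightarrow> partial_deriv e g differentiable (at x)"
    and g2: "\<And>e. e \<in> Basis \<Longrightarrow> continuous_on UNIV (partial_deriv e (partial_deriv e g))"
    and \<phi>: "\<phi> \<in> test_functions"
  shows "(LBINT x. g x * laplacian \<phi> x) = (LBINT x. laplacian g x * \<phi> x)"
proof -
  obtain R where R: "R > 0" "\<And>x. R < norm x \<Longrightarrow> \<phi> x = 0" using test_function_support[OF \<phi>] by blast
  have e: "integrable lborel (\<lambda>x. g x * partial_deriv e (partial_deriv e \<phi>) x)"
     "integrable lborel (\<lambda>x. partial_deriv e (partial_deriv e g) x * \<phi> x)"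
     "(LBINT x. g x * partial_deriv e (partial_deriv e \<phi>) x) = (LBINT x. partial_deriv e (partial_deriv e g) x * \<phi> x)"
    if e: "e \<in> Basis" for e
  proof -
    have po: "partial_deriv e \<phi> x = 0" "partial_deriv e (partial_deriv e \<phi>) x = 0" if "R < norm x" for x
      by (intro partial_deriv_eq_0_outside[of R] R that; assumption)+
    note t1 = test_function_partial_deriv[OF \<phi> e]
    note t2 = test_function_partial_deriv[OF t1 e]
    have c1: "continuous_on UNIV (\<lambda>x. g x * partial_deriv e (partial_deriv e \<phi>) x)"
      by (intro continuous_on_mult differentiable_imp_continuous_on_UNIV g test_function_continuous t2)
    have c2: "continuous_on UNIV (\<lambda>x. partial_deriv e (partial_deriv e g) x * \<phi> x)"
      by (intro continuous_on_mult g2 e test_function_continuous \<phi>)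
    show i1: "integrable lborel (\<lambda>x. g x * partial_deriv e (partial_deriv e \<phi>) x)"
      by (rule integrable_continuous_compact_support[OF c1, of R]) (simp add: po)
    show i2: "integrable lborel (\<lambda>x. partial_deriv e (partial_deriv e g) x * \<phi> x)"
      by (rule integrable_continuous_compact_support[OF c2, of R]) (simp add: R)
    define F where "F x = g x * partial_deriv e \<phi> x - partial_deriv e g x * \<phi> x" for x
    have eq: "partial_deriv e F = (\<lambda>x. g x * partial_deriv e (partial_deriv e \<phi>) x - partial_deriv e (partial_deriv e g) x * \<phi> x)"
      unfolding F_def[abs_def] fun_eq_iff
      by (simp add: partial_deriv_diff partial_deriv_mult g g1[OF e] test_function_differentiable t1 \<phi> differentiable_mult)
    have "(LBINT x. partial_deriv e F x) = 0"
    proof (rule integral_partial_deriv_eq_0)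
      show "F differentiable (at x)" for x unfolding F_def[abs_def]
        by (intro differentiable_diff differentiable_mult g g1[OF e] test_function_differentiable t1 \<phi>)
      show "continuous_on UNIV (partial_deriv e F)" unfolding eq by (intro continuous_on_diff c1 c2)
      show "F x = 0" if "R < norm x" for x using that by (simp add: F_def po R)
    qed
    thus "(LBINT x. g x * partial_deriv e (partial_deriv e \<phi>) x) = (LBINT x. partial_deriv e (partial_deriv e g) x * \<phi> x)"
      unfolding eq using i1 i2 by simp
  qed
  have "(LBINT x. g x * laplacian \<phi> x) = (\<Sum>e\<in>Basis. LBINT x. g x * partial_deriv e (partial_deriv e \<phi>) x)"
    unfolding laplacian_def sum_distrib_left by (rule Bochner_Integration.integral_sum) (rule e)
  also have "\<dots> = (\<Sum>e\<in>Basis. LBINT x. partial_deriv e (partial_deriv e g) x * \<phi> x)"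
    by (intro sum.cong refl e)
  also have "\<dots> = (LBINT x. laplacian g x * \<phi> x)"
    unfolding laplacian_def sum_distrib_right by (rule Bochner_Integration.integral_sum[symmetric]) (rule e)
  finally show ?thesis .
qed

lemma integral_laplacian_test_function:
  fixes \<phi> :: "'a::euclidean_space \<Rightarrow> real"
  assumes "\<phi> \<in> test_functions"
  shows "(LBINT x. laplacian \<phi> x) = 0"
proof -
  have p: "partial_deriv e (\<lambda>x::'a. 1) = (\<lambda>x. 0)" "partial_deriv e (\<lambda>x::'a. 0) = (\<lambda>x. 0)" for e :: 'a
    using partial_deriv_eqI[OF has_derivative_const] by (auto simp: fun_eq_iff)
  show ?thesis
    using Green_second_identity[of "\<lambda>x. 1", OF _ _ _ assms] by (simp add: p laplacian_def)
qed

section \<open>The fundamental solution\<close>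

text \<open>
The negative Laplacian of \<open>newton DIM('a) (sqrt ((norm z)\<^sup>2 + 1))\<close>.
\<close>

definition poisson_profile :: "'a::euclidean_space \<Rightarrow> real" where
  "poisson_profile z = real DIM('a) * (1 + (norm z)\<^sup>2) powr (- (real DIM('a) / 2) - 1)"

text \<open>
The constant \<open>\<kappa>\<close> for which the negative Laplacian of the Newton kernel is \<open>\<kappa>\<close> times the point mass at the origin.
\<close>

definition newton_mass :: "'a::euclidean_space itself \<Rightarrow> real" where
  "newton_mass _ = (LBINT z. poisson_profile (z::'a))"

lemma measurable_poisson_profile [measurable]: "poisson_profile \<in> borel_measurable borel"
  unfolding poisson_profile_def[abs_def] by measurable

lemma poisson_profile_pos: "poisson_profile z > 0"
  unfolding poisson_profile_def by (intro mult_pos_pos) (auto simp: add_pos_nonneg intro!: powr_gt_zero[THEN iffD2] order.strict_implies_not_eq[symmetric])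

lemma integrable_poisson_profile: "integrable lborel (poisson_profile :: 'a::euclidean_space \<Rightarrow> real)"
proof (rule integrable_dominated)
  show "integrable lborel (\<lambda>z::'a. real DIM('a) * shell_profile 0 (real DIM('a) + 2) (norm z))"
    by (intro integrable_mult_right integrable_shell_profile) auto
  show "AE z in lborel. \<bar>poisson_profile (z::'a)\<bar> \<le> real DIM('a) * shell_profile 0 (real DIM('a) + 2) (norm z)"
    using AE_lborel_singleton[of "0::'a"]
  proof eventually_elim
    case (elim z)
    have "(1 + (norm z)\<^sup>2) powr (- (real DIM('a) / 2) - 1) \<le> shell_profile 0 (real DIM('a) + 2) (norm z)"
    proof (cases "norm z < 1")
      case True
      have "(1 + (norm z)\<^sup>2) powr (- (real DIM('a) / 2) - 1) \<le> (1 + (norm z)\<^sup>2) powr 0"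
        by (intro powr_mono) auto
      thus ?thesis using True elim by (simp add: shell_profile_def split: if_splits)
    next
      case False
      have "(1 + (norm z)\<^sup>2) powr (- (real DIM('a) / 2) - 1) \<le> ((norm z)\<^sup>2) powr (- (real DIM('a) / 2) - 1)"
        using elim by (intro powr_mono2') auto
      also have "(norm z)\<^sup>2 = norm z powr 2" using elim by simp
      also have "(norm z powr 2) powr (- (real DIM('a) / 2) - 1) = norm z powr (- (real DIM('a) + 2))"
        by (subst powr_powr) (simp add: algebra_simps)
      finally show ?thesis using False by (simp add: shell_profile_def)
    qed
    thus ?case using poisson_profile_pos[of z] unfolding poisson_profile_def by (simp add: mult_left_mono)
  qed
qed measurable

lemma newton_mass_pos: "newton_mass TYPE('a::euclidean_space) > 0"
proof -
  have "newton_mass TYPE('a) \<ge> 0" unfolding newton_mass_def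
    by (intro integral_nonneg_AE AE_I2) (auto intro: less_imp_le poisson_profile_pos)
  moreover have "newton_mass TYPE('a) \<noteq> 0"
  proof
    assume "newton_mass TYPE('a) = 0"
    hence "AE z in lborel. poisson_profile (z::'a) = 0"
      unfolding newton_mass_def using integrable_poisson_profile poisson_profile_pos
      by (subst (asm) integral_nonneg_eq_0_iff_AE) (auto intro: less_imp_le)
    hence "AE z::'a in lborel. False" by eventually_elim (use poisson_profile_pos in \<open>metis less_irrefl\<close>)
    thus False by (simp add: AE_iff_measurable[OF _ refl])
  qed
  ultimately show ?thesis by simp
qed

text \<open>
The regularised kernel is smooth, so the second Green identity moves the Laplacian onto it. Its negative
Laplacian at scale \<open>\<epsilon>\<close> is \<open>\<epsilon> powr (- N)\<close> times the profile at \<open>(x - y) / \<epsilon>\<close>, where \<open>N = DIM('a)\<close>; the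
substitution \<open>x = y + \<epsilon> *\<^sub>R z\<close> removes this factor.
\<close>

lemma regularised_newton_identity:
  fixes y :: "'a::euclidean_space"
  assumes \<epsilon>: "\<epsilon> > 0" and \<phi>: "\<phi> \<in> test_functions"
  shows "(LBINT x. newton DIM('a) (sqrt ((norm (x - y))\<^sup>2 + \<epsilon>\<^sup>2)) * laplacian \<phi> x)
       = - (LBINT z. poisson_profile z * \<phi> (y + \<epsilon> *\<^sub>R z))"
proof -
  let ?N = "real DIM('a)"
  define g where "g s = newton DIM('a) (sqrt (s + \<epsilon>\<^sup>2))" for s
  define g' where "g' s = - (1/2) * (s + \<epsilon>\<^sup>2) powr (- (?N/2))" for s
  define g'' where "g'' s = (?N/4) * (s + \<epsilon>\<^sup>2) powr (- (?N/2) - 1)" for s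
  have pos: "s + \<epsilon>\<^sup>2 > 0" if "s \<ge> 0" for s using \<epsilon> that by (simp add: add_nonneg_pos)
  have dg: "(g has_real_derivative g' s) (at s)" if s: "s \<ge> 0" for s
  proof -
    let ?t = "sqrt (s + \<epsilon>\<^sup>2)"
    have t: "?t > 0" using pos[OF s] by simp
    have "((\<lambda>s. sqrt (s + \<epsilon>\<^sup>2)) has_real_derivative inverse ?t / 2) (at s)"
      using pos[OF s] by (auto intro!: derivative_eq_intros)
    from DERIV_chain2[OF DERIV_newton[OF t, of "DIM('a)"] this]
    have "(g has_real_derivative - (?t powr (1 - ?N)) * (inverse ?t / 2)) (at s)" unfolding g_def .
    also have "- (?t powr (1 - ?N)) * (inverse ?t / 2) = - (1/2) * (?t powr (1 - ?N) * ?t powr (-1))"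
      using t by (simp add: powr_minus)
    also have "?t powr (1 - ?N) * ?t powr (-1) = ?t powr (- ?N)"
      by (subst powr_add[symmetric]) simp
    also have "?t powr (- ?N) = (s + \<epsilon>\<^sup>2) powr (- (?N/2))"
      using pos[OF s] by (simp add: powr_half_sqrt[symmetric] powr_powr)
    finally show ?thesis by (simp add: g'_def)
  qed
  have dg': "(g' has_real_derivative g'' s) (at s)" if s: "s \<ge> 0" for s
  proof -
    have "((\<lambda>s. s + \<epsilon>\<^sup>2) has_real_derivative 1) (at s)" by (auto intro!: derivative_eq_intros)
    from DERIV_chain2[OF has_real_derivative_powr[OF pos[OF s], of "- (?N/2)"] this]
    have "((\<lambda>s. (s + \<epsilon>\<^sup>2) powr (- (?N/2))) has_real_derivative - (?N/2) * (s + \<epsilon>\<^sup>2) powr (- (?N/2) - 1) * 1) (at s)" .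
    from DERIV_cmult[OF this, of "-(1/2)"] show ?thesis unfolding g'_def[abs_def] g''_def by simp
  qed
  have lap: "laplacian (\<lambda>x. g ((norm (x - y))\<^sup>2)) x = - (?N * \<epsilon>\<^sup>2 * ((norm (x - y))\<^sup>2 + \<epsilon>\<^sup>2) powr (- (?N/2) - 1))" for x
  proof -
    define S where "S = (norm (x - y))\<^sup>2 + \<epsilon>\<^sup>2"
    have S: "S > 0" unfolding S_def by (rule pos) simp
    have "S powr (- (?N/2)) = S powr (1 + (- (?N/2) - 1))" by simp
    also have "\<dots> = S powr 1 * S powr (- (?N/2) - 1)" by (rule powr_add)
    also have "S powr 1 = S" using S by simp
    finally have e: "S powr (- (?N/2)) = S * S powr (- (?N/2) - 1)" .
    have "laplacian (\<lambda>x. g ((norm (x - y))\<^sup>2)) x = - ?N * S powr (- (?N/2)) + ?N * (norm (x - y))\<^sup>2 * S powr (- (?N/2) - 1)"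
      by (subst laplacian_radial[OF dg dg']) (auto simp: g'_def g''_def S_def)
    also have "\<dots> = ?N * ((norm (x - y))\<^sup>2 - S) * S powr (- (?N/2) - 1)" unfolding e by (simp add: algebra_simps)
    also have "(norm (x - y))\<^sup>2 - S = - \<epsilon>\<^sup>2" by (simp add: S_def)
    finally show ?thesis by (simp add: S_def)
  qed
  have cont_g'': "continuous_on UNIV (\<lambda>x. g'' ((norm (x - y))\<^sup>2))"
    unfolding g''_def by (intro continuous_intros) (use \<epsilon> in auto)
  have cont_g': "continuous_on UNIV (\<lambda>x. g' ((norm (x - y))\<^sup>2))"
    unfolding g'_def by (intro continuous_intros) (use \<epsilon> in auto)
  obtain R where R: "R > 0" "\<And>x. R < norm x \<Longrightarrow> \<phi> x = 0" using test_function_support[OF \<phi>] by blast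
  have "(LBINT x. g ((norm (x - y))\<^sup>2) * laplacian \<phi> x) = (LBINT x. laplacian (\<lambda>x. g ((norm (x - y))\<^sup>2)) x * \<phi> x)"
  proof (rule Green_second_identity[OF _ _ _ \<phi>])
    show "(\<lambda>x. g ((norm (x - y))\<^sup>2)) differentiable (at x)" for x by (rule partial_deriv_radial(1)[OF dg])
    fix e :: 'a assume e: "e \<in> Basis"
    show "partial_deriv e (\<lambda>x. g ((norm (x - y))\<^sup>2)) differentiable (at x)" for x
      by (rule partial_deriv2_radial(1)[OF dg dg' e])
    show "continuous_on UNIV (partial_deriv e (partial_deriv e (\<lambda>x. g ((norm (x - y))\<^sup>2))))"
      by (subst partial_deriv2_radial(2)[where g = g, OF dg dg' e]) (auto intro!: continuous_intros cont_g' cont_g'')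
  qed
  also have "\<dots> = - (LBINT x. ?N * \<epsilon>\<^sup>2 * ((norm (x - y))\<^sup>2 + \<epsilon>\<^sup>2) powr (- (?N/2) - 1) * \<phi> x)"
    unfolding lap by simp
  also have "(LBINT x. ?N * \<epsilon>\<^sup>2 * ((norm (x - y))\<^sup>2 + \<epsilon>\<^sup>2) powr (- (?N/2) - 1) * \<phi> x)
     = \<bar>\<epsilon>\<bar> ^ DIM('a) * (LBINT z. ?N * \<epsilon>\<^sup>2 * ((norm (y + \<epsilon> *\<^sub>R z - y))\<^sup>2 + \<epsilon>\<^sup>2) powr (- (?N/2) - 1) * \<phi> (y + \<epsilon> *\<^sub>R z))"
  proof (rule integral_lborel_affine)
    show "integrable lborel (\<lambda>x. ?N * \<epsilon>\<^sup>2 * ((norm (x - y))\<^sup>2 + \<epsilon>\<^sup>2) powr (- (?N/2) - 1) * \<phi> x)"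
    proof (rule integrable_continuous_compact_support[where R = R])
      show "continuous_on UNIV (\<lambda>x. ?N * \<epsilon>\<^sup>2 * ((norm (x - y))\<^sup>2 + \<epsilon>\<^sup>2) powr (- (?N/2) - 1) * \<phi> x)"
        by (intro continuous_intros test_function_continuous[OF \<phi>]) (use \<epsilon> in auto)
    qed (use R in auto)
  qed (use \<epsilon> in simp)
  also have "\<dots> = (LBINT z. poisson_profile z * \<phi> (y + \<epsilon> *\<^sub>R z))"
    unfolding integral_mult_right_zero[symmetric]
  proof (intro Bochner_Integration.integral_cong refl)
    fix z :: 'a
    have "(norm (y + \<epsilon> *\<^sub>R z - y))\<^sup>2 + \<epsilon>\<^sup>2 = \<epsilon>\<^sup>2 * (1 + (norm z)\<^sup>2)" by (simp add: power_mult_distrib algebra_simps)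
    also have "\<dots> powr (- (?N/2) - 1) = (\<epsilon>\<^sup>2) powr (- (?N/2) - 1) * (1 + (norm z)\<^sup>2) powr (- (?N/2) - 1)"
      by (rule powr_mult)
    also have "(\<epsilon>\<^sup>2) powr (- (?N/2) - 1) = \<epsilon> powr (- ?N - 2)"
    proof -
      have "\<epsilon>\<^sup>2 = \<epsilon> powr 2" using \<epsilon> by simp
      thus ?thesis by (simp only: powr_powr) (simp add: algebra_simps)
    qed
    finally have 1: "((norm (y + \<epsilon> *\<^sub>R z - y))\<^sup>2 + \<epsilon>\<^sup>2) powr (- (?N/2) - 1) = \<epsilon> powr (- ?N - 2) * (1 + (norm z)\<^sup>2) powr (- (?N/2) - 1)" .
    have "\<bar>\<epsilon>\<bar> ^ DIM('a) * \<epsilon>\<^sup>2 * \<epsilon> powr (- ?N - 2) = \<epsilon> powr ?N * \<epsilon> powr 2 * \<epsilon> powr (- ?N - 2)"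
      using \<epsilon> by (simp add: powr_realpow)
    also have "\<dots> = 1" using \<epsilon> by (simp only: powr_add[symmetric]) simp
    finally have 2: "\<bar>\<epsilon>\<bar> ^ DIM('a) * \<epsilon>\<^sup>2 * \<epsilon> powr (- ?N - 2) = 1" .
    have "\<bar>\<epsilon>\<bar> ^ DIM('a) * (?N * \<epsilon>\<^sup>2 * ((norm (y + \<epsilon> *\<^sub>R z - y))\<^sup>2 + \<epsilon>\<^sup>2) powr (- (?N/2) - 1) * \<phi> (y + \<epsilon> *\<^sub>R z))
       = (\<bar>\<epsilon>\<bar> ^ DIM('a) * \<epsilon>\<^sup>2 * \<epsilon> powr (- ?N - 2)) * (?N * (1 + (norm z)\<^sup>2) powr (- (?N/2) - 1) * \<phi> (y + \<epsilon> *\<^sub>R z))"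
      unfolding 1 by (simp only: ac_simps)
    thus "\<bar>\<epsilon>\<bar> ^ DIM('a) * (?N * \<epsilon>\<^sup>2 * ((norm (y + \<epsilon> *\<^sub>R z - y))\<^sup>2 + \<epsilon>\<^sup>2) powr (- (?N/2) - 1) * \<phi> (y + \<epsilon> *\<^sub>R z))
       = poisson_profile z * \<phi> (y + \<epsilon> *\<^sub>R z)"
      unfolding 2 by (simp add: poisson_profile_def)
  qed
  finally show ?thesis by (simp add: g_def)
qed

text \<open>
The limit \<open>\<epsilon> \<rightarrow> 0\<close> in the regularised identity. The Laplacian of a test function has integral zero, so a constant
may be subtracted from the kernel. With the value at a radius \<open>R\<close> beyond the support, the regularised kernels become
nonnegative there and are bounded by a multiple of the locally integrable power \<open>norm (x - y) powr (1 - N)\<close>,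
uniformly in \<open>\<epsilon>\<close>.
\<close>

lemma newton_kernel_fundamental:
  fixes y :: "'a::euclidean_space"
  assumes N: "DIM('a) \<ge> 2" and \<phi>: "\<phi> \<in> test_functions"
  shows "integrable lborel (\<lambda>x. newton_kernel (x - y) * laplacian \<phi> x)"
    and "(LBINT x. newton_kernel (x - y) * laplacian \<phi> x) = - newton_mass TYPE('a) * \<phi> y"
proof -
  let ?N = "real DIM('a)"
  have N2: "?N \<ge> 2" using N by simp
  obtain S B where L: "continuous_on UNIV (laplacian \<phi>)" "S > 0" "\<And>x. S < norm x \<Longrightarrow> laplacian \<phi> x = 0"
    "B \<ge> 0" "\<And>x. \<bar>laplacian \<phi> x\<bar> \<le> B" "integrable lborel (laplacian \<phi>)"
    by (rule test_function_laplacian[OF \<phi>]) auto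
  have [measurable]: "laplacian \<phi> \<in> borel_measurable borel" using L(6) by auto
  \<comment> \<open>On the support, the regularised radius \<open>A j x\<close> below is at most \<open>norm (x - y) + 1 \<le> R\<close>.\<close>
  define R where "R = S + norm y + 1"
  define \<epsilon> where "\<epsilon> j = inverse (real (Suc j))" for j
  have \<epsilon>: "\<epsilon> j > 0" "\<epsilon> j \<le> 1" for j by (auto simp: \<epsilon>_def field_simps)
  have \<epsilon>0: "\<epsilon> \<longlonglongrightarrow> 0" unfolding \<epsilon>_def[abs_def] by (rule LIMSEQ_inverse_real_of_nat)
  define A where "A j x = sqrt ((norm (x - y))\<^sup>2 + (\<epsilon> j)\<^sup>2)" for j and x :: 'a
  define c where "c = newton DIM('a) R"
  define kr where "kr j x = (newton DIM('a) (A j x) - c) * laplacian \<phi> x" for j x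
  define kl where "kl x = (newton_kernel (x - y) - c) * laplacian \<phi> x" for x
  define w where "w x = B * (R * (shell_profile (?N - 1) (?N + 1) (norm (x - y)) + indicator (cball 0 S) x))" for x :: 'a
  have wi: "integrable lborel w"
  proof -
    have "integrable lborel (\<lambda>x::'a. shell_profile (?N - 1) (?N + 1) (norm (- y + 1 *\<^sub>R x)))"
      by (rule integrable_lborel_affine[OF integrable_shell_profile]) auto
    hence "integrable lborel (\<lambda>x::'a. shell_profile (?N - 1) (?N + 1) (norm (x - y)))" by simp
    moreover have "integrable lborel (\<lambda>x::'a. indicator (cball 0 S) x :: real)" by (rule integrable_indicator_cball)
    ultimately show ?thesis unfolding w_def by (intro integrable_mult_right Bochner_Integration.integrable_add)
  qed
  have bd: "\<bar>kr j x\<bar> \<le> w x" if x: "x \<noteq> y" for j x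
  proof (cases "norm x \<le> S")
    case True
    have t: "norm (x - y) > 0" using x by simp
    have tA: "norm (x - y) \<le> A j x" unfolding A_def by (rule real_le_rsqrt) simp
    have "A j x \<le> norm (x - y) + \<epsilon> j" unfolding A_def
      using sqrt_sum_squares_le_sum[of "norm (x - y)" "\<epsilon> j"] \<epsilon>(1)[of j] by simp
    also have "\<dots> \<le> R" using \<epsilon>(2)[of j] True norm_triangle_ineq4[of x y] by (simp add: R_def)
    finally have AR: "A j x \<le> R" .
    have A0: "A j x > 0" using t tA by linarith
    have "\<bar>newton DIM('a) (A j x) - c\<bar> = newton DIM('a) (A j x) - newton DIM('a) R"
      using newton_antimono[OF A0 AR, of "DIM('a)"] by (simp add: c_def)
    also have "\<dots> \<le> (R - A j x) powr 1 * A j x powr (2 - ?N - 1) / 1"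
      by (rule newton_diff_le[OF A0 AR _ _ N]) auto
    also have "\<dots> = (R - A j x) * A j x powr (1 - ?N)" using AR by simp
    also have "\<dots> \<le> R * norm (x - y) powr (1 - ?N)"
    proof (intro mult_mono powr_mono2')
      show "0 \<le> R" "R - A j x \<le> R" using A0 AR by linarith+
    qed (use t tA N2 in auto)
    also have "norm (x - y) powr (1 - ?N) \<le> shell_profile (?N - 1) (?N + 1) (norm (x - y)) + indicator (cball 0 S) x"
    proof (cases "norm (x - y) < 1")
      case False
      hence "norm (x - y) powr (1 - ?N) \<le> norm (x - y) powr 0" using N2 by (intro powr_mono) auto
      also have "\<dots> = 1" using t by simp
      finally have "norm (x - y) powr (1 - ?N) \<le> indicator (cball 0 S) x" using True by simp
      thus ?thesis using shell_profile_nonneg[of "?N - 1" "?N + 1" "norm (x - y)"] by linarith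
    qed (use N2 in \<open>simp add: shell_profile_def\<close>)
    finally have 1: "\<bar>newton DIM('a) (A j x) - c\<bar> \<le> R * (shell_profile (?N - 1) (?N + 1) (norm (x - y)) + indicator (cball 0 S) x)"
      using A0 AR by (auto simp: mult_left_mono)
    have "\<bar>newton DIM('a) (A j x) - c\<bar> * \<bar>laplacian \<phi> x\<bar>
       \<le> R * (shell_profile (?N - 1) (?N + 1) (norm (x - y)) + indicator (cball 0 S) x) * B"
      using 1 L(4,5) A0 AR by (intro mult_mono) auto
    thus ?thesis unfolding kr_def w_def abs_mult by (simp only: mult.commute mult.left_commute)
  next
    case False
    thus ?thesis using L(2,3,4) by (simp add: kr_def w_def R_def)
  qed
  have lim: "(\<lambda>j. kr j x) \<longlonglongrightarrow> kl x" if x: "x \<noteq> y" for x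
  proof -
    have "(\<lambda>j. A j x) \<longlonglongrightarrow> sqrt ((norm (x - y))\<^sup>2 + 0\<^sup>2)" unfolding A_def by (intro tendsto_intros \<epsilon>0)
    moreover have "isCont (newton DIM('a)) (norm (x - y))" using x by (intro DERIV_isCont[OF DERIV_newton]) simp
    ultimately have "(\<lambda>j. newton DIM('a) (A j x)) \<longlonglongrightarrow> newton DIM('a) (norm (x - y))"
      by (intro isCont_tendsto_compose[of _ "newton DIM('a)"]) auto
    thus ?thesis unfolding kr_def kl_def newton_kernel_def by (intro tendsto_intros)
  qed
  have AEy: "AE x in lborel. x \<noteq> y" by (rule AE_lborel_singleton)
  have DCT: "integrable lborel (kl)" "(\<lambda>j. integral\<^sup>L lborel (kr j)) \<longlonglongrightarrow> integral\<^sup>L lborel (kl)" "\<And>j. integrable lborel (kr j)"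
  proof -
    have [measurable]: "A j \<in> borel_measurable borel" for j unfolding A_def[abs_def] by measurable
    have mk: "kl \<in> borel_measurable lborel" unfolding kl_def[abs_def] by measurable
    have ms: "kr j \<in> borel_measurable lborel" for j unfolding kr_def[abs_def] by measurable
    have l: "AE x in lborel. (\<lambda>j. kr j x) \<longlonglongrightarrow> kl x" using AEy by eventually_elim (rule lim)
    have b: "AE x in lborel. norm (kr j x) \<le> w x" for j
      using AEy by eventually_elim (unfold real_norm_def, rule bd)
    show "integrable lborel (kl)" "(\<lambda>j. integral\<^sup>L lborel (kr j)) \<longlonglongrightarrow> integral\<^sup>L lborel (kl)" "\<And>j. integrable lborel (kr j)"
      using integral_dominated_convergence[OF mk ms wi l b] integrable_dominated_convergence[OF mk ms wi l b]
        integrable_dominated_convergence2[OF mk ms wi l b] by auto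
  qed
  have cL: "integrable lborel (\<lambda>x. c * laplacian \<phi> x)" "(LBINT x. c * laplacian \<phi> x) = 0"
    using L(6) integral_laplacian_test_function[OF \<phi>] by auto
  have "integrable lborel (\<lambda>x. kl x + c * laplacian \<phi> x)"
    by (intro Bochner_Integration.integrable_add DCT(1) cL)
  thus I: "integrable lborel (\<lambda>x. newton_kernel (x - y) * laplacian \<phi> x)" by (simp add: kl_def algebra_simps)
  have shift: "(LBINT x. F x * laplacian \<phi> x) = (LBINT x. (F x - c) * laplacian \<phi> x)"
    if "integrable lborel (\<lambda>x. (F x - c) * laplacian \<phi> x)" for F
  proof -
    have "(LBINT x. F x * laplacian \<phi> x) = (LBINT x. (F x - c) * laplacian \<phi> x + c * laplacian \<phi> x)"
      by (simp add: algebra_simps)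
    also have "\<dots> = (LBINT x. (F x - c) * laplacian \<phi> x) + (LBINT x. c * laplacian \<phi> x)"
      by (rule Bochner_Integration.integral_add[OF that cL(1)])
    finally show ?thesis using cL(2) by simp
  qed
  have "(\<lambda>j. LBINT x. newton DIM('a) (A j x) * laplacian \<phi> x) \<longlonglongrightarrow> (LBINT x. newton_kernel (x - y) * laplacian \<phi> x)"
    using DCT(2) unfolding kr_def[abs_def] kl_def[abs_def]
    by (simp only: shift[OF DCT(1)[unfolded kl_def[abs_def]]] shift[OF DCT(3)[unfolded kr_def[abs_def]]])
  hence lim1: "(\<lambda>j. - (LBINT z. poisson_profile z * \<phi> (y + \<epsilon> j *\<^sub>R z))) \<longlonglongrightarrow> (LBINT x. newton_kernel (x - y) * laplacian \<phi> x)"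
    unfolding A_def regularised_newton_identity[OF \<epsilon>(1) \<phi>] .
  have c\<phi>: "continuous_on UNIV \<phi>" by (rule test_function_continuous[OF \<phi>])
  have [measurable]: "\<phi> \<in> borel_measurable borel" using c\<phi> by (rule borel_measurable_continuous_onI)
  obtain R0 where R0: "R0 > 0" "\<And>x. R0 < norm x \<Longrightarrow> \<phi> x = 0" using test_function_support[OF \<phi>] by blast
  obtain B0 where B0: "B0 \<ge> 0" "\<And>x. \<bar>\<phi> x\<bar> \<le> B0" by (rule bounded_continuous_compact_support[OF c\<phi> R0(2)]) auto
  have "(\<lambda>j. LBINT z. poisson_profile z * \<phi> (y + \<epsilon> j *\<^sub>R z)) \<longlonglongrightarrow> (LBINT z. poisson_profile (z::'a) * \<phi> y)"
  proof (rule integral_dominated_convergence[where w = "\<lambda>z::'a. poisson_profile z * B0"])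
    show "AE z in lborel. (\<lambda>j. poisson_profile z * \<phi> (y + \<epsilon> j *\<^sub>R z)) \<longlonglongrightarrow> poisson_profile z * \<phi> y"
    proof (rule AE_I2)
      fix z :: 'a
      have "(\<lambda>j. y + \<epsilon> j *\<^sub>R z) \<longlonglongrightarrow> y + 0 *\<^sub>R z" by (intro tendsto_intros \<epsilon>0)
      hence "(\<lambda>j. \<phi> (y + \<epsilon> j *\<^sub>R z)) \<longlonglongrightarrow> \<phi> y"
        using c\<phi> by (intro isCont_tendsto_compose[of y \<phi>]) (auto simp: continuous_on_eq_continuous_at)
      thus "(\<lambda>j. poisson_profile z * \<phi> (y + \<epsilon> j *\<^sub>R z)) \<longlonglongrightarrow> poisson_profile z * \<phi> y" by (intro tendsto_intros)
    qed
    show "AE z in lborel. norm (poisson_profile z * \<phi> (y + \<epsilon> j *\<^sub>R z)) \<le> poisson_profile z * B0" for j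
      by (intro AE_I2) (auto simp: abs_mult abs_of_pos[OF poisson_profile_pos] intro!: mult_left_mono B0 less_imp_le[OF poisson_profile_pos])
    show "integrable lborel (\<lambda>z::'a. poisson_profile z * B0)" by (intro integrable_mult_left integrable_poisson_profile)
  qed measurable
  from tendsto_minus[OF this] lim1
  have "(LBINT x. newton_kernel (x - y) * laplacian \<phi> x) = - (LBINT z. poisson_profile (z::'a) * \<phi> y)"
    using LIMSEQ_unique by blast
  thus "(LBINT x. newton_kernel (x - y) * laplacian \<phi> x) = - newton_mass TYPE('a) * \<phi> y"
    by (simp add: newton_mass_def)
qed

section \<open>The Newton potential\<close>

text \<open>
The kernel at \<open>0 - y\<close> is subtracted because the kernel alone decays too slowly (and in the plane grows) for the
integral to converge at infinity.
\<close>

definition newton_potential :: "('a::euclidean_space \<Rightarrow> real) \<Rightarrow> 'a \<Rightarrow> real" where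
  "newton_potential f x = (LBINT y. newton_increment x 0 y * f y) / newton_mass TYPE('a)"

lemma newton_potential_diff_le:
  fixes f :: "'a::euclidean_space \<Rightarrow> real"
  assumes "\<And>x. integrable lborel (\<lambda>y. newton_increment x 0 y * f y)"
  shows "\<bar>newton_potential f x - newton_potential f z\<bar>
     \<le> (LBINT y. \<bar>newton_increment x z y * f y\<bar>) / newton_mass TYPE('a)"
proof -
  have "newton_potential f x - newton_potential f z =
     (LBINT y. newton_increment x 0 y * f y - newton_increment z 0 y * f y) / newton_mass TYPE('a)"
    unfolding newton_potential_def diff_divide_distrib[symmetric]
    by (subst Bochner_Integration.integral_diff) (use assms in auto)
  also have "\<dots> = (LBINT y. newton_increment x z y * f y) / newton_mass TYPE('a)"
    by (simp add: algebra_simps)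
  finally show ?thesis
    using integral_norm_bound[of lborel "\<lambda>y. newton_increment x z y * f y"] newton_mass_pos[where 'a='a]
    by (simp add: abs_divide divide_right_mono)
qed

text \<open>
Fubini's theorem and the fundamental solution identity; the subtracted kernel contributes nothing because the Laplacian of
\<open>\<phi>\<close> has integral zero. The locally bounded majorant \<open>M\<close> makes the double integral absolutely convergent.
\<close>

lemma integral_newton_potential_laplacian:
  fixes f :: "'a::euclidean_space \<Rightarrow> real"
  assumes N: "DIM('a) \<ge> 2" and [measurable]: "f \<in> borel_measurable borel"
    and int: "\<And>x. integrable lborel (\<lambda>y. newton_increment x 0 y * f y)"
    and bd: "\<And>x. (LBINT y. \<bar>newton_increment x 0 y * f y\<bar>) \<le> M x"
    and M: "\<And>S. bounded (M ` cball 0 S)"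
    and \<phi>: "\<phi> \<in> test_functions"
  shows "(LBINT x. newton_potential f x * laplacian \<phi> x) = - (LBINT y. f y * \<phi> y)"
proof -
  let ?K = "\<lambda>x y. newton_increment x 0 y"
  define m where "m = newton_mass TYPE('a)"
  have m: "m > 0" unfolding m_def by (rule newton_mass_pos)
  obtain S B where L: "continuous_on UNIV (laplacian \<phi>)" "S > 0" "\<And>x. S < norm x \<Longrightarrow> laplacian \<phi> x = 0"
    "B \<ge> 0" "\<And>x. \<bar>laplacian \<phi> x\<bar> \<le> B" "integrable lborel (laplacian \<phi>)"
    by (rule test_function_laplacian[OF \<phi>]) auto
  have [measurable]: "laplacian \<phi> \<in> borel_measurable borel" using L(6) by auto
  obtain D where "\<forall>t \<in> M ` cball 0 S. norm t \<le> D" using M[of S] unfolding bounded_iff by blast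
  hence D: "\<bar>M x\<bar> \<le> D" if "norm x \<le> S" for x using that by auto
  have D0: "D \<ge> 0" using D[of 0] L(2) by auto
  define F where "F x y = ?K x y * f y * laplacian \<phi> x" for x y
  have mF: "case_prod F \<in> borel_measurable (lborel \<Otimes>\<^sub>M lborel)" unfolding F_def by measurable
  have Fub: "(LBINT y. LBINT x. F x y) = (LBINT x. LBINT y. F x y)"
  proof (rule Fubini_integral_dominated[OF mF])
    show "integrable lborel (F x)" for x using int by (simp add: F_def[abs_def])
    show "integrable lborel (\<lambda>x::'a. D * B * indicator (cball 0 S) x)" by (intro integrable_mult_right integrable_indicator_cball)
    show "(LBINT y. \<bar>F x y\<bar>) \<le> D * B * indicator (cball 0 S) x" for x
    proof (cases "norm x \<le> S")
      case True
      have "(LBINT y. \<bar>F x y\<bar>) = (LBINT y. \<bar>?K x y * f y\<bar>) * \<bar>laplacian \<phi> x\<bar>" by (simp add: F_def abs_mult)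
      also have "\<dots> \<le> D * B"
        using bd[of x] D[OF True] L(5)[of x] D0 by (intro mult_mono) auto
      finally show ?thesis using True by simp
    qed (use L(3) in \<open>simp add: F_def\<close>)
  qed
  have inner: "(LBINT x. F x y) = - m * (f y * \<phi> y)" for y
  proof -
    have "(LBINT x. F x y) = (LBINT x. f y * (newton_kernel (x - y) * laplacian \<phi> x - newton_kernel (0 - y) * laplacian \<phi> x))"
      unfolding F_def by (simp add: algebra_simps)
    also have "\<dots> = f y * ((LBINT x. newton_kernel (x - y) * laplacian \<phi> x) - (LBINT x. newton_kernel (0 - y) * laplacian \<phi> x))"
      unfolding integral_mult_right_zero
      by (subst Bochner_Integration.integral_diff[OF newton_kernel_fundamental(1)[OF N \<phi>] integrable_mult_right[OF L(6)]]) simp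
    also have "\<dots> = - m * (f y * \<phi> y)"
      by (simp add: newton_kernel_fundamental(2)[OF N \<phi>] integral_laplacian_test_function[OF \<phi>] m_def)
    finally show ?thesis .
  qed
  have "(LBINT x. newton_potential f x * laplacian \<phi> x) = (LBINT x. (LBINT y. F x y) / m)"
    by (simp add: newton_potential_def F_def m_def)
  also have "\<dots> = (LBINT x. LBINT y. F x y) / m" by simp
  also have "\<dots> = - (LBINT y. f y * \<phi> y)"
    unfolding Fub[symmetric] inner using m by simp
  finally show ?thesis .
qed

lemma integrable_newton_kernel_diff:
  fixes f :: "'a::euclidean_space \<Rightarrow> real"
  assumes N: "DIM('a) \<ge> 2" and p: "real DIM('a) / 2 < p" "p < real DIM('a)"
    and f: "f \<in> borel_measurable borel" "integrable lborel (\<lambda>x. \<bar>f x\<bar> powr p)"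
  shows "integrable lborel (\<lambda>y. newton_increment x z y * f y)"
  using newton_kernel_Holder_bound[OF N p] f by blast

lemma newton_potential_Holder:
  assumes N: "DIM('a::euclidean_space) \<ge> 2" and p: "real DIM('a) / 2 < p" "p < real DIM('a)"
  obtains C where "\<And>f::'a \<Rightarrow> real. \<And>x z. f \<in> borel_measurable borel \<Longrightarrow> integrable lborel (\<lambda>x. \<bar>f x\<bar> powr p) \<Longrightarrow>
      \<bar>newton_potential f x - newton_potential f z\<bar> \<le> C * norm (x - z) powr (2 - real DIM('a) / p) * lborel_norm p f"
proof -
  let ?m = "newton_mass TYPE('a)"
  obtain C where C: "\<And>f::'a \<Rightarrow> real. \<And>x z. f \<in> borel_measurable borel \<Longrightarrow> integrable lborel (\<lambda>x. \<bar>f x\<bar> powr p) \<Longrightarrow>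
      (LBINT y. \<bar>newton_increment x z y * f y\<bar>)
         \<le> C * norm (x - z) powr (2 - real DIM('a) / p) * lborel_norm p f"
    using newton_kernel_Holder_bound[OF N p] by blast
  show ?thesis
  proof (rule that[of "C / ?m"])
    fix f :: "'a \<Rightarrow> real" and x z :: 'a
    assume f: "f \<in> borel_measurable borel" "integrable lborel (\<lambda>x. \<bar>f x\<bar> powr p)"
    have "\<bar>newton_potential f x - newton_potential f z\<bar> \<le> (LBINT y. \<bar>newton_increment x z y * f y\<bar>) / ?m"
      by (rule newton_potential_diff_le[OF integrable_newton_kernel_diff[OF N p f]])
    also have "\<dots> \<le> (C * norm (x - z) powr (2 - real DIM('a) / p) * lborel_norm p f) / ?m"
      using newton_mass_pos[where 'a='a] by (intro divide_right_mono C[OF f]) auto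
    finally show "\<bar>newton_potential f x - newton_potential f z\<bar>
        \<le> C / ?m * norm (x - z) powr (2 - real DIM('a) / p) * lborel_norm p f" by simp
  qed
qed

lemma newton_potential_weak_solution:
  fixes f :: "'a::euclidean_space \<Rightarrow> real"
  assumes N: "DIM('a) \<ge> 2" and p: "real DIM('a) / 2 < p" "p < real DIM('a)"
    and f: "f \<in> borel_measurable borel" "integrable lborel (\<lambda>x. \<bar>f x\<bar> powr p)"
    and \<phi>: "\<phi> \<in> test_functions"
  shows "(LBINT x. newton_potential f x * laplacian \<phi> x) = - (LBINT y. f y * \<phi> y)"
proof -
  define \<alpha> where "\<alpha> = 2 - real DIM('a) / p"
  have "p > 0" using p(1) N by linarith
  hence \<alpha>: "\<alpha> > 0" using p by (simp add: \<alpha>_def field_simps)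
  let ?A = "lborel_norm p f"
  obtain C where C0: "C \<ge> 0" and C: "\<And>x z. (LBINT y. \<bar>newton_increment x z y * f y\<bar>)
         \<le> C * norm (x - z) powr \<alpha> * ?A"
    using newton_kernel_Holder_bound[OF N p] f unfolding \<alpha>_def by blast
  show ?thesis
  proof (rule integral_newton_potential_laplacian[OF N f(1) integrable_newton_kernel_diff[OF N p f] C _ \<phi>])
    fix S :: real
    have "\<bar>C * norm (x - 0) powr \<alpha> * ?A\<bar> \<le> C * \<bar>S\<bar> powr \<alpha> * ?A" if "norm x \<le> S" for x :: 'a
    proof -
      have "norm x powr \<alpha> \<le> \<bar>S\<bar> powr \<alpha>" using that \<alpha> by (intro powr_mono2) auto
      thus ?thesis using C0 by (auto simp: abs_mult intro!: mult_right_mono mult_left_mono)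
    qed
    thus "bounded ((\<lambda>x::'a. C * norm (x - 0) powr \<alpha> * ?A) ` cball 0 S)"
      unfolding bounded_iff by (intro exI[of _ "C * \<bar>S\<bar> powr \<alpha> * ?A"]) auto
  qed
qed

section \<open>Smooth radial bump functions\<close>

text \<open>
The functions \<open>P(1/t) * exp (-1/t)\<close>, extended by zero, for all polynomials \<open>P\<close>. The family is closed under
differentiation, so every member is smooth.
\<close>

definition exp_bump :: "real poly \<Rightarrow> real \<Rightarrow> real" where
  "exp_bump P t = (if t > 0 then poly P (1 / t) * exp (- (1 / t)) else 0)"

definition bump_deriv :: "real poly \<Rightarrow> real poly" where
  "bump_deriv P = [:0, 0, 1:] * (P - pderiv P)"

lemma poly_times_exp_tendsto_0: "((\<lambda>s. poly P s * exp (- s)) \<longlongrightarrow> (0::real)) at_top"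
proof -
  have "((\<lambda>s. \<Sum>i\<le>degree P. coeff P i * (s ^ i / exp s)) \<longlongrightarrow> (\<Sum>i\<le>degree P. coeff P i * 0)) at_top"
    by (intro tendsto_sum tendsto_mult tendsto_const tendsto_power_div_exp_0)
  moreover have "poly P s * exp (- s) = (\<Sum>i\<le>degree P. coeff P i * (s ^ i / exp s))" for s
    by (simp add: poly_altdef exp_minus divide_inverse sum_distrib_right mult.assoc)
  ultimately show ?thesis by simp
qed

text \<open>
At \<open>t = 0\<close> the difference quotient is again a member of the family, with \<open>P\<close> replaced by \<open>s * P(s)\<close>, and tends to zero
since the exponential beats every polynomial.
\<close>

lemma DERIV_exp_bump: "(exp_bump P has_real_derivative exp_bump (bump_deriv P) t) (at t)"
proof (cases t "0::real" rule: linorder_cases)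
  case greater
  have "((\<lambda>t. poly P (1 / t) * exp (- (1 / t))) has_real_derivative exp_bump (bump_deriv P) t) (at t)"
    using greater unfolding exp_bump_def bump_deriv_def
    by (auto intro!: derivative_eq_intros poly_DERIV simp: field_simps power2_eq_square)
  moreover have "\<forall>\<^sub>F s in nhds t. exp_bump P s = poly P (1 / s) * exp (- (1 / s))"
    using greater by (intro eventually_nhds_in_open[of "{0<..}" t, THEN eventually_mono]) (auto simp: exp_bump_def)
  ultimately show ?thesis by (subst DERIV_cong_ev[OF refl _ refl])
next
  case less
  have "\<forall>\<^sub>F s in nhds t. exp_bump P s = 0"
    using less by (intro eventually_nhds_in_open[of "{..<0}" t, THEN eventually_mono]) (auto simp: exp_bump_def)
  moreover have "((\<lambda>s. 0) has_real_derivative exp_bump (bump_deriv P) t) (at t)"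
    using less by (simp add: exp_bump_def)
  ultimately show ?thesis by (subst DERIV_cong_ev[OF refl _ refl])
next
  case equal
  have "((\<lambda>h. exp_bump P h / h) \<longlongrightarrow> 0) (at 0)"
    unfolding filterlim_split_at_real[of _ _ 0]
  proof (rule filterlim_split_at)
    show "((\<lambda>h. exp_bump P h / h) \<longlongrightarrow> 0) (at_left 0)"
      by (rule tendsto_eventually) (auto simp: exp_bump_def eventually_at_filter)
    have "((\<lambda>h. poly (pCons 0 P) (inverse h) * exp (- inverse h)) \<longlongrightarrow> 0) (at_right 0)"
      by (rule filterlim_compose[OF poly_times_exp_tendsto_0 filterlim_inverse_at_top_right])
    moreover have "\<forall>\<^sub>F h in at_right 0. poly (pCons 0 P) (inverse h) * exp (- inverse h) = exp_bump P h / h"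
      by (auto simp: eventually_at_filter exp_bump_def divide_inverse)
    ultimately show "((\<lambda>h. exp_bump P h / h) \<longlongrightarrow> 0) (at_right 0)"
      by (rule Lim_transform_eventually)
  qed
  thus ?thesis using equal by (simp add: DERIV_def exp_bump_def)
qed

lemma continuous_on_exp_bump: "continuous_on A (exp_bump P)"
  by (intro continuous_at_imp_continuous_on ballI DERIV_isCont[OF DERIV_exp_bump])

lemma exp_bump_bounded:
  obtains B where "B \<ge> 0" "\<And>t. t \<le> 1 \<Longrightarrow> \<bar>exp_bump P t\<bar> \<le> B"
proof -
  have "compact (exp_bump P ` {0..1})" by (intro compact_continuous_image continuous_on_exp_bump) auto
  then obtain B where B: "\<And>y. y \<in> exp_bump P ` {0..1} \<Longrightarrow> norm y \<le> B"
    using compact_imp_bounded bounded_iff by metis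
  show ?thesis
  proof (rule that[of "max B 0"])
    fix t :: real assume "t \<le> 1"
    show "\<bar>exp_bump P t\<bar> \<le> max B 0"
    proof (cases "t \<ge> 0")
      case True
      hence "exp_bump P t \<in> exp_bump P ` {0..1}" using \<open>t \<le> 1\<close> by auto
      from B[OF this] show ?thesis by simp
    qed (simp add: exp_bump_def)
  qed auto
qed

lemma C_k_Suc: "C_k (Suc k) f \<Longrightarrow> C_k k f"
proof (induction k arbitrary: f)
  case 0
  thus ?case by (auto intro!: continuous_at_imp_continuous_on differentiable_imp_continuous_within)
next
  case (Suc k)
  have "C_k k (partial_deriv e f)" if "e \<in> Basis" for e
    using Suc.prems that by (intro Suc.IH) auto
  thus ?case using Suc.prems by simp
qed

lemma partial_deriv_add:
  assumes "f differentiable (at x)" "g differentiable (at x)"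
  shows "partial_deriv e (\<lambda>x. f x + g x) x = partial_deriv e f x + partial_deriv e g x"
  using partial_deriv_eqI[OF has_derivative_add[OF assms[unfolded frechet_derivative_works]], of e]
  by (simp add: partial_deriv_def)

lemma C_k_add: "C_k k f \<Longrightarrow> C_k k g \<Longrightarrow> C_k k (\<lambda>x. f x + g x)"
proof (induction k arbitrary: f g)
  case 0
  thus ?case by (simp add: continuous_on_add)
next
  case (Suc k)
  have "partial_deriv e (\<lambda>x. f x + g x) = (\<lambda>x. partial_deriv e f x + partial_deriv e g x)" for e
    using Suc.prems by (auto simp: fun_eq_iff partial_deriv_add)
  thus ?case using Suc by (auto intro: differentiable_add)
qed

lemma C_k_mult: "C_k k f \<Longrightarrow> C_k k g \<Longrightarrow> C_k k (\<lambda>x. f x * g x)"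
proof (induction k arbitrary: f g)
  case 0
  thus ?case by (simp add: continuous_on_mult)
next
  case (Suc k)
  have d: "f differentiable (at x)" "g differentiable (at x)" for x using Suc.prems by auto
  have "partial_deriv e (\<lambda>x. f x * g x) = (\<lambda>x. f x * partial_deriv e g x + partial_deriv e f x * g x)" for e
    using partial_deriv_mult[OF d] by (auto simp: fun_eq_iff)
  moreover have "C_k k (\<lambda>x. f x * partial_deriv e g x + partial_deriv e f x * g x)" if "e \<in> Basis" for e
    using Suc.prems that C_k_Suc[OF Suc.prems(1)] C_k_Suc[OF Suc.prems(2)] by (intro C_k_add Suc.IH) auto
  ultimately show ?case using d by (auto intro: differentiable_mult)
qed

lemma C_k_const: "C_k k (\<lambda>x::'a::euclidean_space. c)"
proof (induction k arbitrary: c)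
  case (Suc k)
  have "partial_deriv e (\<lambda>x::'a. c) = (\<lambda>x. 0)" for e
    using partial_deriv_eqI[OF has_derivative_const] by (auto simp: fun_eq_iff)
  thus ?case using Suc by simp
qed simp

lemma C_k_linear: "C_k k (\<lambda>x::'a::euclidean_space. c * ((x - a) \<bullet> e))"
proof (cases k)
  case (Suc l)
  have 1: "((\<lambda>x::'a. c * ((x - a) \<bullet> e)) has_derivative (\<lambda>v. c * (v \<bullet> e))) (at x)" for x
    by (auto intro!: derivative_eq_intros)
  have "partial_deriv e' (\<lambda>x::'a. c * ((x - a) \<bullet> e)) = (\<lambda>x. c * (e' \<bullet> e))" for e'
    using partial_deriv_eqI[OF 1] by (auto simp: fun_eq_iff)
  thus ?thesis using 1 Suc C_k_const by (auto simp: differentiable_def)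
qed (auto intro!: continuous_intros)

definition radial_bump :: "real poly \<Rightarrow> 'a::euclidean_space \<Rightarrow> real \<Rightarrow> 'a \<Rightarrow> real" where
  "radial_bump P a R x = exp_bump P (1 - (norm (x - a))\<^sup>2 / R\<^sup>2)"

lemma DERIV_scaled_exp_bump:
  "((\<lambda>s. c * exp_bump P (1 - s / R\<^sup>2)) has_real_derivative (- c / R\<^sup>2) * exp_bump (bump_deriv P) (1 - s / R\<^sup>2)) (at s)"
proof -
  have "((\<lambda>s. 1 - s / R\<^sup>2) has_real_derivative - (1 / R\<^sup>2)) (at s)"
    using DERIV_diff[OF DERIV_const[of 1] DERIV_cdivide[OF DERIV_ident, of "R\<^sup>2"]] by simp
  from DERIV_cmult[OF DERIV_chain2[OF DERIV_exp_bump this], of c] show ?thesis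
    by (simp add: mult.commute)
qed

lemma partial_deriv_radial_bump:
  "radial_bump P a R differentiable (at x)"
  "partial_deriv e (radial_bump P a R) = (\<lambda>x. (- 2 / R\<^sup>2) * ((x - a) \<bullet> e) * radial_bump (bump_deriv P) a R x)"
  using partial_deriv_radial[of "\<lambda>s. 1 * exp_bump P (1 - s / R\<^sup>2)", OF DERIV_scaled_exp_bump]
  unfolding radial_bump_def[abs_def] by (auto simp: mult.assoc)

text \<open>
A partial derivative is a linear function times another radial bump, so the induction runs over all
polynomials \<open>P\<close> at once.
\<close>

lemma C_k_radial_bump: "C_k k (radial_bump P a R)"
proof (induction k arbitrary: P)
  case 0
  show ?case using partial_deriv_radial_bump(1)[where P = P and a = a and R = R]
    by (auto intro!: continuous_at_imp_continuous_on differentiable_imp_continuous_within)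
next
  case (Suc k)
  have "C_k k (partial_deriv e (radial_bump P a R))" for e
    unfolding partial_deriv_radial_bump(2) by (intro C_k_mult C_k_linear Suc)
  thus ?case by (simp add: partial_deriv_radial_bump(1))
qed

lemma radial_bump_eq_0:
  assumes "R > 0" "R \<le> norm (x - a)"
  shows "radial_bump P a R x = 0"
proof -
  have "R\<^sup>2 \<le> (norm (x - a))\<^sup>2" using assms by (intro power_mono) auto
  hence "1 - (norm (x - a))\<^sup>2 / R\<^sup>2 \<le> 0" using assms by (simp add: field_simps)
  thus ?thesis by (simp add: radial_bump_def exp_bump_def)
qed

lemma continuous_on_radial_bump: "continuous_on UNIV (radial_bump P a R)"
  using C_k_radial_bump[of 0 P a R] by simp

lemma radial_bump_test_function:
  assumes R: "R > 0"
  shows "radial_bump P a R \<in> test_functions"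
proof -
  have "{x. radial_bump P a R x \<noteq> 0} \<subseteq> cball a R"
    using radial_bump_eq_0[OF R, of _ a P] by (force simp: dist_norm norm_minus_commute)
  hence "closure {x. radial_bump P a R x \<noteq> 0} \<subseteq> cball a R" by (simp add: closure_minimal)
  hence "compact (closure {x. radial_bump P a R x \<noteq> 0})"
    by (auto simp: compact_eq_bounded_closed intro: bounded_subset)
  thus ?thesis by (simp add: test_functions_def C_k_radial_bump)
qed

lemma laplacian_radial_bump:
  fixes a :: "'a::euclidean_space"
  shows "laplacian (radial_bump P a R) x =
     - 2 * real DIM('a) / R\<^sup>2 * radial_bump (bump_deriv P) a R x
     + 4 * (norm (x - a))\<^sup>2 / R^4 * radial_bump (bump_deriv (bump_deriv P)) a R x"
proof -
  have 1: "((\<lambda>s. 1 * exp_bump P (1 - s / R\<^sup>2)) has_real_derivative (- 1 / R\<^sup>2) * exp_bump (bump_deriv P) (1 - s / R\<^sup>2)) (at s)" for s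
    by (rule DERIV_scaled_exp_bump)
  have 2: "((\<lambda>s. (- 1 / R\<^sup>2) * exp_bump (bump_deriv P) (1 - s / R\<^sup>2)) has_real_derivative
      (- (- 1 / R\<^sup>2) / R\<^sup>2) * exp_bump (bump_deriv (bump_deriv P)) (1 - s / R\<^sup>2)) (at s)" for s
    by (rule DERIV_scaled_exp_bump)
  have "laplacian (radial_bump P a R) x = laplacian (\<lambda>x. 1 * exp_bump P (1 - (norm (x - a))\<^sup>2 / R\<^sup>2)) x"
    by (simp add: radial_bump_def[abs_def])
  also have "\<dots> = 2 * real DIM('a) * ((- 1 / R\<^sup>2) * exp_bump (bump_deriv P) (1 - (norm (x - a))\<^sup>2 / R\<^sup>2)) + 
      4 * (norm (x - a))\<^sup>2 * ((- (- 1 / R\<^sup>2) / R\<^sup>2) * exp_bump (bump_deriv (bump_deriv P)) (1 - (norm (x - a))\<^sup>2 / R\<^sup>2))"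
    by (rule laplacian_radial[OF 1 2])
  finally show ?thesis by (simp add: radial_bump_def power4_eq_xxxx power2_eq_square mult.assoc)
qed

section \<open>Bump averages of weakly harmonic functions\<close>

definition locally_integrable :: "('a::euclidean_space \<Rightarrow> real) \<Rightarrow> bool" where
  "locally_integrable w \<longleftrightarrow> w \<in> borel_measurable borel \<and> (\<forall>S. integrable lborel (\<lambda>y. indicator (cball 0 S) y * w y))"

lemma locally_integrable_measurable: "locally_integrable w \<Longrightarrow> w \<in> borel_measurable borel"
  by (simp add: locally_integrable_def)

lemma locally_integrable_abs:
  assumes "locally_integrable w"
  shows "integrable lborel (\<lambda>y. indicator (cball 0 S) y * \<bar>w y\<bar>)"
proof -
  have "integrable lborel (\<lambda>y. \<bar>indicator (cball 0 S) y * w y\<bar>)"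
    using assms by (intro integrable_abs) (simp add: locally_integrable_def)
  thus ?thesis by (simp add: abs_mult)
qed

lemma locally_integrable_mult:
  fixes w :: "'a::euclidean_space \<Rightarrow> real"
  assumes w: "locally_integrable w" and \<psi>: "\<psi> \<in> borel_measurable borel" "\<And>y. \<bar>\<psi> y\<bar> \<le> B" "\<And>y. S < norm y \<Longrightarrow> \<psi> y = 0"
  shows "integrable lborel (\<lambda>y. w y * \<psi> y)"
proof (rule integrable_dominated)
  show "integrable lborel (\<lambda>y. B * (indicator (cball 0 S) y * \<bar>w y\<bar>))"
    by (intro integrable_mult_right locally_integrable_abs w)
  show "AE y in lborel. \<bar>w y * \<psi> y\<bar> \<le> B * (indicator (cball 0 S) y * \<bar>w y\<bar>)"
  proof (rule AE_I2)
    fix y :: 'a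
    have "\<bar>w y\<bar> * \<bar>\<psi> y\<bar> \<le> \<bar>w y\<bar> * B" by (intro mult_left_mono \<psi>) auto
    thus "\<bar>w y * \<psi> y\<bar> \<le> B * (indicator (cball 0 S) y * \<bar>w y\<bar>)"
      using \<psi>(3)[of y] by (auto simp: abs_mult indicator_def mult.commute)
  qed
qed (use w \<psi>(1) in \<open>auto simp: locally_integrable_def\<close>)

text \<open>
The weight of the averages below. With \<open>\<beta> = exp_bump 1\<close>, it is the function \<open>\<beta>'(1 - s)\<close> of
\<open>s = (norm (x - a))\<^sup>2 / R\<^sup>2\<close>. The derivative \<open>\<beta>'\<close> is taken because then the derivative in \<open>R\<close> of the rescaled weight
is a multiple of the Laplacian of \<open>radial_bump 1 a R\<close>.
\<close>

abbreviation mean_bump :: "'a::euclidean_space \<Rightarrow> real \<Rightarrow> 'a \<Rightarrow> real" where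
  "mean_bump \<equiv> radial_bump (bump_deriv 1)"

lemma measurable_radial_bump [measurable]: "radial_bump P a R \<in> borel_measurable borel"
  by (rule borel_measurable_continuous_onI[OF continuous_on_radial_bump])

lemma radial_bump_bounded:
  obtains B where "B \<ge> 0" "\<And>a R x. \<bar>radial_bump P a R x\<bar> \<le> B"
  by (rule exp_bump_bounded[of P]) (auto simp: radial_bump_def)

lemma mean_bump_nonneg: "mean_bump a R x \<ge> 0"
  by (simp add: radial_bump_def exp_bump_def bump_deriv_def)

lemma integrable_mult_radial_bump:
  fixes w :: "'a::euclidean_space \<Rightarrow> real"
  assumes w: "locally_integrable w" and R: "R > 0"
  shows "integrable lborel (\<lambda>y. w y * radial_bump P a R y)"
proof -
  obtain B where B: "B \<ge> 0" "\<And>x. \<bar>radial_bump P a R x\<bar> \<le> B" using radial_bump_bounded by metis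
  show ?thesis
  proof (rule locally_integrable_mult[OF w _ B(2), where S = "norm a + R"])
    fix y :: 'a assume "norm a + R < norm y"
    hence "R \<le> norm (y - a)" using norm_triangle_ineq2[of y a] by simp
    thus "radial_bump P a R y = 0" by (rule radial_bump_eq_0[OF R])
  qed measurable
qed

text \<open>
In terms of \<open>\<Phi> = mean_bump 0 1\<close>, the left side is \<open>t powr (- N) * \<Phi> ((y - a) / t)\<close> with \<open>N = DIM('a)\<close>. Its
derivative in \<open>t\<close> is \<open>- (t powr (- N - 1))\<close> times the divergence of the field \<open>z \<mapsto> \<Phi> z *\<^sub>R z\<close> at \<open>z = (y - a) / t\<close>,
and this field is a gradient, namely that of \<open>- 1/2\<close> times \<open>radial_bump 1 0 1\<close>.
\<close>

lemma DERIV_mean_bump: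
  fixes a y :: "'a::euclidean_space"
  assumes t: "t > 0"
  shows "((\<lambda>t. t powr (- real DIM('a)) * mean_bump a t y) has_real_derivative
           (1/2) * t powr (1 - real DIM('a)) * laplacian (radial_bump 1 a t) y) (at t)"
proof -
  let ?N = "real DIM('a)"
  define r where "r = (norm (y - a))\<^sup>2"
  have 1: "((\<lambda>t. 1 - r / t\<^sup>2) has_real_derivative 2 * r / t ^ 3) (at t)"
    using t by (auto intro!: derivative_eq_intros simp: field_simps power2_eq_square power3_eq_cube)
  have 2: "((\<lambda>t. exp_bump (bump_deriv 1) (1 - r / t\<^sup>2)) has_real_derivative
      exp_bump (bump_deriv (bump_deriv 1)) (1 - r / t\<^sup>2) * (2 * r / t ^ 3)) (at t)"
    by (rule DERIV_chain2[OF DERIV_exp_bump 1])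
  have 3: "((\<lambda>t. t powr (- ?N)) has_real_derivative (- ?N) * t powr (- ?N - 1)) (at t)"
    by (rule has_real_derivative_powr[OF t])
  define A where "A = exp_bump (bump_deriv 1) (1 - r / t\<^sup>2)"
  define B where "B = exp_bump (bump_deriv (bump_deriv 1)) (1 - r / t\<^sup>2)"
  have "((\<lambda>t. t powr (- ?N) * mean_bump a t y) has_real_derivative
     (- ?N) * t powr (- ?N - 1) * A + B * (2 * r / t ^ 3) * t powr (- ?N)) (at t)"
    using DERIV_mult[OF 3 2] unfolding radial_bump_def r_def[symmetric] A_def B_def .
  also have "(- ?N) * t powr (- ?N - 1) * A + B * (2 * r / t ^ 3) * t powr (- ?N)
     = (1/2) * t powr (1 - ?N) * (- 2 * ?N / t\<^sup>2 * A + 4 * r / t^4 * B)"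
  proof -
    have e1: "t powr (1 - ?N) = t * t powr (- ?N)"
      using t powr_add[of t 1 "- ?N"] by simp
    have e2: "t powr (- ?N - 1) = t powr (- ?N) / t"
      using t powr_diff[of t "- ?N" 1] by simp
    show ?thesis unfolding e1 e2 using t by (simp add: field_simps power2_eq_square power3_eq_cube power4_eq_xxxx)
  qed
  also have "- 2 * ?N / t\<^sup>2 * A + 4 * r / t^4 * B = laplacian (radial_bump 1 a t) y"
    unfolding laplacian_radial_bump by (simp add: radial_bump_def r_def A_def B_def)
  finally show ?thesis .
qed

definition bump_mean :: "('a::euclidean_space \<Rightarrow> real) \<Rightarrow> 'a \<Rightarrow> real \<Rightarrow> real" where
  "bump_mean w a t = (LBINT y. w y * (t powr (- real DIM('a)) * mean_bump a t y))"

text \<open>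
Differentiation under the integral sign: the derivative of the weight is a Laplacian of a test function,
to which \<open>w\<close> is orthogonal.
\<close>

lemma DERIV_bump_mean:
  fixes w :: "'a::euclidean_space \<Rightarrow> real"
  assumes w: "locally_integrable w" and harm: "\<And>\<phi>. \<phi> \<in> test_functions \<Longrightarrow> (LBINT x. w x * laplacian \<phi> x) = 0"
    and t0: "t0 > 0"
  shows "(bump_mean w a has_real_derivative 0) (at t0)"
proof -
  let ?N = "real DIM('a)"
  define \<Lambda> where "\<Lambda> t y = w y * (t powr (- ?N) * mean_bump a t y)" for t y
  define \<Lambda>' where "\<Lambda>' t y = w y * ((1/2) * t powr (1 - ?N) * laplacian (radial_bump 1 a t) y)" for t y
  obtain B1 where B1: "B1 \<ge> 0" "\<And>t x. \<bar>mean_bump a t x\<bar> \<le> B1" using radial_bump_bounded by metis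
  obtain B2 where B2: "B2 \<ge> 0" "\<And>t x. \<bar>radial_bump (bump_deriv (bump_deriv 1)) a t x\<bar> \<le> B2" using radial_bump_bounded by metis
  \<comment> \<open>For \<open>t\<close> between \<open>T\<close> and \<open>3 * T\<close> the supports stay in a fixed ball and the powers of \<open>1 / t\<close> stay bounded.\<close>
  define T where "T = t0 / 2"
  have T: "T > 0" using t0 by (simp add: T_def)
  define D where "D = (1/2) * T powr (1 - ?N) * ((2 * ?N * B1 + 4 * B2) / T\<^sup>2)"
  define S where "S = norm a + 3 * T"
  have bound: "\<bar>\<Lambda>' t y\<bar> \<le> D * (indicator (cball 0 S) y * \<bar>w y\<bar>)" if t: "\<bar>t - t0\<bar> < T" for t y
  proof -
    have tb: "T < t" "t < 3 * T" using t unfolding T_def abs_less_iff by linarith+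
    hence tp: "t > 0" using T by linarith
    show ?thesis
    proof (cases "norm (y - a) < t")
      case True
      have "norm y \<le> norm a + norm (y - a)" using norm_triangle_ineq[of a "y - a"] by simp
      hence yS: "norm y \<le> S" using True tb by (simp add: S_def)
      have r: "(norm (y - a))\<^sup>2 / t\<^sup>2 \<le> 1" using True tp by (simp add: power_mono)
      have le1: "\<bar>- 2 * ?N / t\<^sup>2 * mean_bump a t y\<bar> \<le> 2 * ?N / t\<^sup>2 * B1"
        using B1(2)[of t y] by (simp add: abs_mult divide_right_mono mult_left_mono)
      have e4: "4 * (norm (y - a))\<^sup>2 / t^4 * x = 4 / t\<^sup>2 * ((norm (y - a))\<^sup>2 / t\<^sup>2) * x" for x
        by (simp add: power4_eq_xxxx power2_eq_square)
      have le2: "\<bar>4 * (norm (y - a))\<^sup>2 / t^4 * radial_bump (bump_deriv (bump_deriv 1)) a t y\<bar> \<le> 4 / t\<^sup>2 * 1 * B2"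
        unfolding e4 abs_mult using r B2(1) B2(2)[of t y] by (intro mult_mono) auto
      have "\<bar>laplacian (radial_bump 1 a t) y\<bar> \<le> 2 * ?N / t\<^sup>2 * B1 + 4 / t\<^sup>2 * 1 * B2"
        unfolding laplacian_radial_bump using le1 le2 by linarith
      also have "\<dots> = (2 * ?N * B1 + 4 * B2) / t\<^sup>2" by (simp add: add_divide_distrib)
      also have "\<dots> \<le> (2 * ?N * B1 + 4 * B2) / T\<^sup>2"
        using tb T B1 B2 by (intro divide_left_mono power_mono mult_pos_pos) auto
      finally have lap: "\<bar>laplacian (radial_bump 1 a t) y\<bar> \<le> (2 * ?N * B1 + 4 * B2) / T\<^sup>2" .
      have pw: "t powr (1 - ?N) \<le> T powr (1 - ?N)"
        using tb T DIM_positive[where 'a='a] by (intro powr_mono2') auto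
      have "\<bar>(1/2) * t powr (1 - ?N) * laplacian (radial_bump 1 a t) y\<bar> \<le> D"
        unfolding D_def abs_mult using lap pw by (intro mult_mono) auto
      hence "\<bar>w y\<bar> * \<bar>(1/2) * t powr (1 - ?N) * laplacian (radial_bump 1 a t) y\<bar> \<le> \<bar>w y\<bar> * D"
        by (rule mult_left_mono) simp
      thus ?thesis unfolding \<Lambda>'_def abs_mult[of "w y"] using yS by (simp add: mult.commute)
    next
      case False
      hence "laplacian (radial_bump 1 a t) y = 0"
        unfolding laplacian_radial_bump using False by (simp add: radial_bump_eq_0[OF tp])
      moreover have "D \<ge> 0" using B1 B2 by (simp add: D_def)
      ultimately show ?thesis by (simp add: \<Lambda>'_def)
    qed
  qed
  have "((\<lambda>t. LBINT y. \<Lambda> t y) has_real_derivative (LBINT y. \<Lambda>' t0 y)) (at t0)"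
  proof (rule has_real_derivative_integral[OF T])
    show "\<bar>\<Lambda>' t y\<bar> \<le> D * (indicator (cball 0 S) y * \<bar>w y\<bar>)" if "\<bar>t - t0\<bar> < T" for t y by (rule bound[OF that])
    show "integrable lborel (\<lambda>y. D * (indicator (cball 0 S) y * \<bar>w y\<bar>))" by (intro integrable_mult_right locally_integrable_abs w)
    fix t assume t: "\<bar>t - t0\<bar> < T"
    hence tp: "t > 0" using T unfolding T_def abs_less_iff by linarith
    have "integrable lborel (\<lambda>y. t powr (- ?N) * (w y * mean_bump a t y))"
      by (intro integrable_mult_right integrable_mult_radial_bump w tp)
    thus "integrable lborel (\<Lambda> t)" unfolding \<Lambda>_def by (simp add: mult.left_commute)
    show "((\<lambda>s. \<Lambda> s y) has_real_derivative \<Lambda>' t y) (at t)" for y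
      unfolding \<Lambda>_def \<Lambda>'_def by (intro DERIV_cmult DERIV_mean_bump tp)
  qed
  moreover have "(LBINT y. \<Lambda>' t0 y) = 0"
  proof -
    have "(LBINT y. \<Lambda>' t0 y) = (LBINT y. (1/2) * t0 powr (1 - ?N) * (w y * laplacian (radial_bump 1 a t0) y))"
      unfolding \<Lambda>'_def by (intro Bochner_Integration.integral_cong refl mult.left_commute)
    also have "\<dots> = 0" by (simp add: harm radial_bump_test_function[OF t0])
    finally show ?thesis .
  qed
  ultimately show ?thesis unfolding bump_mean_def[abs_def] \<Lambda>_def by simp
qed

lemma bump_mean_radius_independent:
  fixes w :: "'a::euclidean_space \<Rightarrow> real"
  assumes w: "locally_integrable w" and harm: "\<And>\<phi>. \<phi> \<in> test_functions \<Longrightarrow> (LBINT x. w x * laplacian \<phi> x) = 0"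
    and R: "R > 0"
  shows "bump_mean w a R = bump_mean w a 1"
proof -
  have "\<exists>c. \<forall>t\<in>{0<..}. bump_mean w a t = c"
  proof (rule has_field_derivative_zero_constant)
    fix t :: real assume "t \<in> {0<..}"
    hence "t > 0" by simp
    show "(bump_mean w a has_real_derivative 0) (at t within {0<..})"
      by (rule has_field_derivative_at_within, rule DERIV_bump_mean[OF w harm \<open>t > 0\<close>])
  qed simp
  thus ?thesis using R by auto
qed

lemma small_multiple_le_0:
  fixes x K :: real
  assumes "\<And>\<epsilon>. \<epsilon> > 0 \<Longrightarrow> x \<le> \<epsilon> * K"
  shows "x \<le> 0"
proof (rule field_le_epsilon)
  fix e :: real assume e: "e > 0"
  have "x \<le> e / (\<bar>K\<bar> + 1) * K" using e by (intro assms) auto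
  also have "\<dots> \<le> e / (\<bar>K\<bar> + 1) * (\<bar>K\<bar> + 1)" using e by (intro mult_left_mono) auto
  finally show "x \<le> 0 + e" by simp
qed

text \<open>
Compare the averages at radius \<open>R\<close>: the two weights differ by \<open>O(norm a / R)\<close> on the ball of radius \<open>2 * R\<close> and
vanish outside, while the integral of \<open>\<bar>w\<bar>\<close> over this ball is \<open>o(R ^ (N + 1))\<close> with \<open>N = DIM('a)\<close>. After division by \<open>R ^ N\<close> the
difference tends to zero as \<open>R\<close> grows, but it is independent of \<open>R\<close>.
\<close>

lemma bump_mean_center_independent:
  fixes w :: "'a::euclidean_space \<Rightarrow> real"
  assumes w: "locally_integrable w" and harm: "\<And>\<phi>. \<phi> \<in> test_functions \<Longrightarrow> (LBINT x. w x * laplacian \<phi> x) = 0"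
    and sub: "\<And>\<epsilon>. \<epsilon> > 0 \<Longrightarrow> \<exists>R. AE x in lborel. R \<le> norm x \<longrightarrow> \<bar>w x\<bar> \<le> \<epsilon> * norm x"
  shows "bump_mean w a 1 = bump_mean w 0 1"
proof -
  let ?N = "real DIM('a)"
  obtain H where H: "H \<ge> 0" "\<And>t. t \<le> 1 \<Longrightarrow> \<bar>exp_bump (bump_deriv (bump_deriv 1)) t\<bar> \<le> H" by (rule exp_bump_bounded[of "bump_deriv (bump_deriv 1)"]) blast
  have Lip: "\<bar>exp_bump (bump_deriv 1) s - exp_bump (bump_deriv 1) t\<bar> \<le> H * \<bar>s - t\<bar>" if "s \<le> 1" "t \<le> 1" for s t
    using field_differentiable_bound[of "{..1::real}" "exp_bump (bump_deriv 1)" "exp_bump (bump_deriv (bump_deriv 1))" H s t] H that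
    by (auto intro!: has_field_derivative_at_within DERIV_exp_bump)
  define V where "V = measure lborel (ball (0::'a) 1)"
  have key: "\<bar>bump_mean w a 1 - bump_mean w 0 1\<bar> \<le> 5 * norm a * H * (W * R powr (- ?N - 1) + \<epsilon> * 2 ^ Suc DIM('a) * V)"
    if R: "R > 0" "norm a \<le> R" and \<epsilon>: "\<epsilon> > 0" and R0: "AE x in lborel. R0 \<le> norm x \<longrightarrow> \<bar>w x\<bar> \<le> \<epsilon> * norm x"
      and W: "W = (LBINT y. indicator (cball 0 R0) y * \<bar>w y\<bar>)" for R \<epsilon> R0 W
  proof -
    define k where "k b y = w y * (R powr (- ?N) * mean_bump b R y)" for b y
    have i: "integrable lborel (k b)" for b
      using integrable_mult_right[OF integrable_mult_radial_bump[OF w R(1)], of "R powr (- ?N)"] by (simp add: k_def[abs_def] mult.left_commute)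
    have pt: "\<bar>mean_bump a R y - mean_bump 0 R y\<bar> \<le> 5 * norm a * H / R * indicator (cball 0 (2 * R)) y" for y
    proof (cases "norm y \<le> 2 * R")
      case True
      have "\<bar>mean_bump a R y - mean_bump 0 R y\<bar> \<le> H * \<bar>(1 - (norm (y - a))\<^sup>2 / R\<^sup>2) - (1 - (norm (y - 0))\<^sup>2 / R\<^sup>2)\<bar>"
        unfolding radial_bump_def by (rule Lip) auto
      also have "\<dots> \<le> H * (5 * norm a / R)"
      proof (intro mult_left_mono H(1))
        have "(1 - (norm (y - a))\<^sup>2 / R\<^sup>2) - (1 - (norm (y - 0))\<^sup>2 / R\<^sup>2) = (norm y - norm (y - a)) * (norm y + norm (y - a)) / R\<^sup>2"
          using R by (simp add: field_simps power2_eq_square)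
        hence "\<bar>(1 - (norm (y - a))\<^sup>2 / R\<^sup>2) - (1 - (norm (y - 0))\<^sup>2 / R\<^sup>2)\<bar> = \<bar>norm y - norm (y - a)\<bar> * (norm y + norm (y - a)) / R\<^sup>2"
          by (simp add: abs_mult)
        also have "\<dots> \<le> norm a * (5 * R) / R\<^sup>2"
        proof (intro divide_right_mono mult_mono)
          show "\<bar>norm y - norm (y - a)\<bar> \<le> norm a" using norm_triangle_ineq3[of y "y - a"] by simp
          show "norm y + norm (y - a) \<le> 5 * R" using norm_triangle_ineq4[of y a] True R by linarith
        qed auto
        also have "\<dots> = 5 * norm a / R" using R by (simp add: power2_eq_square)
        finally show "\<bar>(1 - (norm (y - a))\<^sup>2 / R\<^sup>2) - (1 - (norm (y - 0))\<^sup>2 / R\<^sup>2)\<bar> \<le> 5 * norm a / R" .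
      qed
      finally show ?thesis using True by (simp add: mult.commute)
    next
      case False
      have "norm (y - a) \<ge> R" using norm_triangle_ineq2[of y a] False R by linarith
      hence "mean_bump a R y = 0" "mean_bump 0 R y = 0" using False R by (auto intro!: radial_bump_eq_0)
      thus ?thesis using False by simp
    qed
    define I where "I = (LBINT y. indicator (cball 0 (2 * R)) y * \<bar>w y\<bar>)"
    have iI: "integrable lborel (\<lambda>y. indicator (cball 0 S) y * \<bar>w y\<bar>)" for S by (rule locally_integrable_abs[OF w])
    have "bump_mean w a 1 - bump_mean w 0 1 = bump_mean w a R - bump_mean w 0 R"
      by (simp add: bump_mean_radius_independent[OF w harm R(1)])
    also have "\<dots> = (LBINT y. k a y - k 0 y)"
      unfolding bump_mean_def k_def[symmetric] by (rule Bochner_Integration.integral_diff[OF i i, symmetric])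
    finally have "\<bar>bump_mean w a 1 - bump_mean w 0 1\<bar>
        \<le> (LBINT y. \<bar>k a y - k 0 y\<bar>)"
      using integral_abs_bound by metis
    also have "\<dots> \<le> (LBINT y. R powr (- ?N) * (5 * norm a * H / R) * (indicator (cball 0 (2 * R)) y * \<bar>w y\<bar>))"
    proof (intro integral_mono integrable_mult_right iI)
      show "integrable lborel (\<lambda>y. \<bar>k a y - k 0 y\<bar>)"
        by (intro integrable_abs Bochner_Integration.integrable_diff i)
      fix y :: 'a
      have "\<bar>k a y - k 0 y\<bar>
         = (\<bar>w y\<bar> * R powr (- ?N)) * \<bar>mean_bump a R y - mean_bump 0 R y\<bar>"
        by (simp add: k_def right_diff_distrib[symmetric] abs_mult)
      also have "\<dots> \<le> (\<bar>w y\<bar> * R powr (- ?N)) * (5 * norm a * H / R * indicator (cball 0 (2 * R)) y)"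
        by (intro mult_left_mono pt) auto
      finally show "\<bar>k a y - k 0 y\<bar>
        \<le> R powr (- ?N) * (5 * norm a * H / R) * (indicator (cball 0 (2 * R)) y * \<bar>w y\<bar>)" by (simp only: ac_simps)
    qed
    also have "\<dots> = R powr (- ?N) * (5 * norm a * H / R) * I" by (simp add: I_def)
    also have "\<dots> = 5 * norm a * H * (R powr (- ?N - 1) * I)"
    proof -
      have e: "R powr (- ?N - 1) = R powr (- ?N) / R" using R powr_diff[of R "- ?N" 1] by simp
      show ?thesis unfolding e by simp
    qed
    also have "\<dots> \<le> 5 * norm a * H * (W * R powr (- ?N - 1) + \<epsilon> * 2 ^ Suc DIM('a) * V)"
    proof (intro mult_left_mono)
      have fin: "integrable lborel (\<lambda>y::'a. indicator (cball 0 (2 * R)) y :: real)" by (rule integrable_indicator_cball)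
      have "I \<le> (LBINT y. indicator (cball 0 R0) y * \<bar>w y\<bar> + \<epsilon> * (2 * R) * indicator (cball 0 (2 * R)) y)"
        unfolding I_def
      proof (rule integral_mono_AE)
        show "AE y in lborel. indicator (cball 0 (2 * R)) y * \<bar>w y\<bar> \<le> indicator (cball 0 R0) y * \<bar>w y\<bar> + \<epsilon> * (2 * R) * indicator (cball 0 (2 * R)) y"
          using R0
        proof eventually_elim
          case (elim y)
          show ?case
          proof (cases "norm y \<le> 2 * R \<and> R0 \<le> norm y")
            case True
            hence "\<bar>w y\<bar> \<le> \<epsilon> * norm y" using elim by simp
            also have "\<dots> \<le> \<epsilon> * (2 * R)" using True \<epsilon> by (intro mult_left_mono) auto
            finally show ?thesis using True R(1) \<epsilon> by (auto simp: indicator_def)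
          next
            case False
            thus ?thesis using R \<epsilon> by (auto simp: indicator_def)
          qed
        qed
      qed (use iI fin in auto)
      also have "\<dots> = W + \<epsilon> * (2 * R) * measure lborel (cball (0::'a) (2 * R))"
        using iI fin by (simp add: W)
      also have "measure lborel (cball (0::'a) (2 * R)) = V * (2 * R) ^ DIM('a)"
        using R content_ball_conv_unit_ball[of "2 * R" "0::'a"] content_cball_conv_ball[of "0::'a" "2 * R"] by (simp add: V_def mult.commute)
      finally have "R powr (- ?N - 1) * I \<le> R powr (- ?N - 1) * (W + \<epsilon> * (2 * R) * (V * (2 * R) ^ DIM('a)))"
        by (intro mult_left_mono) auto
      also have "\<dots> = W * R powr (- ?N - 1) + \<epsilon> * 2 ^ Suc DIM('a) * V * (R powr (- ?N - 1) * R ^ Suc DIM('a))"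
        by (simp add: power_mult_distrib algebra_simps)
      also have "R powr (- ?N - 1) * R ^ Suc DIM('a) = 1"
      proof -
        have "R ^ Suc DIM('a) = R powr (real (Suc DIM('a)))" using R by (simp only: powr_realpow)
        thus ?thesis using R by (simp only: powr_add[symmetric]) simp
      qed
      finally show "R powr (- ?N - 1) * I \<le> W * R powr (- ?N - 1) + \<epsilon> * 2 ^ Suc DIM('a) * V" by simp
    qed (use H(1) in auto)
    finally show ?thesis .
  qed
  have "\<bar>bump_mean w a 1 - bump_mean w 0 1\<bar> \<le> \<epsilon> * (5 * norm a * H * 2 ^ Suc DIM('a) * V)" if \<epsilon>: "\<epsilon> > 0" for \<epsilon>
  proof -
    obtain R0 where R0: "AE x in lborel. R0 \<le> norm x \<longrightarrow> \<bar>w x\<bar> \<le> \<epsilon> * norm x" using sub[OF \<epsilon>] by blast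
    define W where "W = (LBINT y. indicator (cball 0 R0) y * \<bar>w y\<bar>)"
    have "((\<lambda>R. R powr (- ?N - 1)) \<longlongrightarrow> 0) at_top"
      by (rule tendsto_neg_powr) (auto simp: filterlim_ident)
    hence "((\<lambda>R. 5 * norm a * H * (W * R powr (- ?N - 1) + \<epsilon> * 2 ^ Suc DIM('a) * V)) \<longlongrightarrow> 5 * norm a * H * (W * 0 + \<epsilon> * 2 ^ Suc DIM('a) * V)) at_top"
      by (intro tendsto_intros)
    moreover have "\<forall>\<^sub>F R in at_top. \<bar>bump_mean w a 1 - bump_mean w 0 1\<bar> \<le> 5 * norm a * H * (W * R powr (- ?N - 1) + \<epsilon> * 2 ^ Suc DIM('a) * V)"
      using eventually_gt_at_top[of 0] eventually_ge_at_top[of "norm a"]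
      by eventually_elim (rule key[OF _ _ \<epsilon> R0 W_def])
    ultimately have "\<bar>bump_mean w a 1 - bump_mean w 0 1\<bar> \<le> 5 * norm a * H * (W * 0 + \<epsilon> * 2 ^ Suc DIM('a) * V)"
      by (rule tendsto_lowerbound) simp
    thus ?thesis by (simp add: algebra_simps)
  qed
  hence "\<bar>bump_mean w a 1 - bump_mean w 0 1\<bar> \<le> 0"
    by (rule small_multiple_le_0)
  thus ?thesis by simp
qed

section \<open>A Liouville theorem\<close>

text \<open>
On each bounded box the measures whose densities are the positive and the negative part of \<open>W\<close> agree on
all boxes, a generator that is stable under intersection; hence they are equal, and so are the densities.
\<close>

lemma AE_eq_0_if_box_integrals_0:
  fixes W :: "'a::euclidean_space \<Rightarrow> real"
  assumes W: "locally_integrable W"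
    and zero: "\<And>l u. (LBINT y. W y * indicator (box l u) y) = 0"
  shows "AE y in lborel. W y = 0"
proof -
  have [measurable]: "W \<in> borel_measurable borel" by (rule locally_integrable_measurable[OF W])
  let ?B = "\<lambda>n::nat. box (- (real n *\<^sub>R One)) (real n *\<^sub>R One) :: 'a set"
  have each: "AE y in lborel. y \<in> ?B n \<longrightarrow> W y = 0" for n
  proof -
    let ?p = "\<lambda>y. ennreal (indicator (?B n) y * max 0 (W y))" and ?m = "\<lambda>y. ennreal (indicator (?B n) y * max 0 (- W y))"
    have bi: "integrable lborel (\<lambda>y. W y * indicator (box l u) y)" for l u
    proof -
      obtain S where S: "\<And>y. y \<in> box l u \<Longrightarrow> norm y \<le> S" using bounded_box[of l u] by (auto simp: bounded_iff)
      show ?thesis by (rule locally_integrable_mult[OF W, of _ 1 S]) (use S in \<open>force simp: indicator_def\<close>)+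
    qed
    have eq: "emeasure (density lborel ?p) X = emeasure (density lborel ?m) X" if X: "X = box l u" for X l u
    proof -
      obtain l' u' where b: "?B n \<inter> box l u = box l' u'" unfolding box_Int_box by blast
      have e: "emeasure (density lborel (\<lambda>y. ennreal (indicator (?B n) y * f y))) X = ennreal (LBINT y. f y * indicator (box l' u') y)"
        if f: "\<And>y. f y \<ge> 0" "f \<in> borel_measurable borel" "integrable lborel (\<lambda>y. f y * indicator (box l' u') y)" for f :: "'a \<Rightarrow> real"
      proof -
        note f(2)[measurable]
        have "emeasure (density lborel (\<lambda>y. ennreal (indicator (?B n) y * f y))) X = (\<integral>\<^sup>+y. ennreal (indicator (?B n) y * f y) * indicator X y \<partial>lborel)"
          unfolding X by (rule emeasure_density) auto
        also have "\<dots> = (\<integral>\<^sup>+y. ennreal (f y * indicator (box l' u') y) \<partial>lborel)"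
          unfolding b[symmetric] X by (intro nn_integral_cong) (auto simp: indicator_def)
        also have "\<dots> = ennreal (LBINT y. f y * indicator (box l' u') y)"
          by (rule nn_integral_eq_integral[OF f(3)]) (use f(1) in auto)
        finally show ?thesis .
      qed
      let ?b = "indicator (box l' u') :: 'a \<Rightarrow> real"
      have ip: "integrable lborel (\<lambda>y. max 0 (W y) * ?b y)"
        by (rule integrable_dominated[OF integrable_abs[OF bi[of l' u']]]) (auto simp: indicator_def)
      have im: "integrable lborel (\<lambda>y. max 0 (- W y) * ?b y)"
        by (rule integrable_dominated[OF integrable_abs[OF bi[of l' u']]]) (auto simp: indicator_def)
      have "(LBINT y. max 0 (W y) * ?b y) - (LBINT y. max 0 (- W y) * ?b y)
        = (LBINT y. max 0 (W y) * ?b y - max 0 (- W y) * ?b y)"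
        by (rule Bochner_Integration.integral_diff[OF ip im, symmetric])
      also have "\<dots> = (LBINT y. W y * ?b y)"
        by (intro Bochner_Integration.integral_cong refl) (auto simp: indicator_def max_def)
      finally have "(LBINT y. max 0 (W y) * ?b y) = (LBINT y. max 0 (- W y) * ?b y)"
        using zero by simp
      thus ?thesis using e[OF _ _ ip] e[OF _ _ im] by simp
    qed
    let ?E = "range (\<lambda>(a, b). box a b::'a set)"
    have "density lborel ?p = density lborel ?m"
    proof (rule measure_eqI_generator_eq[of ?E UNIV _ _ ?B])
      show "Int_stable ?E" by (auto simp: Int_stable_def box_Int_box)
      show "?E \<subseteq> Pow UNIV" "sets (density lborel ?p) = sigma_sets UNIV ?E" "sets (density lborel ?m) = sigma_sets UNIV ?E"
        by (simp_all add: borel_eq_box)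
      show "range ?B \<subseteq> ?E" "(\<Union>i. ?B i) = UNIV" unfolding UN_box_eq_UNIV by auto
      show "emeasure (density lborel ?p) X = emeasure (density lborel ?m) X" if "X \<in> ?E" for X
        using that eq by auto
      show "emeasure (density lborel ?p) (?B i) \<noteq> \<infinity>" for i
      proof -
        have "emeasure (density lborel ?p) (?B i) = (\<integral>\<^sup>+y. ?p y * indicator (?B i) y \<partial>lborel)"
          by (rule emeasure_density) auto
        also have "\<dots> \<le> (\<integral>\<^sup>+y. ennreal (norm (W y * indicator (?B n) y)) \<partial>lborel)"
          by (intro nn_integral_mono) (auto simp: indicator_def intro!: ennreal_leI)
        also have "\<dots> < \<infinity>" using bi[of "- (real n *\<^sub>R One)" "real n *\<^sub>R One"] by (simp only: integrable_iff_bounded)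
        finally show ?thesis by simp
      qed
    qed
    hence "AE y in lborel. ?p y = ?m y" by (intro sigma_finite_measure.density_unique[OF sigma_finite_lborel]) auto
    thus ?thesis by eventually_elim (auto simp: max_def split: if_splits)
  qed
  have "AE y in lborel. \<forall>n. y \<in> ?B n \<longrightarrow> W y = 0" unfolding AE_all_countable using each by blast
  moreover have "\<exists>n. y \<in> ?B n" for y :: 'a using UN_box_eq_UNIV by blast
  ultimately show ?thesis by (auto elim!: eventually_mono)
qed

definition bump_mass :: "'a::euclidean_space itself \<Rightarrow> real" where
  "bump_mass _ = (LBINT z. mean_bump (0::'a) 1 z)"

lemma integrable_radial_bump: "R > 0 \<Longrightarrow> integrable lborel (radial_bump P a R)" for a :: "'a::euclidean_space"
proof (rule integrable_continuous_compact_support[OF continuous_on_radial_bump, where R = "norm a + R"])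
  fix x :: 'a assume R: "R > 0" and "norm a + R < norm x"
  hence "R \<le> norm (x - a)" using norm_triangle_ineq2[of x a] by simp
  thus "radial_bump P a R x = 0" by (rule radial_bump_eq_0[OF R])
qed

lemma bump_mass_pos: "bump_mass TYPE('a::euclidean_space) > 0"
proof -
  have "bump_mass TYPE('a) \<ge> 0" unfolding bump_mass_def
    by (intro integral_nonneg_AE AE_I2) (simp add: mean_bump_nonneg)
  moreover have "bump_mass TYPE('a) \<noteq> 0"
  proof
    assume "bump_mass TYPE('a) = 0"
    hence "AE z in lborel. mean_bump (0::'a) 1 z = 0"
      unfolding bump_mass_def
      by (subst (asm) integral_nonneg_eq_0_iff_AE) (auto intro: integrable_radial_bump simp: mean_bump_nonneg)
    moreover have "mean_bump (0::'a) 1 z \<noteq> 0" if "norm z < 1" for z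
    proof -
      have "(norm z)\<^sup>2 < 1" using that by (simp add: power_less_one_iff)
      thus ?thesis by (simp add: radial_bump_def exp_bump_def bump_deriv_def)
    qed
    ultimately have "AE z in lborel. (z::'a) \<notin> ball 0 1" by (auto elim!: eventually_mono)
    moreover have "ball (0::'a) 1 = {z. \<not> z \<notin> ball 0 1}" by auto
    ultimately have "emeasure lborel (ball (0::'a) 1) = 0" by (subst (asm) AE_iff_measurable[of "ball 0 1"]) auto
    hence "measure lborel (ball (0::'a) 1) = 0" by (simp add: measure_def)
    thus False using content_ball_pos[of 1 "0::'a"] by simp
  qed
  ultimately show ?thesis by simp
qed

lemma radial_bump_affine: "R > 0 \<Longrightarrow> radial_bump P a R (a + R *\<^sub>R z) = radial_bump P 0 1 z"
  by (simp add: radial_bump_def power_mult_distrib)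

lemma radial_bump_commute: "radial_bump P a R y = radial_bump P y R a"
  by (simp add: radial_bump_def norm_minus_commute)

lemma integral_mean_bump: "R > 0 \<Longrightarrow> (LBINT y. mean_bump a R y) = R ^ DIM('a) * bump_mass TYPE('a)" for a :: "'a::euclidean_space"
  using integral_lborel_affine[OF integrable_radial_bump[of R "bump_deriv 1" a], of R a]
  by (simp add: radial_bump_affine bump_mass_def)

text \<open>
Integrating the hypothesis over all centres \<open>a\<close> in a box tests \<open>W\<close> against the mollified
indicator of the box. As the radius tends to zero, this converges to a multiple of the indicator off the boundary.
\<close>

lemma AE_eq_0_if_bump_integrals_0:
  fixes W :: "'a::euclidean_space \<Rightarrow> real"
  assumes W: "locally_integrable W"
    and zero: "\<And>a R. R > 0 \<Longrightarrow> (LBINT y. W y * mean_bump a R y) = 0"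
  shows "AE y in lborel. W y = 0"
proof (rule AE_eq_0_if_box_integrals_0[OF W])
  fix l u :: 'a
  let ?N = "DIM('a)"
  let ?U = "box l u"
  have [measurable]: "W \<in> borel_measurable borel" by (rule locally_integrable_measurable[OF W])
  obtain S where S: "\<And>y. y \<in> ?U \<Longrightarrow> norm y \<le> S" using bounded_box[of l u] by (auto simp: bounded_iff)
  obtain H where H: "H \<ge> 0" "\<And>a R x. \<bar>mean_bump a R (x::'a)\<bar> \<le> H" by (rule radial_bump_bounded[of "bump_deriv 1"]) blast
  define \<kappa> where "\<kappa> = bump_mass TYPE('a)"
  have \<kappa>: "\<kappa> > 0" unfolding \<kappa>_def by (rule bump_mass_pos)
  define \<theta> where "\<theta> R y = (LBINT z. indicator ?U (y + R *\<^sub>R z) * mean_bump 0 1 z)" for R and y :: 'a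
  have [measurable]: "(\<lambda>(a, y). mean_bump a R y) \<in> borel_measurable (borel \<Otimes>\<^sub>M (borel :: 'a measure))" for R
  proof -
    have [measurable]: "exp_bump P \<in> borel_measurable borel" for P
      by (rule borel_measurable_continuous_onI[OF continuous_on_exp_bump])
    show ?thesis unfolding radial_bump_def by measurable
  qed
  have supp: "mean_bump a R y = 0" if "R > 0" "R \<le> 1" "norm a \<le> S" "S + 1 < norm y" for a y :: 'a and R
  proof (rule radial_bump_eq_0[OF that(1)])
    show "R \<le> norm (y - a)" using norm_triangle_ineq2[of y a] that by linarith
  qed
  have fub: "(LBINT y. W y * \<theta> R y) = 0" if R: "R > 0" "R \<le> 1" for R
  proof -
    define F where "F a y = indicator ?U a * (W y * mean_bump a R y)" for a y
    have mF: "case_prod F \<in> borel_measurable (lborel \<Otimes>\<^sub>M lborel)" unfolding F_def by measurable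
    define D where "D = H * (LBINT y. indicator (cball 0 (S + 1)) y * \<bar>W y\<bar>)"
    have Wi: "integrable lborel (\<lambda>y. W y * mean_bump a R y)" for a by (rule integrable_mult_radial_bump[OF W R(1)])
    have inner: "(LBINT a. F a y) = R ^ ?N * (W y * \<theta> R y)" for y
    proof -
      have ib: "integrable lborel (\<lambda>a. indicator ?U a * mean_bump y R a)"
        by (rule integrable_dominated[OF integrable_radial_bump[OF R(1), of "bump_deriv 1" y]])
           (auto simp: indicator_def mean_bump_nonneg)
      have "(LBINT a. F a y) = (LBINT a. W y * (indicator ?U a * mean_bump y R a))"
        unfolding F_def by (subst radial_bump_commute) (simp add: mult.left_commute)
      also have "\<dots> = W y * (R ^ ?N * \<theta> R y)"
        using integral_lborel_affine[OF ib, of R y] R by (simp add: radial_bump_affine \<theta>_def)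
      finally show ?thesis by simp
    qed
    have "(LBINT y. LBINT a. F a y) = (LBINT a. LBINT y. F a y)"
    proof (rule Fubini_integral_dominated[OF mF])
      show "integrable lborel (F x)" for x using Wi by (simp add: F_def[abs_def])
      show "integrable lborel (\<lambda>x::'a. D * indicator ?U x)"
        using emeasure_lborel_box_finite[of l u] by (intro integrable_mult_right integrable_real_indicator) auto
      show "(LBINT y. \<bar>F x y\<bar>) \<le> D * indicator ?U x" for x
      proof (cases "x \<in> ?U")
        case True
        have "(LBINT y. \<bar>W y * mean_bump x R y\<bar>) \<le> (LBINT y. H * (indicator (cball 0 (S + 1)) y * \<bar>W y\<bar>))"
        proof (intro integral_mono integrable_abs Wi integrable_mult_right locally_integrable_abs W)
          fix y :: 'a
          have "\<bar>W y\<bar> * \<bar>mean_bump x R y\<bar> \<le> \<bar>W y\<bar> * H" by (intro mult_left_mono H) auto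
          thus "\<bar>W y * mean_bump x R y\<bar> \<le> H * (indicator (cball 0 (S + 1)) y * \<bar>W y\<bar>)"
            using supp[OF R S[OF True], of y] by (auto simp: abs_mult indicator_def mult.commute)
        qed
        thus ?thesis using True by (simp add: F_def D_def)
      qed (simp add: F_def)
    qed
    also have "\<dots> = 0" by (simp add: F_def zero[OF R(1)])
    finally show ?thesis using R by (simp add: inner)
  qed
  define \<epsilon> where "\<epsilon> j = inverse (real (Suc j))" for j
  have \<epsilon>: "\<epsilon> j > 0" "\<epsilon> j \<le> 1" for j by (auto simp: \<epsilon>_def field_simps)
  have \<epsilon>0: "\<epsilon> \<longlonglongrightarrow> 0" unfolding \<epsilon>_def[abs_def] by (rule LIMSEQ_inverse_real_of_nat)
  have bi: "integrable lborel (\<lambda>z::'a. mean_bump 0 1 z)" by (rule integrable_radial_bump) simp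
  have \<theta>i: "integrable lborel (\<lambda>z. indicator ?U (y + R *\<^sub>R z) * mean_bump 0 1 z)" for R y
    by (rule integrable_dominated[OF bi]) (auto simp: indicator_def mean_bump_nonneg)
  have \<theta>bd: "\<bar>\<theta> R y\<bar> \<le> \<kappa>" for R y
  proof -
    have "\<bar>\<theta> R y\<bar> \<le> (LBINT z. \<bar>indicator ?U (y + R *\<^sub>R z) * mean_bump 0 1 z\<bar>)" unfolding \<theta>_def by (rule integral_abs_bound)
    also have "\<dots> \<le> \<kappa>" unfolding \<kappa>_def bump_mass_def
      by (intro integral_mono integrable_abs \<theta>i bi) (auto simp: indicator_def mean_bump_nonneg)
    finally show ?thesis .
  qed
  have \<theta>supp: "\<theta> R y = 0" if R: "R > 0" "R \<le> 1" and y: "S + 1 < norm y" for R y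
  proof -
    have eq: "indicator ?U (y + R *\<^sub>R z) * mean_bump 0 1 z = 0" for z
    proof (cases "norm z \<le> 1")
      case True
      have "norm y \<le> norm (y + R *\<^sub>R z) + norm (R *\<^sub>R z)" using norm_triangle_ineq4[of "y + R *\<^sub>R z" "R *\<^sub>R z"] by simp
      moreover have "norm (R *\<^sub>R z) \<le> 1" using True R by (simp add: mult_le_one)
      ultimately have "S < norm (y + R *\<^sub>R z)" using y by linarith
      hence "y + R *\<^sub>R z \<notin> ?U" using S by force
      thus ?thesis by simp
    qed (simp add: radial_bump_eq_0)
    show ?thesis unfolding \<theta>_def eq by simp
  qed
  have \<theta>lim: "(\<lambda>j. \<theta> (\<epsilon> j) y) \<longlonglongrightarrow> \<kappa> * indicator ?U y" if y: "y \<notin> cbox l u - box l u" for y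
  proof -
    have ev: "\<forall>\<^sub>F j in sequentially. indicator ?U (y + \<epsilon> j *\<^sub>R z) = (indicator ?U y :: real)" for z
    proof -
      have t: "(\<lambda>j. y + \<epsilon> j *\<^sub>R z) \<longlonglongrightarrow> y"
      proof -
        have "(\<lambda>j. y + \<epsilon> j *\<^sub>R z) \<longlonglongrightarrow> y + 0 *\<^sub>R z" by (intro tendsto_intros \<epsilon>0)
        thus ?thesis by simp
      qed
      show ?thesis
      proof (cases "y \<in> ?U")
        case True
        have "\<forall>\<^sub>F j in sequentially. y + \<epsilon> j *\<^sub>R z \<in> ?U" by (rule topological_tendstoD[OF t open_box True])
        thus ?thesis using True by (auto elim!: eventually_mono)
      next
        case False
        hence "y \<in> - cbox l u" using y by auto
        have "\<forall>\<^sub>F j in sequentially. y + \<epsilon> j *\<^sub>R z \<in> - cbox l u"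
          by (rule topological_tendstoD[OF t _ \<open>y \<in> - cbox l u\<close>]) (simp add: closed_cbox open_Compl)
        thus ?thesis using False box_subset_cbox[of l u] by (auto elim!: eventually_mono simp: indicator_def)
      qed
    qed
    have "(\<lambda>j. \<theta> (\<epsilon> j) y) \<longlonglongrightarrow> (LBINT z. indicator ?U y * mean_bump (0::'a) 1 z)" unfolding \<theta>_def
    proof (rule integral_dominated_convergence[OF _ _ bi])
      show "AE z in lborel. (\<lambda>j. indicator ?U (y + \<epsilon> j *\<^sub>R z) * mean_bump 0 1 z) \<longlonglongrightarrow> indicator ?U y * mean_bump 0 1 z"
        by (intro AE_I2 tendsto_mult tendsto_const tendsto_eventually ev)
      show "AE z in lborel. norm (indicator ?U (y + \<epsilon> j *\<^sub>R z) * mean_bump 0 1 z) \<le> mean_bump 0 1 z" for j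
        by (intro AE_I2) (auto simp: indicator_def mean_bump_nonneg)
    qed measurable
    thus ?thesis by (simp add: \<kappa>_def bump_mass_def mult.commute)
  qed
  have [measurable]: "\<theta> R \<in> borel_measurable borel" for R unfolding \<theta>_def[abs_def] by measurable
  have "(\<lambda>j. LBINT y. W y * \<theta> (\<epsilon> j) y) \<longlonglongrightarrow> (LBINT y. W y * (\<kappa> * indicator ?U y))"
  proof (rule integral_dominated_convergence[where w = "\<lambda>y. \<kappa> * (indicator (cball 0 (S + 1)) y * \<bar>W y\<bar>)"])
    show "integrable lborel (\<lambda>y. \<kappa> * (indicator (cball 0 (S + 1)) y * \<bar>W y\<bar>))"
      by (intro integrable_mult_right locally_integrable_abs W)
    have "AE y in lborel. y \<notin> cbox l u - box l u" by (rule AE_not_in[OF null_sets_cbox_Diff_box])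
    thus "AE y in lborel. (\<lambda>j. W y * \<theta> (\<epsilon> j) y) \<longlonglongrightarrow> W y * (\<kappa> * indicator ?U y)"
      by eventually_elim (intro tendsto_mult tendsto_const \<theta>lim)
    show "AE y in lborel. norm (W y * \<theta> (\<epsilon> j) y) \<le> \<kappa> * (indicator (cball 0 (S + 1)) y * \<bar>W y\<bar>)" for j
    proof (rule AE_I2)
      fix y :: 'a
      have "\<bar>W y\<bar> * \<bar>\<theta> (\<epsilon> j) y\<bar> \<le> \<bar>W y\<bar> * \<kappa>" by (intro mult_left_mono \<theta>bd) auto
      thus "norm (W y * \<theta> (\<epsilon> j) y) \<le> \<kappa> * (indicator (cball 0 (S + 1)) y * \<bar>W y\<bar>)"
        using \<theta>supp[OF \<epsilon>, of y j] by (auto simp: abs_mult indicator_def mult.commute)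
    qed
  qed measurable
  hence "(LBINT y. W y * (\<kappa> * indicator ?U y)) = 0"
    using LIMSEQ_unique[OF _ tendsto_const] by (simp add: fub[OF \<epsilon>])
  moreover have "(LBINT y. W y * (\<kappa> * indicator ?U y)) = \<kappa> * (LBINT y. W y * indicator ?U y)"
    unfolding integral_mult_right_zero[symmetric] by (intro Bochner_Integration.integral_cong refl mult.left_commute)
  ultimately show "(LBINT y. W y * indicator ?U y) = 0" using \<kappa> by simp
qed

text \<open>
All bump averages of \<open>w\<close>, for every centre and radius, agree with those of one constant \<open>c\<close>, so those of \<open>w - c\<close> vanish.
\<close>

theorem Liouville_weakly_harmonic:
  fixes w :: "'a::euclidean_space \<Rightarrow> real"
  assumes w: "locally_integrable w" and harm: "\<And>\<phi>. \<phi> \<in> test_functions \<Longrightarrow> (LBINT x. w x * laplacian \<phi> x) = 0"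
    and sub: "\<And>\<epsilon>. \<epsilon> > 0 \<Longrightarrow> \<exists>R. AE x in lborel. R \<le> norm x \<longrightarrow> \<bar>w x\<bar> \<le> \<epsilon> * norm x"
  shows "\<exists>c. AE x in lborel. w x = c"
proof -
  define \<kappa> where "\<kappa> = bump_mass TYPE('a)"
  have \<kappa>: "\<kappa> > 0" unfolding \<kappa>_def by (rule bump_mass_pos)
  define c where "c = bump_mean w 0 1 / \<kappa>"
  have wm: "w \<in> borel_measurable borel" by (rule locally_integrable_measurable[OF w])
  have W: "locally_integrable (\<lambda>x. w x - c)" unfolding locally_integrable_def
  proof (intro conjI allI)
    fix S :: real
    have "integrable lborel (\<lambda>y::'a. indicator (cball 0 S) y :: real)" by (rule integrable_indicator_cball)
    hence "integrable lborel (\<lambda>y. indicator (cball 0 S) y * w y - c * indicator (cball 0 S) y)"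
      using w by (intro Bochner_Integration.integrable_diff integrable_mult_right) (auto simp: locally_integrable_def)
    thus "integrable lborel (\<lambda>y. indicator (cball 0 S) y * (w y - c))" by (simp add: algebra_simps)
  qed (use wm in measurable)
  have "AE x in lborel. w x - c = 0"
  proof (rule AE_eq_0_if_bump_integrals_0[OF W])
    fix a :: 'a and R :: real assume R: "R > 0"
    have "R powr (- real DIM('a)) * (LBINT y. w y * mean_bump a R y) = bump_mean w a R"
      unfolding bump_mean_def integral_mult_right_zero[symmetric]
      by (intro Bochner_Integration.integral_cong refl mult.left_commute)
    also have "\<dots> = c * \<kappa>"
      using bump_mean_radius_independent[OF w harm R, of a] bump_mean_center_independent[OF w harm sub, of a] \<kappa> by (simp add: c_def)
    finally have 1: "(LBINT y. w y * mean_bump a R y) = R ^ DIM('a) * (c * \<kappa>)"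
      using R by (simp add: powr_minus powr_realpow field_simps)
    have "(LBINT y. (w y - c) * mean_bump a R y) = (LBINT y. w y * mean_bump a R y - c * mean_bump a R y)"
      by (simp add: algebra_simps)
    also have "\<dots> = (LBINT y. w y * mean_bump a R y) - (LBINT y. c * mean_bump a R y)"
      by (intro Bochner_Integration.integral_diff integrable_mult_radial_bump[OF w R] integrable_mult_right integrable_radial_bump R)
    also have "\<dots> = 0" using 1 integral_mean_bump[OF R, of a] by (simp add: \<kappa>_def)
    finally show "(LBINT y. (w y - c) * mean_bump a R y) = 0" .
  qed
  hence "AE x in lborel. w x = c" by eventually_elim simp
  thus ?thesis by blast
qed

section \<open>The Poisson equation with Lebesgue data\<close>

lemma borel_representative:
  fixes f :: "'a::euclidean_space \<Rightarrow> real"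
  assumes "f \<in> borel_measurable lebesgue"
  obtains g where "g \<in> borel_measurable borel" "AE x in lebesgue. f x = g x"
  using completion_ex_borel_measurable_real[OF assms] by (auto simp: AE_completion_iff)

text \<open>
The product measure arguments above need Borel functions on \<open>lborel\<close>, whereas data and solutions are
measurable with respect to its completion. This lemma carries integrals from one setting to the other.
\<close>

lemma integral_lebesgue_AE_eq_lborel:
  fixes F G :: "'a::euclidean_space \<Rightarrow> real"
  assumes F: "F \<in> borel_measurable lebesgue" and G: "G \<in> borel_measurable borel" and eq: "AE x in lebesgue. F x = G x"
  shows "integrable lebesgue F \<longleftrightarrow> integrable lborel G" and "(LINT x|lebesgue. F x) = (LINT x|lborel. G x)"
proof -
  have G': "G \<in> borel_measurable lborel" using G by simp
  hence G'': "G \<in> borel_measurable lebesgue" by (rule measurable_completion)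
  show "integrable lebesgue F \<longleftrightarrow> integrable lborel G"
    unfolding integrable_completion[OF G', symmetric] by (rule integrable_cong_AE[OF F G'' eq])
  show "(LINT x|lebesgue. F x) = (LINT x|lborel. G x)"
    unfolding integral_completion[OF G', symmetric] by (rule integral_cong_AE[OF F G'' eq])
qed

lemma Lp_representative:
  fixes f :: "'a::euclidean_space \<Rightarrow> real"
  assumes f: "f \<in> Lp p" and g: "g \<in> borel_measurable borel" and eq: "AE x in lebesgue. f x = g x"
  shows "integrable lborel (\<lambda>x. \<bar>g x\<bar> powr p)" and "Lp_norm p f = lborel_norm p g"
proof -
  note g[measurable]
  have fm[measurable]: "f \<in> borel_measurable lebesgue" and fi: "integrable lebesgue (\<lambda>x. \<bar>f x\<bar> powr p)"
    using f by (auto simp: Lp_def)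
  have F: "(\<lambda>x. \<bar>f x\<bar> powr p) \<in> borel_measurable lebesgue" by measurable
  have G: "(\<lambda>x. \<bar>g x\<bar> powr p) \<in> borel_measurable borel" by measurable
  have e: "AE x in lebesgue. \<bar>f x\<bar> powr p = \<bar>g x\<bar> powr p" using eq by eventually_elim simp
  show "integrable lborel (\<lambda>x. \<bar>g x\<bar> powr p)" "Lp_norm p f = lborel_norm p g"
    using integral_lebesgue_AE_eq_lborel[OF F G e] fi by (auto simp: Lp_norm_def)
qed

text \<open>
Pointwise, \<open>\<bar>f x\<bar> powr r\<close> is at most \<open>\<bar>f x\<bar> powr q\<close> where \<open>\<bar>f x\<bar> \<le> 1\<close>, and at most \<open>\<bar>f x\<bar> powr p\<close> elsewhere.
\<close>

lemma Lp_interpolation: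
  fixes f :: "'a::euclidean_space \<Rightarrow> real"
  assumes f: "f \<in> Lp p" "f \<in> Lp q" and r: "q \<le> r" "r \<le> p"
  shows "f \<in> Lp r"
proof -
  have fm[measurable]: "f \<in> borel_measurable lebesgue" using f by (simp add: Lp_def)
  have "integrable lebesgue (\<lambda>x. \<bar>f x\<bar> powr r)"
  proof (rule integrable_dominated)
    show "integrable lebesgue (\<lambda>x. \<bar>f x\<bar> powr q + \<bar>f x\<bar> powr p)" using f by (auto simp: Lp_def)
    show "AE x in lebesgue. \<bar>\<bar>f x\<bar> powr r\<bar> \<le> \<bar>f x\<bar> powr q + \<bar>f x\<bar> powr p"
    proof (rule AE_I2)
      fix x
      have "\<bar>f x\<bar> powr r \<le> \<bar>f x\<bar> powr q" if "\<bar>f x\<bar> \<le> 1" using that r by (intro powr_mono') auto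
      moreover have "\<bar>f x\<bar> powr r \<le> \<bar>f x\<bar> powr p" if "\<bar>f x\<bar> \<ge> 1" using that r by (intro powr_mono) auto
      ultimately have "\<bar>f x\<bar> powr r \<le> \<bar>f x\<bar> powr q + \<bar>f x\<bar> powr p"
        using powr_ge_zero[of "\<bar>f x\<bar>" q] powr_ge_zero[of "\<bar>f x\<bar>" p] by linarith
      thus "\<bar>\<bar>f x\<bar> powr r\<bar> \<le> \<bar>f x\<bar> powr q + \<bar>f x\<bar> powr p" by simp
    qed
  qed measurable
  thus ?thesis by (simp add: Lp_def)
qed

lemma test_function_borel:
  assumes "\<phi> \<in> test_functions"
  shows "\<phi> \<in> borel_measurable borel" "laplacian \<phi> \<in> borel_measurable borel"
proof -
  show "\<phi> \<in> borel_measurable borel" by (rule borel_measurable_continuous_onI[OF test_function_continuous[OF assms]])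
  show "laplacian \<phi> \<in> borel_measurable borel"
    using test_function_laplacian[OF assms] borel_measurable_continuous_onI by metis
qed

lemma weak_poisson_solution_borel:
  fixes u f g :: "'a::euclidean_space \<Rightarrow> real"
  assumes f: "f \<in> borel_measurable lebesgue" "g \<in> borel_measurable borel" "AE x in lebesgue. f x = g x"
    and u: "u \<in> borel_measurable lebesgue" "u' \<in> borel_measurable borel" "AE x in lebesgue. u x = u' x"
  shows "weak_poisson_solution u f \<longleftrightarrow>
     (\<forall>\<phi>\<in>test_functions. (LBINT x. u' x * laplacian \<phi> x) = - (LBINT x. g x * \<phi> x))"
proof -
  have "(LINT x|lebesgue. u x * laplacian \<phi> x) = (LBINT x. u' x * laplacian \<phi> x) \<and>
        (LINT x|lebesgue. f x * \<phi> x) = (LBINT x. g x * \<phi> x)" if \<phi>: "\<phi> \<in> test_functions" for \<phi>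
  proof -
    note b = test_function_borel[OF \<phi>]
    have m: "\<phi> \<in> borel_measurable lebesgue" "laplacian \<phi> \<in> borel_measurable lebesgue"
      using b by (auto intro: measurable_completion)
    show ?thesis
    proof (intro conjI integral_lebesgue_AE_eq_lborel(2))
      show "(\<lambda>x. u x * laplacian \<phi> x) \<in> borel_measurable lebesgue" "(\<lambda>x. f x * \<phi> x) \<in> borel_measurable lebesgue"
        using f(1) u(1) m by (auto intro: borel_measurable_times)
      show "(\<lambda>x. u' x * laplacian \<phi> x) \<in> borel_measurable borel" "(\<lambda>x. g x * \<phi> x) \<in> borel_measurable borel"
        using f(2) u(2) b by (auto intro: borel_measurable_times)
      show "AE x in lebesgue. u x * laplacian \<phi> x = u' x * laplacian \<phi> x" using u(3) by eventually_elim simp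
      show "AE x in lebesgue. f x * \<phi> x = g x * \<phi> x" using f(3) by eventually_elim simp
    qed
  qed
  thus ?thesis unfolding weak_poisson_solution_def by (intro ball_cong refl) auto
qed

lemma L1_loc_borel_representative:
  fixes v :: "'a::euclidean_space \<Rightarrow> real"
  assumes v: "v \<in> L1_loc"
  obtains v' where "v \<in> borel_measurable lebesgue" "locally_integrable v'" "AE x in lebesgue. v x = v' x"
proof -
  have i: "integrable lebesgue (\<lambda>x. indicator (cball 0 S) x * v x)" for S
    using v compact_cball[of "0::'a" S] by (auto simp: L1_loc_def set_integrable_def)
  have vm: "v \<in> borel_measurable lebesgue"
  proof (rule borel_measurable_LIMSEQ_real)
    show "(\<lambda>n::nat. indicator (cball 0 (real n)) x * v x) \<longlonglongrightarrow> v x" for x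
    proof (rule tendsto_eventually)
      obtain m :: nat where m: "norm x \<le> real m" using real_arch_simple by blast
      show "\<forall>\<^sub>F n in sequentially. indicator (cball 0 (real n)) x * v x = v x"
        using eventually_ge_at_top[of m] by eventually_elim (use m in auto)
    qed
    show "(\<lambda>x. indicator (cball 0 (real n)) x * v x) \<in> borel_measurable lebesgue" for n :: nat
      using i by (rule borel_measurable_integrable)
  qed
  obtain v' where v': "v' \<in> borel_measurable borel" "AE x in lebesgue. v x = v' x" by (rule borel_representative[OF vm])
  have "integrable lborel (\<lambda>x. indicator (cball 0 S) x * v' x)" for S
  proof (rule integral_lebesgue_AE_eq_lborel(1)[THEN iffD1, OF _ _ _ i[of S]])
    show "(\<lambda>x. indicator (cball 0 S) x * v x) \<in> borel_measurable lebesgue" using i by (rule borel_measurable_integrable)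
    show "(\<lambda>x. indicator (cball 0 S) x * v' x) \<in> borel_measurable borel" using v'(1) by (intro borel_measurable_times borel_measurable_indicator) auto
    show "AE x in lebesgue. indicator (cball 0 S) x * v x = indicator (cball 0 S) x * v' x" using v'(2) by eventually_elim simp
  qed
  hence "locally_integrable v'" using v'(1) by (simp add: locally_integrable_def)
  with vm v'(2) show ?thesis by (intro that)
qed

lemma continuous_locally_integrable:
  fixes u :: "'a::euclidean_space \<Rightarrow> real"
  assumes u: "continuous_on UNIV u"
  shows "locally_integrable u" "u \<in> L1_loc"
proof -
  have i: "integrable lborel (\<lambda>x. indicator K x *\<^sub>R u x)" if "compact K" for K
    by (rule borel_integrable_compact[OF that]) (rule continuous_on_subset[OF u], simp)
  have um: "u \<in> borel_measurable borel" by (rule borel_measurable_continuous_onI[OF u])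
  show "locally_integrable u" using i[OF compact_cball] um by (simp add: locally_integrable_def)
  show "u \<in> L1_loc" unfolding L1_loc_def set_integrable_def
  proof (intro CollectI allI impI)
    fix K :: "'a set" assume K: "compact K"
    have "(\<lambda>x. indicator K x *\<^sub>R u x) \<in> borel_measurable lborel" using i[OF K] by auto
    thus "integrable lebesgue (\<lambda>x. indicator K x *\<^sub>R u x)" using i[OF K] by (simp only: integrable_completion)
  qed
qed

text \<open>
The difference of a Borel version of \<open>v\<close> and \<open>u\<close> is weakly harmonic and sublinear, so the Liouville theorem applies.
\<close>

lemma sublinear_poisson_solution_unique:
  fixes u v f :: "'a::euclidean_space \<Rightarrow> real"
  assumes f: "f \<in> borel_measurable lebesgue"
    and u: "continuous_on UNIV u" "weak_poisson_solution u f" "((\<lambda>x. u x / norm x) \<longlongrightarrow> 0) at_infinity"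
    and v: "v \<in> L1_loc" "weak_poisson_solution v f" "ess_sublinear v"
  shows "\<exists>c. AE x in lebesgue. v x = u x + c"
proof -
  obtain g where g: "g \<in> borel_measurable borel" "AE x in lebesgue. f x = g x" by (rule borel_representative[OF f])
  obtain v' where v': "v \<in> borel_measurable lebesgue" "locally_integrable v'" "AE x in lebesgue. v x = v' x"
    by (rule L1_loc_borel_representative[OF v(1)])
  note uli = continuous_locally_integrable(1)[OF u(1)]
  have um: "u \<in> borel_measurable borel" by (rule locally_integrable_measurable[OF uli])
  have um': "u \<in> borel_measurable lebesgue" using um by (auto intro: measurable_completion)
  have v'm: "v' \<in> borel_measurable borel" by (rule locally_integrable_measurable[OF v'(2)])
  have su: "(LBINT x. u x * laplacian \<phi> x) = - (LBINT x. g x * \<phi> x)" if "\<phi> \<in> test_functions" for \<phi>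
    using u(2) that unfolding weak_poisson_solution_borel[OF f g um' um AE_I2[OF refl]] by blast
  have sv: "(LBINT x. v' x * laplacian \<phi> x) = - (LBINT x. g x * \<phi> x)" if "\<phi> \<in> test_functions" for \<phi>
    using v(2) that unfolding weak_poisson_solution_borel[OF f g v'(1) v'm v'(3)] by blast
  have "\<exists>c. AE x in lborel. v' x - u x = c"
  proof (rule Liouville_weakly_harmonic)
    show "locally_integrable (\<lambda>x. v' x - u x)"
      using v'(2) uli by (auto simp: locally_integrable_def right_diff_distrib)
    show "(LBINT x. (v' x - u x) * laplacian \<phi> x) = 0" if \<phi>: "\<phi> \<in> test_functions" for \<phi>
    proof -
      obtain S B where L: "continuous_on UNIV (laplacian \<phi>)" "S > 0" "\<And>x. S < norm x \<Longrightarrow> laplacian \<phi> x = 0"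
        "B \<ge> 0" "\<And>x. \<bar>laplacian \<phi> x\<bar> \<le> B" "integrable lborel (laplacian \<phi>)"
        by (rule test_function_laplacian[OF \<phi>]) auto
      have i: "integrable lborel (\<lambda>x. w x * laplacian \<phi> x)" if "locally_integrable w" for w
        by (rule locally_integrable_mult[OF that test_function_borel(2)[OF \<phi>] L(5) L(3)])
      have "(LBINT x. (v' x - u x) * laplacian \<phi> x) = (LBINT x. v' x * laplacian \<phi> x - u x * laplacian \<phi> x)"
        by (simp add: left_diff_distrib)
      also have "\<dots> = 0" using su[OF \<phi>] sv[OF \<phi>] by (subst Bochner_Integration.integral_diff[OF i[OF v'(2)] i[OF uli]]) simp
      finally show ?thesis .
    qed
    fix \<epsilon> :: real assume \<epsilon>: "\<epsilon> > 0"
    obtain R1 where R1: "AE x in lebesgue. R1 \<le> norm x \<longrightarrow> \<bar>v x / norm x\<bar> < \<epsilon> / 2"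
      using v(3) \<epsilon> unfolding ess_sublinear_def by (meson half_gt_zero)
    have "\<forall>\<^sub>F x in at_infinity. \<bar>u x / norm x\<bar> < \<epsilon> / 2"
      using tendstoD[OF u(3) half_gt_zero[OF \<epsilon>]] by (simp only: dist_real_def diff_0_right)
    then obtain R2 where R2: "\<And>x. R2 \<le> norm x \<Longrightarrow> \<bar>u x / norm x\<bar> < \<epsilon> / 2" by (auto simp: eventually_at_infinity)
    have "AE x in lebesgue. max (max R1 R2) 1 \<le> norm x \<longrightarrow> \<bar>v' x - u x\<bar> \<le> \<epsilon> * norm x"
      using R1 v'(3)
    proof eventually_elim
      case (elim x)
      show ?case
      proof
        assume x: "max (max R1 R2) 1 \<le> norm x"
        hence n: "norm x > 0" by linarith
        have "\<bar>v' x\<bar> / norm x < \<epsilon> / 2" "\<bar>u x\<bar> / norm x < \<epsilon> / 2" using elim R2[of x] x by auto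
        hence "\<bar>v' x\<bar> < \<epsilon> / 2 * norm x" "\<bar>u x\<bar> < \<epsilon> / 2 * norm x" using n by (simp_all only: pos_divide_less_eq)
        thus "\<bar>v' x - u x\<bar> \<le> \<epsilon> * norm x" by (simp add: field_simps)
      qed
    qed
    thus "\<exists>R. AE x in lborel. R \<le> norm x \<longrightarrow> \<bar>v' x - u x\<bar> \<le> \<epsilon> * norm x"
      unfolding AE_completion_iff by blast
  qed
  then obtain c where "AE x in lebesgue. v' x - u x = c" by (auto simp: AE_completion_iff)
  hence "AE x in lebesgue. v x = u x + c" using v'(3) by eventually_elim simp
  thus ?thesis by blast
qed

lemma sublinear_if_Holder:
  fixes u :: "'a::euclidean_space \<Rightarrow> real"
  assumes K: "\<And>x. \<bar>u x - u 0\<bar> \<le> K * norm x powr \<alpha>" and u0: "u 0 = 0" and \<alpha>: "\<alpha> < 1"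
  shows "((\<lambda>x. u x / norm x) \<longlongrightarrow> 0) at_infinity"
proof (rule Lim_null_comparison)
  have "((\<lambda>x::'a. norm x powr (\<alpha> - 1)) \<longlongrightarrow> 0) at_infinity"
    by (rule tendsto_neg_powr) (use \<alpha> in \<open>auto simp: filterlim_norm_at_top\<close>)
  from tendsto_mult[OF tendsto_const[of K] this]
  show "((\<lambda>x::'a. K * norm x powr (\<alpha> - 1)) \<longlongrightarrow> 0) at_infinity" by simp
  have "\<forall>\<^sub>F x::'a in at_infinity. 1 \<le> norm x" by (auto simp: eventually_at_infinity)
  thus "\<forall>\<^sub>F x in at_infinity. norm (u x / norm x) \<le> K * norm x powr (\<alpha> - 1)"
  proof eventually_elim
    case (elim x)
    hence n: "norm x > 0" by linarith
    have "\<bar>u x\<bar> / norm x \<le> K * norm x powr \<alpha> / norm x" using K[of x] u0 n by (intro divide_right_mono) auto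
    also have "\<dots> = K * norm x powr (\<alpha> - 1)" using n powr_diff[of "norm x" \<alpha> 1] by simp
    finally show ?case by simp
  qed
qed

lemma continuous_if_Holder:
  fixes u :: "'a::euclidean_space \<Rightarrow> real"
  assumes K: "\<And>x z. \<bar>u x - u z\<bar> \<le> K * norm (x - z) powr \<alpha>" and \<alpha>: "0 < \<alpha>"
  shows "continuous_on UNIV u"
  unfolding continuous_on_def
proof (intro ballI)
  fix z :: 'a
  have "((\<lambda>x. norm (x - z)) \<longlongrightarrow> 0) (at z within UNIV)" by (auto intro!: tendsto_eq_intros)
  hence "((\<lambda>x. norm (x - z) powr \<alpha>) \<longlongrightarrow> 0 powr \<alpha>) (at z within UNIV)"
    using \<alpha> by (intro tendsto_powr') auto
  from tendsto_mult[OF tendsto_const[of K] this]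
  have "((\<lambda>x. K * norm (x - z) powr \<alpha>) \<longlongrightarrow> 0) (at z within UNIV)" using \<alpha> by simp
  hence "((\<lambda>x. u x - u z) \<longlongrightarrow> 0) (at z within UNIV)"
    by (rule Lim_null_comparison[rotated]) (auto intro!: always_eventually K)
  thus "(u \<longlongrightarrow> u z) (at z within UNIV)" by (simp add: LIM_zero_iff)
qed

text \<open>
The Hoelder exponent \<open>2 - DIM('a) / p\<close> lies strictly between 0 and 1; positivity gives continuity, and being below 1
gives sublinear growth, as \<open>u 0 = 0\<close>.
\<close>

lemma newton_potential_solves_poisson:
  fixes f g :: "'a::euclidean_space \<Rightarrow> real" and p :: real
  assumes N: "DIM('a) \<ge> 2" and p: "real DIM('a) / 2 < p" "p < real DIM('a)"
    and f: "f \<in> Lp p" and g: "g \<in> borel_measurable borel" "AE x in lebesgue. f x = g x"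
  defines "u \<equiv> newton_potential g"
  shows "u \<in> L1_loc" "continuous_on UNIV u" "weak_poisson_solution u f" "((\<lambda>x. u x / norm x) \<longlongrightarrow> 0) at_infinity"
    and "\<And>v. v \<in> L1_loc \<Longrightarrow> weak_poisson_solution v f \<Longrightarrow> ess_sublinear v \<Longrightarrow> \<exists>c. AE x in lebesgue. v x = u x + c"
proof -
  obtain C where C: "\<And>f::'a \<Rightarrow> real. \<And>x z. f \<in> borel_measurable borel \<Longrightarrow> integrable lborel (\<lambda>x. \<bar>f x\<bar> powr p) \<Longrightarrow>
      \<bar>newton_potential f x - newton_potential f z\<bar> \<le> C * norm (x - z) powr (2 - real DIM('a) / p) * lborel_norm p f"
    by (rule newton_potential_Holder[OF N p]) blast
  note gi = Lp_representative(1)[OF f g]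
  have fm: "f \<in> borel_measurable lebesgue" using f by (simp add: Lp_def)
  define K where "K = C * lborel_norm p g"
  define \<alpha> where "\<alpha> = 2 - real DIM('a) / p"
  have "p > 0" using p N by linarith
  hence \<alpha>: "0 < \<alpha>" "\<alpha> < 1" using p by (auto simp: \<alpha>_def field_simps)
  have H: "\<bar>u x - u z\<bar> \<le> K * norm (x - z) powr \<alpha>" for x z
    using C[OF g(1) gi, of x z] by (simp add: u_def K_def \<alpha>_def mult.commute mult.left_commute)
  show cont: "continuous_on UNIV u" by (rule continuous_if_Holder[OF H \<alpha>(1)])
  show "u \<in> L1_loc" by (rule continuous_locally_integrable(2)[OF cont])
  have um: "u \<in> borel_measurable borel" by (rule borel_measurable_continuous_onI[OF cont])
  have um': "u \<in> borel_measurable lebesgue" using um by (auto intro: measurable_completion)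
  show ws: "weak_poisson_solution u f"
  proof (rule weak_poisson_solution_borel[OF fm g um' um AE_I2[OF refl], THEN iffD2])
    show "\<forall>\<phi>\<in>test_functions. (LBINT x. u x * laplacian \<phi> x) = - (LBINT x. g x * \<phi> x)"
      unfolding u_def using newton_potential_weak_solution[OF N p g(1) gi] by blast
  qed
  have "u 0 = 0" by (simp add: u_def newton_potential_def)
  with \<alpha>(2) show sub: "((\<lambda>x. u x / norm x) \<longlongrightarrow> 0) at_infinity"
    by (intro sublinear_if_Holder[of u K \<alpha>]) (use H[of _ 0] in auto)
  show "\<exists>c. AE x in lebesgue. v x = u x + c" if "v \<in> L1_loc" "weak_poisson_solution v f" "ess_sublinear v" for v
    by (rule sublinear_poisson_solution_unique[OF fm cont ws sub that])
qed

theorem theorem1p1: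
  fixes p :: real
  defines "N \<equiv> real CARD('n::finite)"
  assumes "N \<ge> 2" and "N / 2 < p" and "p \<le> N"
  shows
    "(p < N \<longrightarrow>
       (\<exists>C::real. \<forall>f\<in>Lp p. \<exists>u::real^'n \<Rightarrow> real.
          u \<in> L1_loc \<and> continuous_on UNIV u \<and> weak_poisson_solution u f \<and>
          (\<forall>x z. \<bar>u x - u z\<bar> \<le> C * norm (x - z) powr (2 - N / p) * Lp_norm p f) \<and>
          ((\<lambda>x. u x / norm x) \<longlongrightarrow> 0) at_infinity \<and>
          (\<forall>v. v \<in> L1_loc \<and> weak_poisson_solution v f \<and> ess_sublinear v \<longrightarrow>
               (\<exists>c. AE x in lebesgue. v x = u x + c))))
     \<and>
     (p = N \<longrightarrow>
       (\<forall>q. 1 < q \<and> q < N \<longrightarrow>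
         (\<exists>C::real. \<forall>f\<in>Lp N \<inter> Lp q. \<exists>u::real^'n \<Rightarrow> real.
            u \<in> L1_loc \<and> continuous_on UNIV u \<and> weak_poisson_solution u f \<and>
            (\<forall>x z. \<bar>u x - u z\<bar>
                \<le> C * norm (x - z) * (\<bar>ln (norm (x - z))\<bar> + 1) powr (1 / holder_conj N)
                    * (Lp_norm N f + Lp_norm q f)) \<and>
            ((\<lambda>x. u x / norm x) \<longlongrightarrow> 0) at_infinity \<and>
            (\<forall>v. v \<in> L1_loc \<and> weak_poisson_solution v f \<and> ess_sublinear v \<longrightarrow>
                 (\<exists>c. AE x in lebesgue. v x = u x + c)))))"
proof (intro conjI impI allI)
  have dim: "real DIM(real^'n) = N" by (simp add: N_def)
  have N2: "DIM(real^'n) \<ge> 2" using assms(2) dim by linarith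
  {
    assume pN: "p < N"
    have p: "real DIM(real^'n) / 2 < p" "p < real DIM(real^'n)" unfolding dim by (fact assms(3), fact pN)
    obtain C where C: "\<And>f::real^'n \<Rightarrow> real. \<And>x z. f \<in> borel_measurable borel \<Longrightarrow> integrable lborel (\<lambda>x. \<bar>f x\<bar> powr p) \<Longrightarrow>
        \<bar>newton_potential f x - newton_potential f z\<bar> \<le> C * norm (x - z) powr (2 - N / p) * lborel_norm p f"
      by (rule newton_potential_Holder[OF N2 p, unfolded dim]) blast
    show "\<exists>C::real. \<forall>f\<in>Lp p. \<exists>u::real^'n \<Rightarrow> real.
          u \<in> L1_loc \<and> continuous_on UNIV u \<and> weak_poisson_solution u f \<and>
          (\<forall>x z. \<bar>u x - u z\<bar> \<le> C * norm (x - z) powr (2 - N / p) * Lp_norm p f) \<and>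
          ((\<lambda>x. u x / norm x) \<longlongrightarrow> 0) at_infinity \<and>
          (\<forall>v. v \<in> L1_loc \<and> weak_poisson_solution v f \<and> ess_sublinear v \<longrightarrow>
               (\<exists>c. AE x in lebesgue. v x = u x + c))" (is "\<exists>C. \<forall>f\<in>_. ?Q C f")
    proof (intro exI[of _ C] ballI)
      fix f :: "real^'n \<Rightarrow> real" assume f: "f \<in> Lp p"
      obtain g where g: "g \<in> borel_measurable borel" "AE x in lebesgue. f x = g x"
        using f borel_representative[of f] by (auto simp: Lp_def)
      note sol = newton_potential_solves_poisson[OF N2 p f g]
      have "\<forall>x z. \<bar>newton_potential g x - newton_potential g z\<bar> \<le> C * norm (x - z) powr (2 - N / p) * Lp_norm p f"
        unfolding Lp_representative(2)[OF f g] using C[OF g(1) Lp_representative(1)[OF f g]] by blast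
      with sol show "?Q C f"
        by (intro exI[of _ "newton_potential g"]) blast
    qed
  next
    fix q :: real assume "1 < q \<and> q < N"
    hence q: "1 < q" "q < real DIM(real^'n)" unfolding dim by auto
    \<comment> \<open>A subcritical exponent between \<open>q\<close> and \<open>N\<close>: the data lie in \<open>Lp r\<close>, so the Newton potential has all
      properties of the subcritical case, and only the modulus of continuity must be shown.\<close>
    define r where "r = (max q (N / 2) + N) / 2"
    have r: "real DIM(real^'n) / 2 < r" "r < real DIM(real^'n)" "q \<le> r" "r \<le> N"
      using q assms(2) unfolding dim r_def by auto
    obtain C where C: "\<And>f::real^'n \<Rightarrow> real. \<And>x z. f \<in> borel_measurable borel \<Longrightarrow> integrable lborel (\<lambda>x. \<bar>f x\<bar> powr N) \<Longrightarrow>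
      integrable lborel (\<lambda>x. \<bar>f x\<bar> powr q) \<Longrightarrow>
      (LBINT y. \<bar>newton_increment x z y * f y\<bar>)
         \<le> C * norm (x - z) * (\<bar>ln (norm (x - z))\<bar> + 1) powr (1 / holder_conj N) *
            (lborel_norm N f + lborel_norm q f)"
      using newton_kernel_log_bound[OF N2 q, unfolded dim] by blast
    let ?m = "newton_mass TYPE(real^'n)"
    have m: "?m > 0" by (rule newton_mass_pos)
    show "\<exists>C::real. \<forall>f\<in>Lp N \<inter> Lp q. \<exists>u::real^'n \<Rightarrow> real.
            u \<in> L1_loc \<and> continuous_on UNIV u \<and> weak_poisson_solution u f \<and>
            (\<forall>x z. \<bar>u x - u z\<bar>
                \<le> C * norm (x - z) * (\<bar>ln (norm (x - z))\<bar> + 1) powr (1 / holder_conj N)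
                    * (Lp_norm N f + Lp_norm q f)) \<and>
            ((\<lambda>x. u x / norm x) \<longlongrightarrow> 0) at_infinity \<and>
            (\<forall>v. v \<in> L1_loc \<and> weak_poisson_solution v f \<and> ess_sublinear v \<longrightarrow>
                 (\<exists>c. AE x in lebesgue. v x = u x + c))" (is "\<exists>C. \<forall>f\<in>_. ?Q C f")
    proof (intro exI[of _ "C / ?m"] ballI)
      fix f :: "real^'n \<Rightarrow> real" assume "f \<in> Lp N \<inter> Lp q"
      hence f: "f \<in> Lp N" "f \<in> Lp q" by auto
      have fr: "f \<in> Lp r" by (rule Lp_interpolation[OF f r(3,4)])
      obtain g where g: "g \<in> borel_measurable borel" "AE x in lebesgue. f x = g x"
        using f borel_representative[of f] by (auto simp: Lp_def)
      note sol = newton_potential_solves_poisson[OF N2 r(1,2) fr g]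
      have ki: "integrable lborel (\<lambda>y. newton_increment x 0 y * g y)" for x
        by (rule integrable_newton_kernel_diff[OF N2 r(1,2) g(1) Lp_representative(1)[OF fr g]])
      have "\<bar>newton_potential g x - newton_potential g z\<bar>
                \<le> C / ?m * norm (x - z) * (\<bar>ln (norm (x - z))\<bar> + 1) powr (1 / holder_conj N)
                    * (Lp_norm N f + Lp_norm q f)" for x z
      proof -
        have "\<bar>newton_potential g x - newton_potential g z\<bar>
          \<le> (LBINT y. \<bar>newton_increment x z y * g y\<bar>) / ?m"
          by (rule newton_potential_diff_le[OF ki])
        also have "\<dots> \<le> (C * norm (x - z) * (\<bar>ln (norm (x - z))\<bar> + 1) powr (1 / holder_conj N) *
            (Lp_norm N f + Lp_norm q f)) / ?m"
          unfolding Lp_representative(2)[OF f(1) g] Lp_representative(2)[OF f(2) g]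
          using m C[OF g(1) Lp_representative(1)[OF f(1) g] Lp_representative(1)[OF f(2) g]]
          by (intro divide_right_mono) auto
        finally show ?thesis by simp
      qed
      with sol show "?Q (C / ?m) f"
        by (intro exI[of _ "newton_potential g"]) blast
    qed
  }
qed

end
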